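(* Let $d$ be the left-invariant sub-Riemannian metric on $SO_0(2,1)$ described in the context. Let $C=(c_{ij})\in SO_0(2,1)$. Put $|\eta|=\arccos\left(\frac{c_{22}+c_{33}}{1+c_{11}}\right)$, let $\beta$ be the parameter of a shortest arc from $e$ to $C$ (i.e. $C=\gamma(\beta,\phi;t)$ with $t=d(e,C)$ for some $\phi$), and put $|\mu|=\sqrt{1-\beta^2\frac{c_{11}-1}{1+c_{11}}}$, $\theta=\pi\left(\sqrt{\frac{1+c_{11}}{2}}-1\right)$. 0. If $C\in \mathrm{Sim}$ then $d(e,C)=\operatorname{arccosh} c_{11}$. If $C\notin \mathrm{Sim}$ then the following statements hold. I. If $C\in SO(2)$ then $|\beta|\geq \frac{3}{\sqrt5}$, $d(e,C)=\frac{2\pi}{\sqrt{\beta^2-1}}$, and $|\beta|$ is the unique number defined by the equality $$\frac{2|\beta|\pi}{\sqrt{\beta^2-1}}=\arccos\left(\frac{c_{22}+c_{33}}{1+c_{11}}\right)+2\pi .$$ II. If $|\eta|=\theta$ then $|\beta|=\sqrt{\frac{1+c_{11}}{c_{11}-1}}$ and $d(e,C)=\pi\sqrt{\frac{c_{11}-1}{2}}$. Moreover, $|\beta|=\frac{2}{\sqrt3}$ only if $|\eta|=\pi$; otherwise $|\beta|>\frac{2}{\sqrt3}$. III. If $|\eta|>\theta$ then $\frac{2}{\sqrt3}<|\beta|<\sqrt{\frac{1+c_{11}}{c_{11}-1}}$ (the right-hand side being $+\infty$ if $c_{11}=1$). If $|\eta|=\pi$ then $|\beta|\leq\frac{3}{\sqrt5}$.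 In general, $d(e,C)=(2\pi-\gamma)/\sqrt{\beta^2-1}$, where $$|\eta|=(2\pi-\gamma)\frac{|\beta|}{\sqrt{\beta^2-1}}-2\arccos(-|\mu|),\qquad 0\leq\gamma<\pi,\qquad \cos\gamma=\beta^2-c_{11}(\beta^2-1).$$ IV. If $|\eta|<\theta$ then, putting $\alpha=\sqrt{2(c_{11}-1)}-2\arccos\sqrt{\frac{2}{1+c_{11}}}$: a) If $|\eta|=\alpha$ then $|\beta|=1$ and $d(e,C)=\sqrt{2(c_{11}-1)}$. b) If $|\eta|<\alpha$ then $0<|\beta|<1$, $|\beta|$ is an (implicit) solution of the equation $$|\eta|=2\left(\frac{|\beta|}{\sqrt{1-\beta^2}}\operatorname{arccosh}\left(\sqrt{\frac{1+c_{11}}{2}}\,|\mu|\right)-\arccos|\mu|\right),$$ and $$d(e,C)=\frac{2}{\sqrt{1-\beta^2}}\operatorname{arccosh}\left(\sqrt{\frac{1+c_{11}}{2}}\,|\mu|\right).$$ c) If $|\eta|>\alpha$ then $1<|\beta|<\sqrt{\frac{1+c_{11}}{c_{11}-1}}$. If $|\eta|=\pi$ then $|\beta|<\frac{2}{\sqrt3}$. In general, $d(e,C)=\gamma/\sqrt{\beta^2-1}$, where $$|\eta|=\gamma\frac{|\beta|}{\sqrt{\beta^2-1}}-2\arccos|\mu|,\qquad 0<\gamma<\pi,\qquad \cos\gamma=\beta^2-c_{11}(\beta^2-1).$$ V. For every $C\in SO_0(2,1)$, the equalities and inequalities on $|\beta|$, $\gamma$ and $d(e,C)$ listed in whichever of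 the cases 0, I, II, III, IV a), IV b), IV c) of this theorem applies to $C$ uniquely define $d(e,C)$.
   Context: $SO_0(2,1)$ is the connected component of the unit $e$ in the group of linear transformations of $\mathbb{R}^3$ preserving the form $-ts+x_1y_1+x_2y_2$; it consists of real $3\times3$ matrices $C=(c_{ij})$ with $C^{-1}=IC^TI$, $I=\operatorname{diag}(-1,1,1)$, $c_{11}\ge1$, $\det C=1$. For a $2\times 2$ matrix $A$, $1\otimes A$ denotes the block-diagonal matrix with blocks $1$ and $A$; $SO(2)$ is identified with the subgroup $1\otimes SO(2)$ of $SO_0(2,1)$, and $E_2$ is the $2\times2$ identity matrix. $\mathrm{Sim}$ is the set of all symmetric matrices in $SO_0(2,1)\setminus\{1\otimes(-E_2)\}$ (it contains $e$). The Lie algebra $\mathfrak{so}(2,1)$ has the basis $$a=\begin{pmatrix}0&1&0\\1&0&0\\0&0&0\end{pmatrix},\quad b=\begin{pmatrix}0&0&1\\0&0&0\\1&0&0\end{pmatrix},\quad c=\begin{pmatrix}0&0&0\\0&0&-1\\0&1&0\end{pmatrix}.$$ $D$ is the left-invariant distribution on $SO_0(2,1)$ with $D(e)=\operatorname{span}(a,b)$, with the left-invariant scalar product for which $a,b$ is an orthonormal basis of $D(e)$; $d$ is the corresponding left-invariant sub-Riemannian (Carnot–Carathéodory) metric. Every arclength-parametrized geodesic of $d$ with $\gamma(0)=e$ has the form $$\gamma(\beta,\phi;t)=\exp\big(t(\cos\phi\, a+\sin\phi\, b-\beta c)\big)\exp(t\beta c),\quad t\in\mathbb{R},$$ with constants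 $\phi,\beta\in\mathbb{R}$. A shortest arc is a geodesic segment whose length equals the distance $d$ between its ends. *)

theory Defs
  imports "HOL-Analysis.Analysis"
begin

type_synonym mat3 = "real^3^3"

text \<open>The coordinates of a vector are ordered as \<open>(t, x\<^sub>1, x\<^sub>2)\<close>.\<close>

definition lorentz_form :: "real^3 \<Rightarrow> real^3 \<Rightarrow> real" where
  "lorentz_form v w = - (v$1 * w$1) + v$2 * w$2 + v$3 * w$3"

definition O21 :: "mat3 set" where
  "O21 = {A. \<forall>v w. lorentz_form (A *v v) (A *v w) = lorentz_form v w}"

definition SO21 :: "mat3 set" where
  "SO21 = connected_component_set O21 (mat 1)"

definition block1 :: "real^2^2 \<Rightarrow> mat3" where
  "block1 A = vector [vector [1, 0, 0],
                      vector [0, A$1$1, A$1$2],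
                      vector [0, A$2$1, A$2$2]]"

definition SO2 :: "mat3 set" where
  "SO2 = block1 ` {A. rotation_matrix A}"

definition Sim :: "mat3 set" where
  "Sim = {C \<in> SO21 - {block1 (- mat 1)}. transpose C = C}"

definition gen_a :: mat3 where
  "gen_a = vector [vector [0, 1, 0], vector [1, 0, 0], vector [0, 0, 0]]"

definition gen_b :: mat3 where
  "gen_b = vector [vector [0, 0, 1], vector [0, 0, 0], vector [1, 0, 0]]"

definition gen_c :: mat3 where
  "gen_c = vector [vector [0, 0, 0], vector [0, 0, -1], vector [0, 1, 0]]"

text \<open>The left translates \<open>g ** gen_a\<close>, \<open>g ** gen_b\<close> form an orthonormal basis of the distribution
  at \<open>g\<close>. So a piecewise \<open>C\<^sup>1\<close> path \<open>p\<close> is horizontal iff its velocity is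
  \<open>p t ** (u t *\<^sub>R gen_a + v t *\<^sub>R gen_b)\<close> off a finite set, and its speed is
  then \<open>sqrt ((u t)\<^sup>2 + (v t)\<^sup>2)\<close>. A \<open>valid_path\<close> may have unbounded velocity near a
  break point; requiring the integral to exist excludes paths of infinite length.\<close>

definition horizontal_path_of_length :: "(real \<Rightarrow> mat3) \<Rightarrow> real \<Rightarrow> bool" where
  "horizontal_path_of_length p L \<longleftrightarrow>
     valid_path p \<and> path_image p \<subseteq> SO21 \<and>
     (\<exists>u v S. finite S \<and>
        (\<forall>t\<in>{0..1} - S.
           (p has_vector_derivative p t ** (u t *\<^sub>R gen_a + v t *\<^sub>R gen_b)) (at t)) \<and>
        ((\<lambda>t. sqrt ((u t)\<^sup>2 + (v t)\<^sup>2)) has_integral L) {0..1})"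

definition sr_dist :: "mat3 \<Rightarrow> mat3 \<Rightarrow> real" where
  "sr_dist A B = Inf {L. \<exists>p. horizontal_path_of_length p L \<and> pathstart p = A \<and> pathfinish p = B}"

text \<open>Multiplication on the type of matrices is componentwise, so the library
  constant \<open>exp\<close> is not available for the matrix exponential.\<close>

definition mat_exp :: "mat3 \<Rightarrow> mat3" where
  "mat_exp A = (\<Sum>n. (1 / fact n) *\<^sub>R (((**) A) ^^ n) (mat 1))"

definition geodesic :: "real \<Rightarrow> real \<Rightarrow> real \<Rightarrow> mat3" where
  "geodesic \<beta> \<phi> t =
     mat_exp (t *\<^sub>R (cos \<phi> *\<^sub>R gen_a + sin \<phi> *\<^sub>R gen_b - \<beta> *\<^sub>R gen_c)) ** mat_exp ((t * \<beta>) *\<^sub>R gen_c)"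

text \<open>The geodesics are parametrized by arclength, so the segment over \<open>[0, t]\<close> is a
  shortest arc iff \<open>t\<close> equals the distance between its ends.\<close>

definition shortest_arc_param :: "mat3 \<Rightarrow> real \<Rightarrow> bool" where
  "shortest_arc_param C \<beta> \<longleftrightarrow> (\<exists>\<phi>. C = geodesic \<beta> \<phi> (sr_dist (mat 1) C))"

definition abs_eta :: "mat3 \<Rightarrow> real" where
  "abs_eta C = arccos ((C$2$2 + C$3$3) / (1 + C$1$1))"

definition abs_mu :: "mat3 \<Rightarrow> real \<Rightarrow> real" where
  "abs_mu C \<beta> = sqrt (1 - \<beta>\<^sup>2 * ((C$1$1 - 1) / (1 + C$1$1)))"

definition theta :: "mat3 \<Rightarrow> real" where
  "theta C = pi * (sqrt ((1 + C$1$1) / 2) - 1)"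

definition alpha :: "mat3 \<Rightarrow> real" where
  "alpha C = sqrt (2 * (C$1$1 - 1)) - 2 * arccos (sqrt (2 / (1 + C$1$1)))"

text \<open>The relations between \<open>C\<close>, \<open>b = \<bar>\<beta>\<bar>\<close>, \<open>\<gamma>\<close> and the distance \<open>d\<close> in each of the cases.\<close>

definition rel_0 :: "mat3 \<Rightarrow> real \<Rightarrow> bool" where
  "rel_0 C d \<longleftrightarrow> d = arcosh (C$1$1)"

definition eq_I :: "mat3 \<Rightarrow> real \<Rightarrow> bool" where
  "eq_I C b \<longleftrightarrow>
     2 * b * pi / sqrt (b\<^sup>2 - 1) = arccos ((C$2$2 + C$3$3) / (1 + C$1$1)) + 2 * pi"

definition rel_I :: "mat3 \<Rightarrow> real \<Rightarrow> real \<Rightarrow> bool" where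
  "rel_I C b d \<longleftrightarrow> b \<ge> 3 / sqrt 5 \<and> d = 2 * pi / sqrt (b\<^sup>2 - 1) \<and> eq_I C b"

definition rel_II :: "mat3 \<Rightarrow> real \<Rightarrow> real \<Rightarrow> bool" where
  "rel_II C b d \<longleftrightarrow>
     b = sqrt ((1 + C$1$1) / (C$1$1 - 1)) \<and>
     d = pi * sqrt ((C$1$1 - 1) / 2) \<and>
     (b = 2 / sqrt 3 \<longrightarrow> abs_eta C = pi) \<and>
     (b \<noteq> 2 / sqrt 3 \<longrightarrow> b > 2 / sqrt 3)"

text \<open>For \<open>C$1$1 = 1\<close> the upper bound on \<open>b\<close> is \<open>+\<infinity>\<close>, whereas division by zero yields \<open>0\<close>.\<close>

definition rel_III :: "mat3 \<Rightarrow> real \<Rightarrow> real \<Rightarrow> real \<Rightarrow> bool" where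
  "rel_III C b \<gamma> d \<longleftrightarrow>
     2 / sqrt 3 < b \<and>
     (C$1$1 \<noteq> 1 \<longrightarrow> b < sqrt ((1 + C$1$1) / (C$1$1 - 1))) \<and>
     (abs_eta C = pi \<longrightarrow> b \<le> 3 / sqrt 5) \<and>
     d = (2 * pi - \<gamma>) / sqrt (b\<^sup>2 - 1) \<and>
     abs_eta C = (2 * pi - \<gamma>) * (b / sqrt (b\<^sup>2 - 1)) - 2 * arccos (- abs_mu C b) \<and>
     0 \<le> \<gamma> \<and> \<gamma> < pi \<and> cos \<gamma> = b\<^sup>2 - C$1$1 * (b\<^sup>2 - 1)"

definition rel_IVa :: "mat3 \<Rightarrow> real \<Rightarrow> real \<Rightarrow> bool" where
  "rel_IVa C b d \<longleftrightarrow> b = 1 \<and> d = sqrt (2 * (C$1$1 - 1))"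

definition rel_IVb :: "mat3 \<Rightarrow> real \<Rightarrow> real \<Rightarrow> bool" where
  "rel_IVb C b d \<longleftrightarrow>
     0 < b \<and> b < 1 \<and>
     abs_eta C = 2 * (b / sqrt (1 - b\<^sup>2) * arcosh (sqrt ((1 + C$1$1) / 2) * abs_mu C b)
                      - arccos (abs_mu C b)) \<and>
     d = 2 / sqrt (1 - b\<^sup>2) * arcosh (sqrt ((1 + C$1$1) / 2) * abs_mu C b)"

definition rel_IVc :: "mat3 \<Rightarrow> real \<Rightarrow> real \<Rightarrow> real \<Rightarrow> bool" where
  "rel_IVc C b \<gamma> d \<longleftrightarrow>
     1 < b \<and> b < sqrt ((1 + C$1$1) / (C$1$1 - 1)) \<and>
     (abs_eta C = pi \<longrightarrow> b < 2 / sqrt 3) \<and>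
     d = \<gamma> / sqrt (b\<^sup>2 - 1) \<and>
     abs_eta C = \<gamma> * (b / sqrt (b\<^sup>2 - 1)) - 2 * arccos (abs_mu C b) \<and>
     0 < \<gamma> \<and> \<gamma> < pi \<and> cos \<gamma> = b\<^sup>2 - C$1$1 * (b\<^sup>2 - 1)"

end

theory Submission
  imports Defs
begin

text \<open>
  Write \<open>z = cosh \<rho>\<close> for the entry \<open>C$1$1\<close> and \<open>\<psi>\<close> for the total rotation angle of \<open>C\<close>, so that
  \<open>abs_eta C\<close> is the distance from \<open>\<psi>\<close> to the multiples of \<open>2\<pi>\<close>. Along a horizontal path of
  speed \<open>m\<close> these satisfy \<open>\<rho>'\<^sup>2 + coth\<^sup>2 (\<rho>/2) \<psi>'\<^sup>2 \<le> m\<^sup>2\<close>, and rotations about the origin account for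
  the remaining coordinate. Every length bound comes from a function that is monotone along all horizontal
  paths by Cauchy--Schwarz and constant along the geodesics with parameter \<open>b\<close>:
  for \<open>b \<le> 1\<close> it is the length minus a solution \<open>b \<psi> + f(\<rho>)\<close> of the eikonal equation; for \<open>b > 1\<close> no such
  solution exists for large \<open>\<rho>\<close>, but with \<open>l\<close> the length so far and \<open>k\<^sup>2 = b\<^sup>2 - 1\<close>,
  \<open>b l - \<psi> - 2 arccos (cos (k l/2) / cosh (\<rho>/2))\<close> is monotone everywhere. It comes from the reverse triangle
  inequality for timelike curves in the biinvariant Lorentzian metric of the group.
  Hence a geodesic from \<open>e\<close> to \<open>C\<close> whose lifted angle is \<open>abs_eta C\<close> up to sign and with \<open>k t \<le> 2\<pi>\<close> is a
  shortest arc. Uniqueness of \<open>d\<close> and \<open>\<bar>\<beta>\<bar>\<close> therefore needs no monotonicity of the transcendental equations,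
  and their solutions exist by the intermediate value theorem.
\<close>

subsection \<open>Matrix entries in the Lorentz group\<close>

text \<open>The function for \<open>b > 1\<close> arises as follows. Right multiplication of a
  horizontal unit-speed path at length \<open>l\<close> by the rotation through \<open>- b l\<close>
  gives a curve whose velocity has square \<open>1 - b\<^sup>2 = - k\<^sup>2\<close> in the
  biinvariant form with values 1, 1, -1 on \<open>gen_a\<close>, \<open>gen_b\<close>,
  \<open>gen_c\<close>: it is timelike with proper time \<open>k l\<close>. It has the same \<rho>
  and total angle \<open>\<psi> - b l\<close>, so by the trace in SL(2,R) the largest proper time
  \<tau> from \<open>e\<close> satisfies
  \<open>cos (\<tau>/2) = cosh (\<rho>/2) cos ((b l - \<psi>)/2)\<close>. The reverse triangle
  inequality \<open>k l \<le> \<tau>\<close> makes the function nonnegative. Geodesics become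
  one-parameter subgroups, which gives equality until their first return to SO(2) at
  \<open>k l = 2 \<pi>\<close>.

  Identifying \<bar>\<beta>\<bar> meets another obstacle: a shortest arc comes with an arbitrary
  \<beta> and might run past its first return to SO(2), where the end point equations no longer
  separate parameters. But the function of the known extremal must be constant along the whole arc,
  and evaluating it at the return gives a contradiction.\<close>

definition lorentz_matrix :: mat3 where
  "lorentz_matrix = vector [vector [-1, 0, 0], vector [0, 1, 0], vector [0, 0, 1]]"

lemmas mat3_entries = matrix_matrix_mult_def matrix_vector_mult_def mat_def transpose_def
  vec_eq_iff forall_3 sum_3

lemma O21_iff: "A \<in> O21 \<longleftrightarrow> transpose A ** lorentz_matrix ** A = lorentz_matrix"
proof -
  have eq: "lorentz_form v w = v \<bullet> (lorentz_matrix *v w)" for v w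
    by (simp add: lorentz_form_def lorentz_matrix_def inner_vec_def matrix_vector_mult_def sum_3)
  have "lorentz_form (A *v v) (A *v w) = v \<bullet> ((transpose A ** lorentz_matrix ** A) *v w)" for v w
    unfolding eq
    by (metis dot_lmul_matrix matrix_vector_mul_assoc transpose_matrix_vector transpose_transpose)
  then show ?thesis
    unfolding O21_def eq mem_Collect_eq
    by (metis matrix_eq vector_eq_rdot inner_commute)
qed

lemma O21_inverse:
  assumes "A \<in> O21"
  shows "(lorentz_matrix ** transpose A ** lorentz_matrix) ** A = mat 1"
    and "A ** (lorentz_matrix ** transpose A ** lorentz_matrix) = mat 1"
proof -
  have J: "lorentz_matrix ** lorentz_matrix = mat 1"
    by (simp add: lorentz_matrix_def mat3_entries)
  show "(lorentz_matrix ** transpose A ** lorentz_matrix) ** A = mat 1"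
    using assms J unfolding O21_iff by (metis matrix_mul_assoc)
  then show "A ** (lorentz_matrix ** transpose A ** lorentz_matrix) = mat 1"
    using matrix_left_right_inverse by blast
qed

lemma O21_mult: "A \<in> O21 \<Longrightarrow> B \<in> O21 \<Longrightarrow> A ** B \<in> O21"
  by (simp add: O21_def flip: matrix_vector_mul_assoc)

lemma O21_columns:
  assumes "A \<in> O21"
  shows "(A$1$1)\<^sup>2 = 1 + (A$2$1)\<^sup>2 + (A$3$1)\<^sup>2" "(A$2$2)\<^sup>2 + (A$3$2)\<^sup>2 = 1 + (A$1$2)\<^sup>2"
    "(A$2$3)\<^sup>2 + (A$3$3)\<^sup>2 = 1 + (A$1$3)\<^sup>2"
  using O21_inverse(1)[OF assms]
  by (auto simp: lorentz_matrix_def mat3_entries power2_eq_square)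

lemma O21_rows:
  assumes "A \<in> O21"
  shows "A$1$1 * A$1$1 - A$1$2 * A$1$2 - A$1$3 * A$1$3 = 1"
    "A$2$2 * A$2$2 + A$2$3 * A$2$3 - A$2$1 * A$2$1 = 1"
    "A$3$2 * A$3$2 + A$3$3 * A$3$3 - A$3$1 * A$3$1 = 1"
    "A$1$2 * A$2$2 + A$1$3 * A$2$3 = A$1$1 * A$2$1"
    "A$1$2 * A$3$2 + A$1$3 * A$3$3 = A$1$1 * A$3$1"
    "A$2$2 * A$3$2 + A$2$3 * A$3$3 = A$2$1 * A$3$1"
proof -
  have "\<And>i j. (A ** (lorentz_matrix ** transpose A ** lorentz_matrix))$i$j = mat 1$i$j"
    by (simp only: O21_inverse(2)[OF assms])
  note e = this[unfolded lorentz_matrix_def mat3_entries]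
  show "A$1$1 * A$1$1 - A$1$2 * A$1$2 - A$1$3 * A$1$3 = 1"
    using e[of 1 1] by simp
  show "A$2$2 * A$2$2 + A$2$3 * A$2$3 - A$2$1 * A$2$1 = 1"
    using e[of 2 2] by simp
  show "A$3$2 * A$3$2 + A$3$3 * A$3$3 - A$3$1 * A$3$1 = 1"
    using e[of 3 3] by simp
  show "A$1$2 * A$2$2 + A$1$3 * A$2$3 = A$1$1 * A$2$1"
    using e[of 1 2] by simp
  show "A$1$2 * A$3$2 + A$1$3 * A$3$3 = A$1$1 * A$3$1"
    using e[of 1 3] by simp
  show "A$2$2 * A$3$2 + A$2$3 * A$3$3 = A$2$1 * A$3$1"
    using e[of 2 3] by simp
qed

lemma det_sq_O21:
  assumes "A \<in> O21"
  shows "(det A)\<^sup>2 = 1"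
proof -
  have "det A * det lorentz_matrix * det A = det lorentz_matrix"
    by (metis O21_iff assms det_mul det_transpose)
  moreover have "det lorentz_matrix = -1"
    by (simp add: lorentz_matrix_def det_3)
  ultimately show ?thesis by (simp add: power2_eq_square)
qed

text \<open>A continuous function whose square is at least 1 on \<open>O21\<close> never enters the
  interval (-1, 1), so on the component of the identity it keeps the sign it has there. It serves
  for the entry \<open>A$1$1\<close> and for the determinant.\<close>

lemma SO21_connected_value:
  assumes A: "A \<in> SO21" and f: "continuous_on UNIV (f :: mat3 \<Rightarrow> real)"
    and "\<And>B. B \<in> O21 \<Longrightarrow> 1 \<le> (f B)\<^sup>2" and "f (mat 1) > 0"
  shows "f A \<ge> 1"
proof (rule ccontr)
  assume "\<not> f A \<ge> 1"
  have sub: "SO21 \<subseteq> O21"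
    by (simp add: SO21_def connected_component_subset)
  then have "f A < 0"
    using assms(3)[of A] A \<open>\<not> f A \<ge> 1\<close>
    by (smt (verit) one_power2 power2_eq_square mult_le_one subsetD mult_left_le_one_le mult_nonneg_nonneg)
  have "connected (f ` SO21)"
    unfolding SO21_def
    by (intro connected_continuous_image connected_connected_component continuous_on_subset[OF f]) auto
  moreover have "mat 1 \<in> SO21"
    using A unfolding SO21_def by (metis connected_component_eq_empty connected_component_refl_eq empty_iff mem_Collect_eq)
  ultimately have "0 \<in> f ` SO21"
    using connected_contains_Icc[of "f ` SO21" "f A" "f (mat 1)"] A \<open>f A < 0\<close> assms(4)
    by (meson atLeastAtMost_iff image_eqI less_imp_le subset_iff)
  then show False
    using assms(3) sub by force
qed

lemma SO21_O21: "A \<in> SO21 \<Longrightarrow> A \<in> O21"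
  unfolding SO21_def using connected_component_subset by blast

lemma SO21_z_ge1:
  assumes "A \<in> SO21"
  shows "A$1$1 \<ge> 1"
proof (rule SO21_connected_value[OF assms])
  show "continuous_on UNIV (\<lambda>A :: mat3. A$1$1)"
    by (intro continuous_intros)
  show "1 \<le> (B$1$1)\<^sup>2" if "B \<in> O21" for B
    using O21_columns(1)[OF that] by simp
qed (simp add: mat_def)

lemma SO21_det:
  assumes "A \<in> SO21"
  shows "det A = 1"
proof -
  have "det A \<ge> 1"
  proof (rule SO21_connected_value[OF assms])
    show "continuous_on UNIV (\<lambda>A :: mat3. det A)"
      unfolding det_3 by (intro continuous_intros)
    show "1 \<le> (det B)\<^sup>2" if "B \<in> O21" for B
      using det_sq_O21[OF that] by simp
  qed simp
  then show ?thesis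
    using det_sq_O21[OF SO21_O21[OF assms]] by (simp add: power2_eq_1_iff)
qed

text \<open>\<open>K\<close> is the adjugate. For determinant 1 it is the inverse of
  \<open>A\<close>, and so is \<open>lorentz_matrix ** transpose A ** lorentz_matrix\<close>;
  comparing entries expresses entries of \<open>A\<close> by 2x2 minors.\<close>

lemma SO21_cofactors:
  assumes "A \<in> SO21"
  shows "A$1$1 = A$2$2 * A$3$3 - A$2$3 * A$3$2"
    "A$2$1 = A$3$3 * A$1$2 - A$3$2 * A$1$3"
    "A$3$1 = A$2$2 * A$1$3 - A$2$3 * A$1$2"
    "A$2$2 = A$1$1 * A$3$3 - A$1$3 * A$3$1"
    "A$3$3 = A$1$1 * A$2$2 - A$1$2 * A$2$1"
    "A$2$3 = A$1$2 * A$3$1 - A$1$1 * A$3$2"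
    "A$3$2 = A$1$3 * A$2$1 - A$1$1 * A$2$3"
proof -
  define K :: mat3 where "K = vector [
    vector [A$2$2 * A$3$3 - A$2$3 * A$3$2, A$1$3 * A$3$2 - A$1$2 * A$3$3, A$1$2 * A$2$3 - A$1$3 * A$2$2],
    vector [A$2$3 * A$3$1 - A$2$1 * A$3$3, A$1$1 * A$3$3 - A$1$3 * A$3$1, A$1$3 * A$2$1 - A$1$1 * A$2$3],
    vector [A$2$1 * A$3$2 - A$2$2 * A$3$1, A$1$2 * A$3$1 - A$1$1 * A$3$2, A$1$1 * A$2$2 - A$1$2 * A$2$1]]"
  have "K ** A = det A *\<^sub>R mat 1"
    by (simp add: K_def det_3 mat3_entries) (simp add: algebra_simps)
  then have "K = lorentz_matrix ** transpose A ** lorentz_matrix"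
    using O21_inverse(2)[OF SO21_O21[OF assms]] SO21_det[OF assms]
    by (metis matrix_mul_assoc matrix_mul_lid matrix_mul_rid scaleR_one)
  then have "K$i$j = (lorentz_matrix ** transpose A ** lorentz_matrix)$i$j" for i j
    by simp
  note e = this[unfolded K_def lorentz_matrix_def mat3_entries]
  show "A$1$1 = A$2$2 * A$3$3 - A$2$3 * A$3$2"
    using e[of 1 1] by simp
  show "A$2$1 = A$3$3 * A$1$2 - A$3$2 * A$1$3"
    using e[of 1 2] by (simp add: mult.commute)
  show "A$3$1 = A$2$2 * A$1$3 - A$2$3 * A$1$2"
    using e[of 1 3] by (simp add: mult.commute)
  show "A$2$2 = A$1$1 * A$3$3 - A$1$3 * A$3$1"
    using e[of 2 2] by simp
  show "A$3$3 = A$1$1 * A$2$2 - A$1$2 * A$2$1"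
    using e[of 3 3] by simp
  show "A$2$3 = A$1$2 * A$3$1 - A$1$1 * A$3$2"
    using e[of 3 2] by simp
  show "A$3$2 = A$1$3 * A$2$1 - A$1$1 * A$2$3"
    using e[of 2 3] by simp
qed

section \<open>Complex coordinates on the identity component\<close>

definition boost :: "mat3 \<Rightarrow> complex" where
  "boost A = Complex (A$1$2) (A$1$3)"

text \<open>For \<open>A = R(\<psi>\<^sub>1) B R(\<psi>\<^sub>2)\<close> with a boost \<open>B\<close> this is \<open>(1 + A$1$1) cis (\<psi>\<^sub>1 + \<psi>\<^sub>2)\<close>.\<close>

definition twist :: "mat3 \<Rightarrow> complex" where
  "twist A = Complex (A$2$2 + A$3$3) (A$3$2 - A$2$3)"

lemma SO21_norm_boost:
  assumes "A \<in> SO21"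
  shows "(cmod (boost A))\<^sup>2 = (A$1$1)\<^sup>2 - 1"
  using O21_rows(1)[OF SO21_O21[OF assms]]
  by (simp add: boost_def cmod_def power2_eq_square)

lemma SO21_norm_twist:
  assumes "A \<in> SO21"
  shows "cmod (twist A) = 1 + A$1$1"
proof -
  have "(cmod (twist A))\<^sup>2 = (1 + A$1$1)\<^sup>2"
    using SO21_cofactors(1)[OF assms] O21_columns[OF SO21_O21[OF assms]] O21_rows(1)[OF SO21_O21[OF assms]]
    unfolding cmod_power2 unfolding twist_def complex.sel power2_eq_square by algebra
  then show ?thesis
    using SO21_z_ge1[OF assms] by (simp add: power2_eq_iff_nonneg)
qed

text \<open>For \<open>A = R(\<psi>1) B R(\<psi>2)\<close> the first row and first column of the
  boost \<open>B\<close> point in the same direction; the left rotation turns the column by \<psi>1,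
  the right one turns the row by -\<psi>2. The twist angle is therefore the angle from the row to
  the column.\<close>

lemma SO21_column_relation:
  assumes "A \<in> SO21"
  shows "of_real (1 + A$1$1) * Complex (A$2$1) (A$3$1) = twist A * boost A"
proof -
  note c = SO21_cofactors[OF assms] and r = O21_rows[OF SO21_O21[OF assms]]
  have "(1 + A$1$1) * A$2$1 = (A$2$2 + A$3$3) * A$1$2 - (A$3$2 - A$2$3) * A$1$3"
    using c(2) r(4) by algebra
  moreover have "(1 + A$1$1) * A$3$1 = (A$2$2 + A$3$3) * A$1$3 + (A$3$2 - A$2$3) * A$1$2"
    using c(3) r(5) by algebra
  ultimately show ?thesis
    by (simp add: twist_def boost_def complex_eq_iff)
qed

text \<open>Seen as a real-linear map of the complex plane, the lower block has complex-linear part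
  \<open>twist A / 2\<close>; the number on the left is, up to the factor \<open>1 + A$1$1\<close>,
  twice the coefficient of its antilinear part.\<close>

lemma SO21_antilinear_relation:
  assumes "A \<in> SO21"
  shows "of_real (1 + A$1$1) * Complex (A$2$2 - A$3$3) (A$3$2 + A$2$3)
    = Complex (A$2$1) (A$3$1) * boost A"
proof -
  note c = SO21_cofactors[OF assms]
  have "(1 + A$1$1) * (A$2$2 - A$3$3) = A$2$1 * A$1$2 - A$3$1 * A$1$3"
    using c(4,5) by algebra
  moreover have "(1 + A$1$1) * (A$3$2 + A$2$3) = A$2$1 * A$1$3 + A$3$1 * A$1$2"
    using c(6,7) by algebra
  ultimately show ?thesis
    by (simp add: boost_def complex_eq_iff)
qed

text \<open>The modulus of \<open>twist\<close> gives \<open>A$1$1\<close>, after which the two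
  preceding relations give the first column and the antilinear part of the lower block. This is how
  a matrix is recognised as the end point of a geodesic.\<close>

lemma SO21_eqI:
  assumes A: "A \<in> SO21" and B: "B \<in> SO21" and "boost A = boost B" "twist A = twist B"
  shows "A = B"
proof -
  have z: "A$1$1 = B$1$1"
    using SO21_norm_twist[OF A] SO21_norm_twist[OF B] assms(4) by simp
  then have "of_real (1 + A$1$1) \<noteq> (0 :: complex)"
    using SO21_z_ge1[OF A] of_real_eq_0_iff[where 'a = complex, of "1 + A$1$1"] by linarith
  then have c: "Complex (A$2$1) (A$3$1) = Complex (B$2$1) (B$3$1)"
    using SO21_column_relation[OF A] SO21_column_relation[OF B] assms(3,4) z
    by (metis mult_cancel_left)
  moreover have "Complex (A$2$2 - A$3$3) (A$3$2 + A$2$3) = Complex (B$2$2 - B$3$3) (B$3$2 + B$2$3)"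
    using SO21_antilinear_relation[OF A] SO21_antilinear_relation[OF B] assms(3) c z
      \<open>of_real (1 + A$1$1) \<noteq> (0 :: complex)\<close>
    by (metis mult_cancel_left)
  ultimately show ?thesis
    using z assms(3,4) by (auto simp: vec_eq_iff forall_3 boost_def twist_def)
qed

lemma SO21_abs_eta:
  assumes "A \<in> SO21"
  shows "0 \<le> abs_eta A" "abs_eta A \<le> pi" "Re (twist A) = (1 + A$1$1) * cos (abs_eta A)"
    "\<bar>Im (twist A)\<bar> = (1 + A$1$1) * sin (abs_eta A)"
proof -
  have z: "1 + A$1$1 > 0"
    using SO21_z_ge1[OF assms] by simp
  have n: "(Re (twist A))\<^sup>2 + (Im (twist A))\<^sup>2 = (1 + A$1$1)\<^sup>2"
    using SO21_norm_twist[OF assms] by (simp add: cmod_power2[symmetric])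
  have "\<bar>Re (twist A)\<bar> \<le> 1 + A$1$1"
    using abs_Re_le_cmod[of "twist A"] SO21_norm_twist[OF assms] by simp
  then have r: "\<bar>Re (twist A) / (1 + A$1$1)\<bar> \<le> 1"
    using z by (simp add: abs_divide divide_le_eq_1)
  have e: "abs_eta A = arccos (Re (twist A) / (1 + A$1$1))"
    by (simp add: abs_eta_def twist_def)
  show "0 \<le> abs_eta A" "abs_eta A \<le> pi"
    using r[unfolded abs_le_iff] unfolding e by (intro arccos_lbound arccos_ubound; linarith)+
  have "cos (abs_eta A) = Re (twist A) / (1 + A$1$1)"
    using r unfolding e by (simp add: cos_arccos_abs)
  then show re: "Re (twist A) = (1 + A$1$1) * cos (abs_eta A)"
    using z by simp
  have "(Im (twist A))\<^sup>2 = ((1 + A$1$1) * sin (abs_eta A))\<^sup>2"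
    using n sin_cos_squared_add[of "abs_eta A"] unfolding re by algebra
  then have "\<bar>Im (twist A)\<bar> = \<bar>(1 + A$1$1) * sin (abs_eta A)\<bar>"
    by (metis real_sqrt_abs)
  also have "\<dots> = (1 + A$1$1) * sin (abs_eta A)"
    using sin_ge_zero[OF \<open>0 \<le> abs_eta A\<close> \<open>abs_eta A \<le> pi\<close>] z
    by (intro abs_of_nonneg mult_nonneg_nonneg) linarith+
  finally show "\<bar>Im (twist A)\<bar> = (1 + A$1$1) * sin (abs_eta A)" .
qed

text \<open>Symmetry makes \<open>twist C\<close> real. If the boost is nonzero, equality of the
  first row and the first column forces the twist to be positive. If it is zero, the lower block is
  plus or minus the identity, and the excluded matrix is exactly the one with angle \<pi>.\<close>

lemma Sim_iff:
  assumes "C \<in> SO21"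
  shows "C \<in> Sim \<longleftrightarrow> abs_eta C = 0"
proof
  assume "abs_eta C = 0"
  then have t: "Im (twist C) = 0" "Re (twist C) = 1 + C$1$1"
    using SO21_abs_eta(3,4)[OF assms] by auto
  then have "twist C = of_real (1 + C$1$1)"
    by (simp add: complex_eq_iff)
  moreover have "of_real (1 + C$1$1) \<noteq> (0 :: complex)"
    using SO21_z_ge1[OF assms] of_real_eq_0_iff[where 'a = complex, of "1 + C$1$1"] by linarith
  ultimately have "Complex (C$2$1) (C$3$1) = boost C"
    using SO21_column_relation[OF assms] by simp
  with t have "transpose C = C"
    by (auto simp: twist_def boost_def transpose_def vec_eq_iff forall_3)
  moreover have "C \<noteq> block1 (- mat 1)"
  proof
    assume "C = block1 (- mat 1)"
    then have "C$2$2 + C$3$3 = -2" "C$1$1 = 1"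
      by (auto simp: block1_def mat_def)
    with t show False
      by (simp add: twist_def)
  qed
  ultimately show "C \<in> Sim"
    using assms by (simp add: Sim_def)
next
  assume C: "C \<in> Sim"
  then have sym: "C$i$j = C$j$i" for i j
    by (auto simp: Sim_def transpose_def vec_eq_iff)
  have col: "Complex (C$2$1) (C$3$1) = boost C" "Im (twist C) = 0"
    using sym[of 2 1] sym[of 3 1] sym[of 3 2] by (simp_all add: boost_def twist_def)
  show "abs_eta C = 0"
  proof (cases "boost C = 0")
    case False
    then have "twist C = of_real (1 + C$1$1)"
      using SO21_column_relation[OF assms] col by (metis mult_cancel_right)
    then have "Re (twist C) = 1 + C$1$1" by simp
    then show ?thesis
      unfolding abs_eta_def using SO21_z_ge1[OF assms] by (simp add: twist_def)
  next
    case True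
    then have z: "C$1$2 = 0" "C$1$3 = 0" "C$2$1 = 0" "C$3$1 = 0"
      using sym[of 2 1] sym[of 3 1] by (simp_all add: boost_def complex_eq_iff)
    then have 1: "C$1$1 = 1"
      using O21_rows(1)[OF SO21_O21[OF assms]] SO21_z_ge1[OF assms]
      by (simp add: power2_eq_1_iff flip: power2_eq_square)
    have e: "C$2$2 = C$3$3" "C$3$2 = 0" "C$2$3 = 0"
    proof -
      have "C$2$2 = 1 * C$3$3 - 0" "C$2$3 = 0 - 1 * C$3$2"
        using SO21_cofactors(4,6)[OF assms] unfolding 1 z by simp_all
      then show "C$2$2 = C$3$3" "C$3$2 = 0" "C$2$3 = 0"
        using sym[of 2 3] by linarith+
    qed
    then have "C$2$2 = 1 \<or> C$2$2 = -1"
      using O21_rows(2)[OF SO21_O21[OF assms]] z by (simp add: power2_eq_1_iff flip: power2_eq_square)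
    moreover have "C$2$2 \<noteq> -1"
    proof
      assume "C$2$2 = -1"
      then have "C = block1 (- mat 1)"
        using e z 1 by (simp add: block1_def mat_def vec_eq_iff forall_3)
      with C show False by (simp add: Sim_def)
    qed
    ultimately show ?thesis
      using e 1 by (simp add: abs_eta_def)
  qed
qed

lemma SO2_z: "C \<in> SO2 \<Longrightarrow> C$1$1 = 1"
  by (auto simp: SO2_def block1_def)

subsection \<open>Two calibrations for the reduced problem\<close>

lemma nondecreasing_off_finite:
  fixes f :: "real \<Rightarrow> real"
  assumes "a \<le> b" "finite K" "continuous_on {a..b} f"
    and d: "\<And>t. t \<in> {a<..<b} - K \<Longrightarrow> \<exists>y\<ge>0. (f has_real_derivative y) (at t)"
  shows "f a \<le> f b"
proof -
  define g where "g t = (if t \<in> {a<..<b} - K then deriv f t else 0)" for t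
  have "(g has_integral (f b - f a)) {a..b}"
  proof (rule fundamental_theorem_of_calculus_interior_strong[where S = "K"])
    show "(f has_vector_derivative g x) (at x)" if "x \<in> {a<..<b} - K" for x
      using d[OF that] that
      by (auto simp: g_def DERIV_imp_deriv simp flip: has_real_derivative_iff_has_vector_derivative)
  qed (use assms in auto)
  moreover have "g t \<ge> 0" for t
    using d[of t] by (auto simp: g_def DERIV_imp_deriv)
  ultimately have "0 \<le> f b - f a"
    by (rule has_integral_nonneg)
  then show ?thesis by simp
qed

text \<open>The projection of a horizontal path to \<open>z = A$1$1\<close> and to the argument \<open>\<psi>\<close> of its twist, with
  arc length \<open>l\<close>: these are the curves of length \<open>l\<close> for
  \<open>d\<rho>\<^sup>2 + coth\<^sup>2 (\<rho>/2) d\<psi>\<^sup>2\<close>, \<open>z = cosh \<rho>\<close>, where the inequality accounts for the degeneration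
  at \<open>z = 1\<close> and makes the notion stable under increasing \<open>z\<close>.\<close>

definition reduced_curve :: "(real \<Rightarrow> real) \<Rightarrow> (real \<Rightarrow> real) \<Rightarrow> (real \<Rightarrow> real) \<Rightarrow> bool" where
  "reduced_curve z \<psi> l \<longleftrightarrow>
     continuous_on {0..1} z \<and> continuous_on {0..1} \<psi> \<and> continuous_on {0..1} l \<and>
     (\<forall>t\<in>{0..1}. 1 \<le> z t) \<and>
     (\<exists>K. finite K \<and> (\<forall>t\<in>{0<..<1} - K. \<exists>P Q m.
        (z has_real_derivative P) (at t) \<and> (\<psi> has_real_derivative Q) (at t) \<and>
        (l has_real_derivative m) (at t) \<and> 0 \<le> m \<and>
        P\<^sup>2 + ((1 + z t) * Q)\<^sup>2 \<le> ((z t)\<^sup>2 - 1) * m\<^sup>2))"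

lemma reduced_curve_uminus:
  assumes "reduced_curve z \<psi> l"
  shows "reduced_curve z (\<lambda>t. - \<psi> t) l"
proof -
  obtain K where K: "finite K" "\<And>t. t \<in> {0<..<1} - K \<Longrightarrow> \<exists>P Q m.
        (z has_real_derivative P) (at t) \<and> (\<psi> has_real_derivative Q) (at t) \<and>
        (l has_real_derivative m) (at t) \<and> 0 \<le> m \<and>
        P\<^sup>2 + ((1 + z t) * Q)\<^sup>2 \<le> ((z t)\<^sup>2 - 1) * m\<^sup>2"
    using assms unfolding reduced_curve_def by blast
  have "\<exists>P Q m. (z has_real_derivative P) (at t) \<and> ((\<lambda>t. - \<psi> t) has_real_derivative Q) (at t) \<and>
        (l has_real_derivative m) (at t) \<and> 0 \<le> m \<and>
        P\<^sup>2 + ((1 + z t) * Q)\<^sup>2 \<le> ((z t)\<^sup>2 - 1) * m\<^sup>2" if t: "t \<in> {0<..<1} - K" for t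
  proof -
    obtain P Q m where "(z has_real_derivative P) (at t)" "(\<psi> has_real_derivative Q) (at t)"
        "(l has_real_derivative m) (at t)" "0 \<le> m"
        "P\<^sup>2 + ((1 + z t) * Q)\<^sup>2 \<le> ((z t)\<^sup>2 - 1) * m\<^sup>2"
      using K(2)[OF t] by blast
    then show ?thesis
      by (intro exI[of _ P] exI[of _ "- Q"] exI[of _ m])
        (auto intro: DERIV_minus simp: power_mult_distrib)
  qed
  then show ?thesis
    using assms K(1) unfolding reduced_curve_def by (auto intro: continuous_intros)
qed

text \<open>For \<open>1 < z\<close> the bound reads \<open>P\<^sup>2 / (z\<^sup>2 - 1) + (z + 1) /
  (z - 1) * Q\<^sup>2 \<le> m\<^sup>2\<close>, and both coefficients decrease in \<open>z\<close>.
  The form without division includes \<open>z = 1\<close>, where it forces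
  \<open>P = Q = 0\<close>.\<close>

lemma shifted_speed_bound:
  fixes z e P Q m :: real
  assumes "1 \<le> z" "0 \<le> e" and le: "P\<^sup>2 + ((1 + z) * Q)\<^sup>2 \<le> (z\<^sup>2 - 1) * m\<^sup>2"
  shows "P\<^sup>2 + ((1 + (z + e)) * Q)\<^sup>2 \<le> ((z + e)\<^sup>2 - 1) * m\<^sup>2"
proof -
  have "((1 + z) * Q)\<^sup>2 \<le> (z\<^sup>2 - 1) * m\<^sup>2"
    using le zero_le_power2[of P] by linarith
  also have "\<dots> \<le> (1 + z)\<^sup>2 * m\<^sup>2"
    using assms(1) by (intro mult_right_mono) (auto simp: power2_eq_square algebra_simps)
  finally have Q: "Q\<^sup>2 \<le> m\<^sup>2"
    using assms(1) by (simp add: power_mult_distrib)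
  have "(1 + z) * ((1 + z) * Q\<^sup>2) = ((1 + z) * Q)\<^sup>2" "(1 + z) * ((z - 1) * m\<^sup>2) = (z\<^sup>2 - 1) * m\<^sup>2"
    by (simp_all add: power2_eq_square algebra_simps)
  then have "(1 + z) * ((1 + z) * Q\<^sup>2) \<le> (1 + z) * ((z - 1) * m\<^sup>2)"
    using le zero_le_power2[of P] by linarith
  then have Q': "(1 + z) * Q\<^sup>2 \<le> (z - 1) * m\<^sup>2"
    using assms(1) by simp
  have "((1 + (z + e)) * Q)\<^sup>2 - ((1 + z) * Q)\<^sup>2 = e * (2 * ((1 + z) * Q\<^sup>2) + e * Q\<^sup>2)"
    by (simp add: power2_eq_square algebra_simps)
  also have "\<dots> \<le> e * (2 * ((z - 1) * m\<^sup>2) + e * m\<^sup>2)"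
    using Q Q' assms(2) by (intro mult_left_mono add_mono) auto
  also have "\<dots> \<le> e * (2 * (z * m\<^sup>2) + e * m\<^sup>2)"
    using assms(2) by (intro mult_left_mono add_mono mult_right_mono) auto
  also have "\<dots> = ((z + e)\<^sup>2 - 1) * m\<^sup>2 - (z\<^sup>2 - 1) * m\<^sup>2"
    by (simp add: power2_eq_square algebra_simps)
  finally show ?thesis
    using le by linarith
qed

text \<open>The shifted curve stays admissible by \<open>shifted_speed_bound\<close>, so it is
  enough to check a sign above \<open>z = 1\<close>, although the curves of interest start at
  \<open>z = 1\<close> and may return to it.\<close>

lemma reduced_curve_nondecreasing:
  fixes G :: "real \<Rightarrow> real \<Rightarrow> real \<Rightarrow> real"
  assumes curve: "reduced_curve z \<psi> l" and "0 \<le> t1" "t1 \<le> t2" "t2 \<le> 1"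
    and cont: "\<And>t. t \<in> {0..1} \<Longrightarrow> continuous_on {0..} (\<lambda>e. G (z t + e) (\<psi> t) (l t))"
    and cont': "\<And>e. 0 < e \<Longrightarrow> continuous_on {0..1} (\<lambda>t. G (z t + e) (\<psi> t) (l t))"
    and deriv: "\<And>x \<psi> l t P Q m. \<lbrakk>(x has_real_derivative P) (at t); (\<psi> has_real_derivative Q) (at t);
        (l has_real_derivative m) (at t); 0 \<le> m; 1 < x t;
        P\<^sup>2 + ((1 + x t) * Q)\<^sup>2 \<le> ((x t)\<^sup>2 - 1) * m\<^sup>2\<rbrakk>
        \<Longrightarrow> \<exists>y\<ge>0. ((\<lambda>t. G (x t) (\<psi> t) (l t)) has_real_derivative y) (at t)"
  shows "G (z t1) (\<psi> t1) (l t1) \<le> G (z t2) (\<psi> t2) (l t2)"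
proof -
  \<comment> \<open>\<open>G\<close> need not be differentiable at \<open>z = 1\<close>, hence the shift by \<open>e\<close>.\<close>
  define D where "D e t = G (z t + e) (\<psi> t) (l t)" for e t
  obtain K where K: "finite K" "\<And>t. t \<in> {0<..<1} - K \<Longrightarrow> \<exists>P Q m.
        (z has_real_derivative P) (at t) \<and> (\<psi> has_real_derivative Q) (at t) \<and>
        (l has_real_derivative m) (at t) \<and> 0 \<le> m \<and>
        P\<^sup>2 + ((1 + z t) * Q)\<^sup>2 \<le> ((z t)\<^sup>2 - 1) * m\<^sup>2"
    and z1: "\<And>t. t \<in> {0..1} \<Longrightarrow> 1 \<le> z t"
    using curve unfolding reduced_curve_def by blast
  have mono: "D e t1 \<le> D e t2" if "0 < e" for e
  proof (rule nondecreasing_off_finite[OF \<open>t1 \<le> t2\<close> K(1)])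
    show "continuous_on {t1..t2} (D e)"
      unfolding D_def using assms(2-4) by (intro continuous_on_subset[OF cont'[OF that]]) auto
    fix t assume "t \<in> {t1<..<t2} - K"
    then have t: "t \<in> {0<..<1} - K"
      using assms(2,4) by auto
    obtain P Q m where PQ: "(z has_real_derivative P) (at t)" "(\<psi> has_real_derivative Q) (at t)"
        "(l has_real_derivative m) (at t)" "0 \<le> m"
        "P\<^sup>2 + ((1 + z t) * Q)\<^sup>2 \<le> ((z t)\<^sup>2 - 1) * m\<^sup>2"
      using K(2)[OF t] by blast
    have "1 \<le> z t"
      using z1 t by simp
    show "\<exists>y\<ge>0. (D e has_real_derivative y) (at t)"
      unfolding D_def
    proof (rule deriv[of "\<lambda>t. z t + e"])
      show "((\<lambda>t. z t + e) has_real_derivative P) (at t)"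
        using DERIV_add[OF PQ(1) DERIV_const[of e]] by simp
      show "P\<^sup>2 + ((1 + (z t + e)) * Q)\<^sup>2 \<le> ((z t + e)\<^sup>2 - 1) * m\<^sup>2"
        using shifted_speed_bound[OF \<open>1 \<le> z t\<close> _ PQ(5)] that by simp
    qed (use PQ \<open>1 \<le> z t\<close> that in auto)
  qed
  have lim: "((\<lambda>e. D e t) \<longlongrightarrow> D 0 t) (at_right 0)" if "t \<in> {0..1}" for t
  proof -
    have "((\<lambda>e. D e t) \<longlongrightarrow> D 0 t) (at 0 within {0..})"
      using cont[OF that, unfolded continuous_on_def, rule_format, of 0] by (simp add: D_def)
    then show ?thesis
      by (rule tendsto_within_subset) auto
  qed
  have "D 0 t1 \<le> D 0 t2"
    using assms(2-4)
    by (intro tendsto_le[OF trivial_limit_at_right_real lim lim])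
      (auto intro!: eventually_at_rightI[of 0 1] mono)
  then show ?thesis
    by (simp add: D_def)
qed

text \<open>With \<open>c = cosh (\<rho>/2)\<close> and \<open>k\<close>, \<sigma> the cosine and
  sine of \<open>\<kappa> l / 2\<close>, Cauchy--Schwarz is applied twice: to the velocity against
  \<open>(r, k)\<close>, where \<open>r\<^sup>2 + k\<^sup>2 = c\<^sup>2\<close>, and to
  \<open>(1, \<kappa>)\<close> against \<open>(s, \<sigma>)\<close>, where
  \<open>1 + \<kappa>\<^sup>2 = \<beta>\<^sup>2\<close>.\<close>

lemma fast_speed_inequality:
  fixes c k \<sigma> \<beta> \<kappa> m P Q :: real
  assumes "c > 1" "k\<^sup>2 + \<sigma>\<^sup>2 = 1" "\<beta>\<^sup>2 = \<kappa>\<^sup>2 + 1" "0 \<le> \<beta>" "0 \<le> m"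
    and PQ: "P\<^sup>2 + (2 * c\<^sup>2 * Q)\<^sup>2 \<le> 4 * c\<^sup>2 * (c\<^sup>2 - 1) * m\<^sup>2"
  shows "(\<kappa> * \<sigma> * m + k * P / (2 * c\<^sup>2)) / sqrt (c\<^sup>2 - k\<^sup>2) \<le> \<beta> * m - Q"
proof -
  define r s where "r = sqrt (c\<^sup>2 - k\<^sup>2)" and "s = sqrt (c\<^sup>2 - 1)"
  have c2: "c\<^sup>2 > 1"
    using \<open>c > 1\<close> by (simp add: power2_eq_square less_1_mult)
  have "k\<^sup>2 \<le> 1"
    using assms(2) zero_le_power2[of \<sigma>] by linarith
  then have r2: "r\<^sup>2 = c\<^sup>2 - k\<^sup>2" and r: "r > 0"
    using c2 by (auto simp: r_def)
  have s2: "s\<^sup>2 = c\<^sup>2 - 1" and s: "s \<ge> 0"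
    using c2 by (auto simp: s_def)
  have "(r * (2 * c\<^sup>2 * Q) + k * P)\<^sup>2 \<le> (r\<^sup>2 + k\<^sup>2) * (P\<^sup>2 + (2 * c\<^sup>2 * Q)\<^sup>2)"
    using zero_le_power2[of "r * P - k * (2 * c\<^sup>2 * Q)"] by (simp add: power2_eq_square algebra_simps)
  also have "\<dots> \<le> (r\<^sup>2 + k\<^sup>2) * (4 * c\<^sup>2 * (c\<^sup>2 - 1) * m\<^sup>2)"
    by (intro mult_left_mono PQ) simp
  also have "\<dots> = (2 * c\<^sup>2 * (s * m))\<^sup>2"
    unfolding r2 power_mult_distrib s2 by (simp add: power2_eq_square algebra_simps)
  finally have "r * (2 * c\<^sup>2 * Q) + k * P \<le> 2 * c\<^sup>2 * (s * m)"
    by (rule power2_le_imp_le) (use c2 s \<open>0 \<le> m\<close> in auto)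
  moreover have "(r * Q + k * P / (2 * c\<^sup>2)) * (2 * c\<^sup>2) = r * (2 * c\<^sup>2 * Q) + k * P"
    using \<open>c > 1\<close> by (simp add: distrib_right)
  ultimately have "(r * Q + k * P / (2 * c\<^sup>2)) * (2 * c\<^sup>2) \<le> (s * m) * (2 * c\<^sup>2)"
    by (simp only: mult_ac)
  then have 1: "r * Q + k * P / (2 * c\<^sup>2) \<le> s * m"
    by (rule mult_right_le_imp_le) (use c2 in linarith)
  have "(s + \<kappa> * \<sigma>)\<^sup>2 \<le> (1 + \<kappa>\<^sup>2) * (s\<^sup>2 + \<sigma>\<^sup>2)"
    using zero_le_power2[of "\<sigma> - \<kappa> * s"] by (simp add: power2_eq_square algebra_simps)
  also have "\<dots> = (\<beta> * r)\<^sup>2"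
  proof -
    have "s\<^sup>2 + \<sigma>\<^sup>2 = c\<^sup>2 - k\<^sup>2"
      using assms(2) s2 by linarith
    then show ?thesis
      unfolding power_mult_distrib r2 assms(3) by simp
  qed
  finally have "s + \<kappa> * \<sigma> \<le> \<beta> * r"
    by (rule power2_le_imp_le) (use r \<open>0 \<le> \<beta>\<close> in auto)
  then have "(s + \<kappa> * \<sigma>) * m \<le> \<beta> * r * m"
    using \<open>0 \<le> m\<close> by (rule mult_right_mono)
  with 1 have "\<kappa> * \<sigma> * m + k * P / (2 * c\<^sup>2) \<le> (\<beta> * m - Q) * r"
    by (simp add: algebra_simps)
  then show ?thesis
    using r by (simp add: r_def[symmetric] pos_divide_le_eq)
qed

text \<open>The denominator is \<open>cosh (\<rho>/2) \<ge> 1\<close>, so the arccos is defined for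
  every \<rho>, unlike a solution of the eikonal equation. At \<open>z = 1\<close> its argument can
  be 1 or -1, where arccos is not differentiable; this is what the shift in
  \<open>reduced_curve_nondecreasing\<close> avoids.\<close>

lemma fast_phase_nondecreasing:
  fixes \<beta> \<kappa> :: real
  assumes curve: "reduced_curve z \<psi> l" and t: "0 \<le> t1" "t1 \<le> t2" "t2 \<le> 1"
    and \<beta>: "\<beta>\<^sup>2 = \<kappa>\<^sup>2 + 1" "0 \<le> \<beta>"
  defines "D \<equiv> \<lambda>t. \<beta> * l t - \<psi> t - 2 * arccos (cos (\<kappa> * l t / 2) / sqrt ((1 + z t) / 2))"
  shows "D t1 \<le> D t2"
  unfolding D_def
proof (rule reduced_curve_nondecreasing[OF curve t,
      of "\<lambda>x \<psi> l. \<beta> * l - \<psi> - 2 * arccos (cos (\<kappa> * l / 2) / sqrt ((1 + x) / 2))"])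
  have c: "continuous_on {0..1} z" "continuous_on {0..1} \<psi>" "continuous_on {0..1} l"
    and z1: "\<And>t. t \<in> {0..1} \<Longrightarrow> 1 \<le> z t"
    using curve unfolding reduced_curve_def by blast+
  have bound: "\<bar>cos y / sqrt ((1 + x) / 2)\<bar> \<le> 1" if "1 \<le> x" for x y :: real
  proof -
    have "\<bar>cos y\<bar> \<le> 1" "1 \<le> sqrt ((1 + x) / 2)"
      using that by auto
    then have "\<bar>cos y\<bar> \<le> \<bar>sqrt ((1 + x) / 2)\<bar>" by linarith
    then show ?thesis
      by (simp add: abs_divide divide_le_eq_1)
  qed
  then have bounds: "- 1 \<le> cos y / sqrt ((1 + x) / 2)" "cos y / sqrt ((1 + x) / 2) \<le> 1"
    if "1 \<le> x" for x y :: real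
    using that by (smt (verit, best))+
  show "continuous_on {0..} (\<lambda>e. \<beta> * l t - \<psi> t - 2 * arccos (cos (\<kappa> * l t / 2) / sqrt ((1 + (z t + e)) / 2)))"
    if "t \<in> {0..1}" for t
    using z1[OF that]
    by (intro continuous_intros ballI conjI bounds) (auto simp: add_nonneg_eq_0_iff)
  show "continuous_on {0..1} (\<lambda>t. \<beta> * l t - \<psi> t - 2 * arccos (cos (\<kappa> * l t / 2) / sqrt ((1 + (z t + e)) / 2)))"
    if "0 < e" for e
    using that z1
    by (intro continuous_intros ballI conjI bounds c) (force dest: z1)+
next
  fix x \<psi> l :: "real \<Rightarrow> real" and t P Q m
  assume x: "(x has_real_derivative P) (at t)" and \<psi>: "(\<psi> has_real_derivative Q) (at t)"
    and l: "(l has_real_derivative m) (at t)" and "0 \<le> m" "1 < x t"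
    and le: "P\<^sup>2 + ((1 + x t) * Q)\<^sup>2 \<le> ((x t)\<^sup>2 - 1) * m\<^sup>2"
  define c k \<sigma> where "c = sqrt ((1 + x t) / 2)" "k = cos (\<kappa> * l t / 2)" "\<sigma> = sin (\<kappa> * l t / 2)"
  have c: "c > 1" "c\<^sup>2 = (1 + x t) / 2"
    using \<open>1 < x t\<close> by (auto simp: c_k_\<sigma>_def)
  have c2: "c\<^sup>2 > 1"
    using \<open>1 < x t\<close> c(2) by simp
  have k: "k\<^sup>2 + \<sigma>\<^sup>2 = 1"
    by (simp add: c_k_\<sigma>_def)
  have "\<bar>k\<bar> \<le> 1"
    by (simp add: c_k_\<sigma>_def)
  then have "- 1 < k / c" "k / c < 1"
    using c(1) by (auto simp: field_simps abs_le_iff)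
  have "k\<^sup>2 \<le> 1"
    using k zero_le_power2[of \<sigma>] by linarith
  have dk: "((\<lambda>t. cos (\<kappa> * l t / 2)) has_real_derivative - (\<kappa> * m / 2 * \<sigma>)) (at t)"
    by (auto intro!: derivative_eq_intros l simp: c_k_\<sigma>_def)
  have dc: "((\<lambda>t. sqrt ((1 + x t) / 2)) has_real_derivative P / (4 * c)) (at t)"
    using \<open>1 < x t\<close> by (auto intro!: derivative_eq_intros x simp: c_k_\<sigma>_def field_simps)
  define X where "X = (- (\<kappa> * m / 2 * \<sigma>) * c - k * (P / (4 * c))) / c\<^sup>2"
  have dX: "((\<lambda>t. cos (\<kappa> * l t / 2) / sqrt ((1 + x t) / 2)) has_real_derivative X) (at t)"
    using DERIV_divide[OF dk dc] c(1) by (simp add: X_def c_k_\<sigma>_def(1,2)[symmetric] power2_eq_square)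
  have da: "((\<lambda>t. arccos (cos (\<kappa> * l t / 2) / sqrt ((1 + x t) / 2))) has_real_derivative
      inverse (- sqrt (1 - (k / c)\<^sup>2)) * X) (at t)"
    using DERIV_chain2[OF DERIV_arccos dX] \<open>- 1 < k / c\<close> \<open>k / c < 1\<close> by (simp add: c_k_\<sigma>_def)
  have "1 - (k / c)\<^sup>2 = (c\<^sup>2 - k\<^sup>2) / c\<^sup>2"
    using c(1) by (simp add: power_divide field_simps)
  then have "sqrt (1 - (k / c)\<^sup>2) = sqrt (c\<^sup>2 - k\<^sup>2) / c"
    using c(1) by (simp add: real_sqrt_divide)
  moreover have "sqrt (c\<^sup>2 - k\<^sup>2) > 0"
    using c2 \<open>k\<^sup>2 \<le> 1\<close> by simp
  moreover have "2 * (inverse (- (y / c)) * X) = (\<kappa> * \<sigma> * m + k * P / (2 * c\<^sup>2)) / y" if "y > 0" for y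
    using c(1) that unfolding X_def by (simp add: field_simps power2_eq_square)
  ultimately have e: "2 * (inverse (- sqrt (1 - (k / c)\<^sup>2)) * X)
      = (\<kappa> * \<sigma> * m + k * P / (2 * c\<^sup>2)) / sqrt (c\<^sup>2 - k\<^sup>2)"
    by metis
  have "P\<^sup>2 + (2 * c\<^sup>2 * Q)\<^sup>2 \<le> 4 * c\<^sup>2 * (c\<^sup>2 - 1) * m\<^sup>2"
    using le unfolding c(2) by (simp add: power2_eq_square field_simps)
  then have "2 * (inverse (- sqrt (1 - (k / c)\<^sup>2)) * X) \<le> \<beta> * m - Q"
    unfolding e using c(1) k \<beta> \<open>0 \<le> m\<close> by (intro fast_speed_inequality)
  moreover have "((\<lambda>t. \<beta> * l t - \<psi> t - 2 * arccos (cos (\<kappa> * l t / 2) / sqrt ((1 + x t) / 2)))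
      has_real_derivative \<beta> * m - Q - 2 * (inverse (- sqrt (1 - (k / c)\<^sup>2)) * X)) (at t)"
    by (intro DERIV_diff DERIV_cmult l \<psi> da)
  ultimately show "\<exists>y\<ge>0. ((\<lambda>t. \<beta> * l t - \<psi> t - 2 * arccos (cos (\<kappa> * l t / 2) / sqrt ((1 + x t) / 2)))
      has_real_derivative y) (at t)"
    by (intro exI[of _ "\<beta> * m - Q - 2 * (inverse (- sqrt (1 - (k / c)\<^sup>2)) * X)"]) auto
qed

text \<open>The part of the slow potential depending on \<open>z\<close>, that is \<open>\<integral>\<^sub>0\<^sup>\<rho> sqrt (1 - \<beta>\<^sup>2 tanh\<^sup>2 (s/2)) ds\<close> for
  \<open>z = cosh \<rho>\<close>.\<close>

definition slow_potential :: "real \<Rightarrow> real \<Rightarrow> real" where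
  "slow_potential \<beta> z = 2 * sqrt (1 - \<beta>\<^sup>2) * arsinh (sqrt (1 - \<beta>\<^sup>2) * sqrt ((z - 1) / 2))
     + 2 * \<beta> * arcsin (\<beta> * sqrt ((z - 1) / (z + 1)))"

text \<open>\<open>s\<close> and \<open>c\<close> are sinh and cosh of \<open>\<rho>/2\<close>, so
  \<open>dz/d\<rho> = 2 s c\<close>, and the derivative is
  \<open>sqrt (1 - \<beta>\<^sup>2 tanh\<^sup>2 (\<rho>/2))\<close> divided by \<open>2 s c\<close>.
  The arsinh and arcsin parts combine through
  \<open>\<kappa>\<^sup>2 * c\<^sup>2 + \<beta>\<^sup>2 = q\<^sup>2\<close>.\<close>

lemma slow_potential_deriv:
  assumes "0 \<le> \<beta>" "\<beta> \<le> 1" "1 < z"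
  shows "(slow_potential \<beta> has_real_derivative
    sqrt ((1 + z) / 2 - \<beta>\<^sup>2 * ((z - 1) / 2)) / (sqrt ((z - 1) / 2) * (1 + z))) (at z)"
proof -
  define \<kappa> s c q where "\<kappa> = sqrt (1 - \<beta>\<^sup>2)" and "s = sqrt ((z - 1) / 2)" and "c = sqrt ((1 + z) / 2)"
    and "q = sqrt (c\<^sup>2 - \<beta>\<^sup>2 * s\<^sup>2)"
  have "\<beta>\<^sup>2 \<le> 1"
    using assms(1,2) by (simp add: power_le_one)
  then have \<kappa>: "\<kappa>\<^sup>2 = 1 - \<beta>\<^sup>2"
    by (simp add: \<kappa>_def)
  have s: "s > 0" "s\<^sup>2 = (z - 1) / 2" and c: "c > 0" "c\<^sup>2 = (1 + z) / 2"
    using assms(3) by (auto simp: s_def c_def)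
  have cs: "c\<^sup>2 = 1 + s\<^sup>2"
    unfolding s c by (simp add: field_simps)
  have "\<beta>\<^sup>2 * s\<^sup>2 \<le> 1 * s\<^sup>2"
    using \<open>\<beta>\<^sup>2 \<le> 1\<close> by (intro mult_right_mono) auto
  then have q: "q\<^sup>2 = c\<^sup>2 - \<beta>\<^sup>2 * s\<^sup>2" "q > 0"
    using cs by (auto simp: q_def)
  have q': "sqrt ((\<kappa> * s)\<^sup>2 + 1) = q"
    unfolding q_def power_mult_distrib \<kappa> cs by (simp add: algebra_simps)
  have q'': "sqrt (1 - (\<beta> * (s / c))\<^sup>2) = q / c"
  proof -
    have "1 - (\<beta> * (s / c))\<^sup>2 = q\<^sup>2 / c\<^sup>2"
      unfolding q(1) using c(1) by (simp add: power_mult_distrib power_divide field_simps)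
    then have "1 - (\<beta> * (s / c))\<^sup>2 = (q / c)\<^sup>2"
      by (simp only: power_divide)
    then show ?thesis
      using q(2) c(1) by simp
  qed
  have sc: "sqrt ((z - 1) / (z + 1)) = s / c"
  proof -
    have "(z - 1) / (z + 1) = ((z - 1) / 2) / ((1 + z) / 2)"
      using assms(3) by (simp add: divide_simps) (simp add: algebra_simps)?
    then show ?thesis
      unfolding s_def c_def by (simp only: real_sqrt_divide)
  qed
  have ds: "((\<lambda>z. sqrt ((z - 1) / 2)) has_real_derivative 1 / (4 * s)) (at z)"
    using assms(3) by (auto intro!: derivative_eq_intros simp: s_def field_simps)
  have dsc: "((\<lambda>z. sqrt ((z - 1) / (z + 1))) has_real_derivative 1 / (4 * s * c ^ 3)) (at z)"
  proof -
    have "((\<lambda>z. sqrt ((z - 1) / (z + 1))) has_real_derivative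
        (inverse (sqrt ((z - 1) / (z + 1))) / 2) * (2 / (z + 1)\<^sup>2)) (at z)"
      using assms(3) by (intro DERIV_chain2[OF DERIV_real_sqrt])
        (auto intro!: derivative_eq_intros simp: power2_eq_square field_simps)
    moreover have "(inverse (sqrt ((z - 1) / (z + 1))) / 2) * (2 / (z + 1)\<^sup>2) = 1 / (4 * s * c ^ 3)"
    proof -
      have "(z + 1)\<^sup>2 = 4 * c ^ 4"
      proof -
        have "z + 1 = 2 * c\<^sup>2"
          using c(2) by simp
        then show ?thesis
          by (simp add: power_mult_distrib flip: power_mult)
      qed
      then show ?thesis
        unfolding sc using s(1) c(1) by (simp add: field_simps power3_eq_cube power4_eq_xxxx)
    qed
    ultimately show ?thesis by simp
  qed
  have "\<bar>\<beta> * (s / c)\<bar> < 1"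
  proof (rule ccontr)
    assume "\<not> \<bar>\<beta> * (s / c)\<bar> < 1"
    then have "1 \<le> (\<beta> * (s / c))\<^sup>2"
      by (simp add: abs_square_less_1 not_less[symmetric])
    then have "sqrt (1 - (\<beta> * (s / c))\<^sup>2) \<le> 0" by simp
    then show False
      using q'' divide_pos_pos[OF q(2) c(1)] by linarith
  qed
  then have b: "- 1 < \<beta> * (s / c)" "\<beta> * (s / c) < 1" by linarith+
  have "(slow_potential \<beta> has_real_derivative
     2 * \<kappa> * (1 / sqrt ((\<kappa> * s)\<^sup>2 + 1) * (\<kappa> * (1 / (4 * s))))
     + 2 * \<beta> * (inverse (sqrt (1 - (\<beta> * (s / c))\<^sup>2)) * (\<beta> * (1 / (4 * s * c ^ 3))))) (at z)"
    unfolding slow_potential_def[abs_def] \<kappa>_def[symmetric]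
  proof (intro DERIV_add DERIV_cmult)
    show "((\<lambda>z. arsinh (\<kappa> * sqrt ((z - 1) / 2))) has_real_derivative
        1 / sqrt ((\<kappa> * s)\<^sup>2 + 1) * (\<kappa> * (1 / (4 * s)))) (at z)"
      unfolding s_def by (intro DERIV_chain2[OF arsinh_real_has_field_derivative] DERIV_cmult ds[unfolded s_def])
    show "((\<lambda>z. arcsin (\<beta> * sqrt ((z - 1) / (z + 1)))) has_real_derivative
        inverse (sqrt (1 - (\<beta> * (s / c))\<^sup>2)) * (\<beta> * (1 / (4 * s * c ^ 3)))) (at z)"
      using b unfolding sc[symmetric]
      by (intro DERIV_chain2[OF DERIV_arcsin] DERIV_cmult dsc) auto
  qed
  also have "2 * \<kappa> * (1 / sqrt ((\<kappa> * s)\<^sup>2 + 1) * (\<kappa> * (1 / (4 * s))))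
     + 2 * \<beta> * (inverse (sqrt (1 - (\<beta> * (s / c))\<^sup>2)) * (\<beta> * (1 / (4 * s * c ^ 3))))
     = (\<kappa>\<^sup>2 * c\<^sup>2 + \<beta>\<^sup>2) / (2 * q * s * c\<^sup>2)"
    unfolding q' q'' using s(1) c(1) q(2) by (simp add: field_simps power2_eq_square power3_eq_cube)
  also have "\<kappa>\<^sup>2 * c\<^sup>2 + \<beta>\<^sup>2 = q\<^sup>2"
    unfolding \<kappa> q cs by (simp add: algebra_simps)
  also have "q\<^sup>2 / (2 * q * s * c\<^sup>2) = q / (s * (2 * c\<^sup>2))"
    using q(2) by (simp add: power2_eq_square)
  also have "2 * c\<^sup>2 = 1 + z"
    using c(2) by simp
  also have "q = sqrt ((1 + z) / 2 - \<beta>\<^sup>2 * ((z - 1) / 2))"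
    unfolding q_def s c by simp
  finally show ?thesis
    unfolding s_def .
qed

lemma slow_potential_nondecreasing:
  fixes \<beta> :: real
  assumes curve: "reduced_curve z \<psi> l" and t: "0 \<le> t1" "t1 \<le> t2" "t2 \<le> 1"
    and \<beta>: "0 \<le> \<beta>" "\<beta> \<le> 1"
  defines "D \<equiv> \<lambda>t. l t - \<beta> * \<psi> t - slow_potential \<beta> (z t)"
  shows "D t1 \<le> D t2"
  unfolding D_def
proof (rule reduced_curve_nondecreasing[OF curve t, of "\<lambda>x \<psi> l. l - \<beta> * \<psi> - slow_potential \<beta> x"])
  have c: "continuous_on {0..1} z" "continuous_on {0..1} \<psi>" "continuous_on {0..1} l"
    and z1: "\<And>t. t \<in> {0..1} \<Longrightarrow> 1 \<le> z t"
    using curve unfolding reduced_curve_def by blast+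
  have b1: "\<beta> * sqrt ((x - 1) / (x + 1)) \<le> 1" "- 1 \<le> \<beta> * sqrt ((x - 1) / (x + 1))" if "1 \<le> x" for x
  proof -
    have "\<beta> * sqrt ((x - 1) / (x + 1)) \<le> 1 * 1"
      using \<beta> that by (intro mult_mono) auto
    then show "\<beta> * sqrt ((x - 1) / (x + 1)) \<le> 1" by simp
    have "0 \<le> \<beta> * sqrt ((x - 1) / (x + 1))"
      using \<beta> that by simp
    then show "- 1 \<le> \<beta> * sqrt ((x - 1) / (x + 1))" by linarith
  qed
  have sp: "continuous_on {1..} (slow_potential \<beta>)"
    unfolding slow_potential_def[abs_def]
    by (intro continuous_intros ballI conjI b1) auto
  show "continuous_on {0..} (\<lambda>e. l t - \<beta> * \<psi> t - slow_potential \<beta> (z t + e))" if "t \<in> {0..1}" for t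
    using z1[OF that] by (intro continuous_intros continuous_on_compose2[OF sp]) auto
  show "continuous_on {0..1} (\<lambda>t. l t - \<beta> * \<psi> t - slow_potential \<beta> (z t + e))" if "0 < e" for e
  proof -
    have "1 \<le> z t + e" if "t \<in> {0..1}" for t
      using z1[OF that] \<open>0 < e\<close> by linarith
    then show ?thesis
      by (intro continuous_intros continuous_on_compose2[OF sp] c) auto
  qed
next
  fix x \<psi> l :: "real \<Rightarrow> real" and t P Q m
  assume x: "(x has_real_derivative P) (at t)" and \<psi>: "(\<psi> has_real_derivative Q) (at t)"
    and l: "(l has_real_derivative m) (at t)" and "0 \<le> m" "1 < x t"
    and le: "P\<^sup>2 + ((1 + x t) * Q)\<^sup>2 \<le> ((x t)\<^sup>2 - 1) * m\<^sup>2"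
  define s f where "s = sqrt ((x t - 1) / 2)" and "f = sqrt ((1 + x t) / 2 - \<beta>\<^sup>2 * ((x t - 1) / 2))"
  have s: "s > 0" "s\<^sup>2 = (x t - 1) / 2"
    using \<open>1 < x t\<close> by (auto simp: s_def)
  have "\<beta>\<^sup>2 * ((x t - 1) / 2) \<le> 1 * ((x t - 1) / 2)"
    using \<beta> \<open>1 < x t\<close> by (intro mult_right_mono) (auto simp: power_le_one)
  also have "\<dots> \<le> (1 + x t) / 2"
    by simp
  finally have "0 \<le> (1 + x t) / 2 - \<beta>\<^sup>2 * ((x t - 1) / 2)"
    by simp
  then have f: "f\<^sup>2 = (1 + x t) / 2 - \<beta>\<^sup>2 * ((x t - 1) / 2)" "f \<ge> 0"
    unfolding f_def by (rule real_sqrt_pow2, rule real_sqrt_ge_zero)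
  \<comment> \<open>Cauchy--Schwarz against \<open>(\<beta> * s, f)\<close>, whose square length is
    \<open>(1 + x t) / 2\<close> for every \<beta>: this is the eikonal equation for
    \<open>\<beta> * \<psi> + slow_potential \<beta> z\<close>.\<close>
  have "(\<beta> * s * ((1 + x t) * Q) + f * P)\<^sup>2 \<le> ((\<beta> * s)\<^sup>2 + f\<^sup>2) * (P\<^sup>2 + ((1 + x t) * Q)\<^sup>2)"
    using zero_le_power2[of "\<beta> * s * P - f * ((1 + x t) * Q)"] by (simp add: power2_eq_square algebra_simps)
  also have "\<dots> \<le> ((\<beta> * s)\<^sup>2 + f\<^sup>2) * (((x t)\<^sup>2 - 1) * m\<^sup>2)"
    by (intro mult_left_mono le) simp
  also have "\<dots> = (s * (1 + x t) * m)\<^sup>2"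
    unfolding power_mult_distrib f s by (simp add: power2_eq_square field_simps)
  finally have "\<beta> * s * ((1 + x t) * Q) + f * P \<le> s * (1 + x t) * m"
    by (rule power2_le_imp_le) (use s \<open>0 \<le> m\<close> \<open>1 < x t\<close> in auto)
  moreover have n: "s * (1 + x t) > 0"
    using s(1) \<open>1 < x t\<close> by simp
  have "(\<beta> * Q + f / n * P) * n = \<beta> * Q * n + f * P" if "n > 0" for n
    using that by (simp add: distrib_right)
  note this[OF n]
  ultimately have "(\<beta> * Q + f / (s * (1 + x t)) * P) * (s * (1 + x t)) \<le> m * (s * (1 + x t))"
    by (simp only: mult_ac)
  then have "\<beta> * Q + f / (s * (1 + x t)) * P \<le> m"
    using n by (rule mult_right_le_imp_le)
  moreover have "((\<lambda>t. l t - \<beta> * \<psi> t - slow_potential \<beta> (x t)) has_real_derivative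
      m - \<beta> * Q - f / (s * (1 + x t)) * P) (at t)"
    unfolding s_def f_def
    by (intro DERIV_diff DERIV_cmult l \<psi> DERIV_chain2[OF slow_potential_deriv x] \<beta> \<open>1 < x t\<close>)
  ultimately show "\<exists>y\<ge>0. ((\<lambda>t. l t - \<beta> * \<psi> t - slow_potential \<beta> (x t)) has_real_derivative y) (at t)"
    by (intro exI[of _ "m - \<beta> * Q - f / (s * (1 + x t)) * P"]) auto
qed

subsection \<open>Reduction of horizontal paths\<close>

lemma mat_entries_derivative:
  fixes p :: "real \<Rightarrow> mat3"
  assumes "(p has_vector_derivative p') (at t)"
  shows "((\<lambda>t. p t $ i $ j) has_real_derivative p' $ i $ j) (at t)"
  unfolding has_real_derivative_iff_has_vector_derivative
  using bounded_linear.has_vector_derivative[OF bounded_linear_vec_nth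
      bounded_linear.has_vector_derivative[OF bounded_linear_vec_nth assms]] .

text \<open>Near \<open>t\<close> the function \<open>g\<close> equals
  \<open>g t + Ln (w s / w t)\<close>: both are logarithms of \<open>w\<close>, and continuity keeps
  the imaginary part of \<open>g s - g t\<close> within (-\<pi>, \<pi>), the range of the principal
  branch.\<close>

lemma continuous_log_derivative:
  fixes g w :: "real \<Rightarrow> complex"
  assumes g: "continuous_on {0..1} g" and w: "\<And>t. t \<in> {0..1} \<Longrightarrow> w t = exp (g t)"
    and t: "t \<in> {0<..<1}" and dw: "(w has_vector_derivative w') (at t)"
  shows "(g has_vector_derivative w' / w t) (at t)"
proof -
  have "isCont g t"
    using g t by (auto simp: continuous_on_eq_continuous_at continuous_on_interior)
  then have "((\<lambda>s. Im (g s - g t)) \<longlongrightarrow> Im (g t - g t)) (at t)"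
    unfolding isCont_def by (intro tendsto_intros)
  then have ev: "\<forall>\<^sub>F s in at t. \<bar>Im (g s - g t)\<bar> < pi"
    by (auto simp: tendsto_iff dist_real_def dest: spec[of _ pi])
  have wt: "w t \<noteq> 0"
    using w[of t] t by auto
  have "((\<lambda>s. g t + Ln (w s / w t)) has_vector_derivative w' / w t) (at t)"
  proof -
    have "((\<lambda>s. w s / w t) has_vector_derivative w' / w t) (at t)"
      using bounded_linear.has_vector_derivative[OF bounded_linear_mult_left[of "1 / w t"] dw] by simp
    moreover have "(Ln has_field_derivative inverse (w t / w t)) (at (w t / w t))"
      using wt by (intro has_field_derivative_Ln) auto
    ultimately have "((Ln \<circ> (\<lambda>s. w s / w t)) has_vector_derivative (w' / w t) * inverse (w t / w t)) (at t)"
      by (rule field_vector_diff_chain_at)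
    then have "((\<lambda>s. Ln (w s / w t)) has_vector_derivative w' / w t) (at t)"
      using wt by (simp add: o_def)
    from has_vector_derivative_add[OF has_vector_derivative_const[of "g t"] this]
    show ?thesis by simp
  qed
  moreover have "\<forall>\<^sub>F s in nhds t. s \<in> UNIV \<longrightarrow> g t + Ln (w s / w t) = g s"
  proof -
    have "\<forall>\<^sub>F s in nhds t. s \<in> {0<..<1}"
      using t by (intro eventually_nhds_in_open) auto
    moreover have "\<forall>\<^sub>F s in nhds t. \<bar>Im (g s - g t)\<bar> < pi"
      using ev by (simp add: eventually_nhds_conv_at)
    ultimately show ?thesis
    proof eventually_elim
      case (elim s)
      then have "w s / w t = exp (g s - g t)"
        using w[of s] w[of t] t by (simp add: exp_diff)
      then show ?case
        using elim by (simp add: abs_less_iff)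
    qed
  qed
  ultimately show ?thesis
    using has_vector_derivative_cong_ev[of UNIV "\<lambda>s. g t + Ln (w s / w t)" g t] wt by simp
qed

text \<open>\<open>twist\<close> has modulus \<open>1 + z \<ge> 2\<close> on \<open>SO21\<close>, so
  along the path it has a continuous logarithm, whose imaginary part provides the lifted
  angle.\<close>

lemma horizontal_reduced_curve:
  assumes "valid_path p" and SO: "path_image p \<subseteq> SO21" and S: "finite S"
    and dp: "\<And>t. t \<in> {0..1} - S \<Longrightarrow>
        (p has_vector_derivative p t ** (u t *\<^sub>R gen_a + v t *\<^sub>R gen_b)) (at t)"
    and int: "(\<lambda>t. sqrt ((u t)\<^sup>2 + (v t)\<^sup>2)) integrable_on {0..1}"
    and "pathstart p = mat 1"
  obtains \<psi> where
    "reduced_curve (\<lambda>t. p t $ 1 $ 1) \<psi> (\<lambda>t. integral {0..t} (\<lambda>t. sqrt ((u t)\<^sup>2 + (v t)\<^sup>2)))" "\<psi> 0 = 0"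
    "\<forall>t\<in>{0..1}. twist (p t) = of_real (1 + p t $ 1 $ 1) * cis (\<psi> t)"
proof -
  have p: "continuous_on {0..1} p"
    using \<open>valid_path p\<close> by (simp add: valid_path_imp_path flip: path_def)
  obtain T where T: "finite T" "p C1_differentiable_on ({0..1} - T)"
    using \<open>valid_path p\<close> unfolding valid_path_def piecewise_C1_differentiable_on_def by blast
  define z where "z t = p t $ 1 $ 1" for t
  have SO: "p t \<in> SO21" if "t \<in> {0..1}" for t
    using SO that by (auto simp: path_image_def)
  have z1: "1 \<le> z t" if "t \<in> {0..1}" for t
    using SO21_z_ge1[OF SO[OF that]] by (simp add: z_def)
  have cz: "continuous_on {0..1} z"
    unfolding z_def by (intro continuous_intros p)
  define w where "w t = twist (p t)" for t
  have cw: "continuous_on {0..1} w"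
    unfolding w_def twist_def Complex_eq by (intro continuous_intros p)
  have nw: "cmod (w t) = 1 + z t" if "t \<in> {0..1}" for t
    using SO21_norm_twist[OF SO[OF that]] by (simp add: w_def z_def)
  have w0: "w 0 = 2"
    using assms(6) by (simp add: w_def pathstart_def twist_def mat_def complex_eq_iff)
  obtain g where g: "continuous_on {0..1} g" and wg: "\<And>t. t \<in> {0..1} \<Longrightarrow> w t = exp (g t)"
  proof (rule continuous_logarithm_on_contractible[OF cw])
    show "contractible {0..1::real}"
      by (simp add: convex_imp_contractible)
    show "w t \<noteq> 0" if "t \<in> {0..1}" for t
      using nw[OF that] z1[OF that] by auto
  qed blast
  define \<psi> where "\<psi> t = Im (g t) - Im (g 0)" for t
  define l where "l t = integral {0..t} (\<lambda>t. sqrt ((u t)\<^sup>2 + (v t)\<^sup>2))" for t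
  \<comment> \<open>The twist of the identity is 2, so \<open>Im (g 0)\<close> is a multiple of
    \<open>2 \<pi>\<close> and may be subtracted from the lift.\<close>
  have e0: "cis (Im (g 0)) = 1"
  proof -
    have "exp (g 0) = 2"
      using wg[of 0] w0 by simp
    moreover from this have "exp (Re (g 0)) = 2"
      by (metis norm_exp_eq_Re norm_numeral)
    ultimately show ?thesis
      using exp_eq_polar[of "g 0"] by simp
  qed
  have tw: "w t = of_real (1 + z t) * cis (\<psi> t)" if "t \<in> {0..1}" for t
  proof -
    have "exp (Re (g t)) = 1 + z t"
      using wg[OF that] nw[OF that] by (metis norm_exp_eq_Re)
    moreover have "cis (\<psi> t) = cis (Im (g t))"
      using e0 by (simp add: \<psi>_def cis_divide[symmetric])
    ultimately show ?thesis
      using wg[OF that] by (simp add: exp_eq_polar)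
  qed
  define V where "V t = vector_derivative p (at t)" for t
  \<comment> \<open>The length is known only as an integral. Solving the horizontality equation with
    the inverse of \<open>p t\<close> shows that \<open>u\<close> and \<open>v\<close> are
    continuous wherever \<open>p\<close> is \<open>C\<^sup>1\<close>, so that the length is
    differentiable there.\<close>
  have u: "u t = p t$1$1 * V t$1$2 - p t$2$1 * V t$2$2 - p t$3$1 * V t$3$2" (is "_ = ?u")
    and v: "v t = p t$1$1 * V t$1$3 - p t$2$1 * V t$2$3 - p t$3$1 * V t$3$3" (is "_ = ?v")
    if "t \<in> {0..1} - S" for t
  proof -
    have "(lorentz_matrix ** transpose (p t) ** lorentz_matrix) ** V t = u t *\<^sub>R gen_a + v t *\<^sub>R gen_b"
      using O21_inverse(1)[OF SO21_O21[OF SO]] that vector_derivative_at[OF dp[OF that]]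
      by (simp add: V_def matrix_mul_assoc)
    then have e: "((lorentz_matrix ** transpose (p t) ** lorentz_matrix) ** V t)$1$j
        = (u t *\<^sub>R gen_a + v t *\<^sub>R gen_b)$1$j" for j
      by simp
    have "((lorentz_matrix ** transpose (p t) ** lorentz_matrix) ** V t)$1$j
        = p t$1$1 * V t$1$j - p t$2$1 * V t$2$j - p t$3$1 * V t$3$j" for j
      by (simp add: lorentz_matrix_def matrix_matrix_mult_def transpose_def sum_3)
    then show "u t = ?u" "v t = ?v"
      using e[of 2] e[of 3] by (simp_all add: gen_a_def gen_b_def)
  qed
  define I where "I = {0<..<1} - (S \<union> T)"
  have I: "open I" "I \<subseteq> {0..1}" "I \<subseteq> {0..1} - S" "I \<subseteq> {0..1} - T"
    using S T(1) unfolding I_def by (auto intro!: open_Diff finite_imp_closed)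
  have cu: "continuous_on I u" and cv: "continuous_on I v"
  proof -
    have cp: "continuous_on I (\<lambda>t. p t $ i $ j)" for i j
      using continuous_on_subset[OF p I(2)] by (intro continuous_intros)
    have "continuous_on I (\<lambda>t. vector_derivative p (at t))"
      using T(2) I(4) unfolding C1_differentiable_on_eq by (blast intro: continuous_on_subset)
    then have cp': "continuous_on I (\<lambda>t. V t $ i $ j)" for i j
      unfolding V_def by (intro continuous_intros)
    have "continuous_on I (\<lambda>t. p t$1$1 * V t$1$j - p t$2$1 * V t$2$j - p t$3$1 * V t$3$j)" for j
      by (intro continuous_on_diff continuous_on_mult cp cp')
    note c = this
    have "p t$1$1 * V t$1$2 - p t$2$1 * V t$2$2 - p t$3$1 * V t$3$2 = u t" if "t \<in> I" for t
      using u[of t] I(3) that by auto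
    then show "continuous_on I u"
      by (rule continuous_on_eq[OF c])
    have "p t$1$1 * V t$1$3 - p t$2$1 * V t$2$3 - p t$3$1 * V t$3$3 = v t" if "t \<in> I" for t
      using v[of t] I(3) that by auto
    then show "continuous_on I v"
      by (rule continuous_on_eq[OF c])
  qed
  have "reduced_curve z \<psi> l"
    unfolding reduced_curve_def
  proof (intro conjI ballI exI[of _ "S \<union> T"])
    show "continuous_on {0..1} z" by (rule cz)
    show "continuous_on {0..1} \<psi>"
      unfolding \<psi>_def by (intro continuous_intros g)
    show "continuous_on {0..1} l"
      unfolding l_def by (rule indefinite_integral_continuous_1[OF int])
    show "finite (S \<union> T)"
      using S T by simp
    fix t assume "t \<in> {0<..<1} - (S \<union> T)"
    then have tI: "t \<in> I" and t01: "t \<in> {0<..<1}" by (auto simp: I_def)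
    then have t: "t \<in> {0..1}" and tS: "t \<in> {0..1} - S" using I by auto
    define A where "A = p t"
    have A: "A \<in> SO21" using SO[OF t] by (simp add: A_def)
    have d: "((\<lambda>t. p t $ i $ j) has_real_derivative (A ** (u t *\<^sub>R gen_a + v t *\<^sub>R gen_b)) $ i $ j) (at t)" for i j
      unfolding A_def by (rule mat_entries_derivative[OF dp[OF tS]])
    define P where "P = u t * A$1$2 + v t * A$1$3"
    define Q where "Q = (u t * A$1$3 - v t * A$1$2) / (1 + A$1$1)"
    define m where "m = sqrt ((u t)\<^sup>2 + (v t)\<^sup>2)"
    have "1 \<le> A$1$1"
      by (rule SO21_z_ge1[OF A])
    have "(z has_real_derivative P) (at t)"
      using d[of 1 1] unfolding z_def
      by (simp add: P_def gen_a_def gen_b_def matrix_matrix_mult_def sum_3 mult.commute)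
    moreover have "(\<psi> has_real_derivative Q) (at t)"
    proof -
      \<comment> \<open>The lower block of the velocity is the first column of \<open>A\<close>
        times the row \<open>(u, v)\<close>, so \<open>twist\<close> changes by the column times the
        conjugate of \<open>u + \<i> v\<close>. The column relation then cancels
        \<open>twist\<close> in the logarithmic derivative.\<close>
      define W where "W = Complex (A$2$1) (A$3$1) * Complex (u t) (- v t)"
      have "(w has_vector_derivative W) (at t)"
      proof -
        have "((\<lambda>t. of_real (p t $ 2 $ 2 + p t $ 3 $ 3) + \<i> * of_real (p t $ 3 $ 2 - p t $ 2 $ 3))
           has_vector_derivative of_real (A$2$1 * u t + A$3$1 * v t) + \<i> * of_real (A$3$1 * u t - A$2$1 * v t)) (at t)"
          using d[of 2 2] d[of 3 3] d[of 3 2] d[of 2 3]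
          by (intro has_vector_derivative_add has_vector_derivative_mult_right has_vector_derivative_of_real)
            (auto simp: gen_a_def gen_b_def matrix_matrix_mult_def sum_3 intro!: derivative_eq_intros)
        then show ?thesis
          unfolding w_def twist_def W_def Complex_eq
          by (rule has_vector_derivative_eq_rhs) (simp add: complex_eq_iff algebra_simps)
      qed
      from continuous_log_derivative[OF g wg t01 this]
      have "(g has_vector_derivative W / w t) (at t)" .
      moreover have "W / w t = boost A * Complex (u t) (- v t) / of_real (1 + A$1$1)"
      proof -
        have n: "of_real (1 + A$1$1) \<noteq> (0 :: complex)"
          using \<open>1 \<le> A$1$1\<close> of_real_eq_0_iff[where 'a = complex, of "1 + A$1$1"] by linarith
        have "w t \<noteq> 0"
          using wg[OF t] by simp
        then show ?thesis
          using SO21_column_relation[OF A] n unfolding W_def w_def A_def[symmetric]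
          by (simp add: frac_eq_eq) (metis mult.assoc mult.commute)
      qed
      ultimately have "((\<lambda>t. Im (g t)) has_vector_derivative
          Im (boost A * Complex (u t) (- v t) / of_real (1 + A$1$1))) (at t)"
        using bounded_linear.has_vector_derivative[OF bounded_linear_Im] by metis
      moreover have "Im (boost A * Complex (u t) (- v t) / of_real (1 + A$1$1)) = Q"
        by (simp only: Im_divide_of_real) (simp add: boost_def Q_def algebra_simps)
      ultimately have "((\<lambda>t. Im (g t)) has_real_derivative Q) (at t)"
        by (simp only: has_real_derivative_iff_has_vector_derivative)
      from DERIV_diff[OF this DERIV_const[of "Im (g 0)"]] show ?thesis
        by (simp add: \<psi>_def[abs_def])
    qed
    moreover have "(l has_real_derivative m) (at t)"
    proof -
      have "isCont u t" "isCont v t"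
        using cu cv I(1) tI by (auto simp: continuous_on_eq_continuous_at)
      then have "isCont (\<lambda>t. sqrt ((u t)\<^sup>2 + (v t)\<^sup>2)) t"
        by (intro continuous_intros)
      then have "(l has_vector_derivative m) (at t within {0..1})"
        using integral_has_vector_derivative_continuous_at[OF int, of t "{}"] t
        by (simp add: l_def[abs_def] m_def continuous_at_imp_continuous_at_within)
      then show ?thesis
        using t01 by (simp add: has_real_derivative_iff_has_vector_derivative at_within_Icc_at)
    qed
    moreover have "0 \<le> m"
      by (simp add: m_def)
    \<comment> \<open>\<open>P\<close> and \<open>(1 + z t) * Q\<close> are the scalar and the cross
      product of \<open>(u, v)\<close> with the vector \<open>boost A\<close>, so equality holds by
      Lagrange's identity.\<close>
    moreover have "P\<^sup>2 + ((1 + z t) * Q)\<^sup>2 \<le> ((z t)\<^sup>2 - 1) * m\<^sup>2"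
    proof -
      have e1: "(1 + z t) * Q = u t * A$1$3 - v t * A$1$2"
        using \<open>1 \<le> A$1$1\<close> by (simp add: Q_def z_def A_def)
      have e2: "(z t)\<^sup>2 - 1 = (A$1$2)\<^sup>2 + (A$1$3)\<^sup>2"
        using O21_rows(1)[OF SO21_O21[OF A]] by (simp add: z_def A_def power2_eq_square)
      have e3: "m\<^sup>2 = (u t)\<^sup>2 + (v t)\<^sup>2"
        by (simp add: m_def)
      show ?thesis
        unfolding e1 e2 e3 P_def by (simp add: power2_eq_square algebra_simps)
    qed
    ultimately show "\<exists>P Q m. (z has_real_derivative P) (at t) \<and> (\<psi> has_real_derivative Q) (at t) \<and>
        (l has_real_derivative m) (at t) \<and> 0 \<le> m \<and>
        P\<^sup>2 + ((1 + z t) * Q)\<^sup>2 \<le> ((z t)\<^sup>2 - 1) * m\<^sup>2"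
      by blast
  qed (use z1 in auto)
  then show ?thesis
    using tw by (intro that[of \<psi>]) (auto simp: \<psi>_def l_def[abs_def] w_def z_def[abs_def])
qed

subsection \<open>Explicit geodesics\<close>

text \<open>\<open>gsin \<delta>\<close> and \<open>gcos \<delta>\<close> are the solutions of \<open>f'' = \<delta> f\<close> with the initial values of sine and cosine, and
  \<open>gvers \<delta>\<close> is the integral of \<open>gsin \<delta>\<close>.\<close>

definition gsin :: "real \<Rightarrow> real \<Rightarrow> real" where
  "gsin \<delta> t = (if \<delta> > 0 then sinh (sqrt \<delta> * t) / sqrt \<delta>
     else if \<delta> < 0 then sin (sqrt (- \<delta>) * t) / sqrt (- \<delta>) else t)"

definition gcos :: "real \<Rightarrow> real \<Rightarrow> real" where
  "gcos \<delta> t = (if \<delta> > 0 then cosh (sqrt \<delta> * t)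
     else if \<delta> < 0 then cos (sqrt (- \<delta>) * t) else 1)"

definition gvers :: "real \<Rightarrow> real \<Rightarrow> real" where
  "gvers \<delta> t = (if \<delta> = 0 then t\<^sup>2 / 2 else (gcos \<delta> t - 1) / \<delta>)"

lemma signed_square_cases:
  fixes \<delta> :: real
  obtains (pos) r where "r > 0" "\<delta> = r\<^sup>2" | (zero) "\<delta> = 0" | (neg) r where "r > 0" "\<delta> = - (r\<^sup>2)"
proof (cases \<delta> "0 :: real" rule: linorder_cases)
  case less
  then show ?thesis using neg[of "sqrt (- \<delta>)"] by simp
next
  case greater
  then show ?thesis using pos[of "sqrt \<delta>"] by simp
qed (use zero in simp)

lemma gsin_simps [simp]:
  "gsin 0 t = t" "r > 0 \<Longrightarrow> gsin (r\<^sup>2) t = sinh (r * t) / r"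
  "r > 0 \<Longrightarrow> gsin (- (r\<^sup>2)) t = sin (r * t) / r"
  by (simp_all add: gsin_def real_sqrt_abs)

lemma gcos_simps [simp]:
  "gcos 0 t = 1" "r > 0 \<Longrightarrow> gcos (r\<^sup>2) t = cosh (r * t)"
  "r > 0 \<Longrightarrow> gcos (- (r\<^sup>2)) t = cos (r * t)"
  by (simp_all add: gcos_def real_sqrt_abs)

lemma gvers_simps [simp]:
  "gvers 0 t = t\<^sup>2 / 2" "r > 0 \<Longrightarrow> gvers (r\<^sup>2) t = (cosh (r * t) - 1) / r\<^sup>2"
  "r > 0 \<Longrightarrow> gvers (- (r\<^sup>2)) t = (1 - cos (r * t)) / r\<^sup>2"
  by (simp_all add: gvers_def field_simps)

lemma gcos_gvers: "gcos \<delta> t = 1 + \<delta> * gvers \<delta> t"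
  by (simp add: gvers_def gcos_def)

lemma gcos_squared: "(gcos \<delta> t)\<^sup>2 = 1 + \<delta> * (gsin \<delta> t)\<^sup>2"
  by (cases \<delta> rule: signed_square_cases) (simp_all add: power_divide cosh_square_eq cos_squared_eq)

lemma gsin_squared: "(gsin \<delta> t)\<^sup>2 = 2 * gvers \<delta> t + \<delta> * (gvers \<delta> t)\<^sup>2"
proof (cases "\<delta> = 0")
  case False
  have "(1 + \<delta> * gvers \<delta> t)\<^sup>2 = 1 + \<delta> * (gsin \<delta> t)\<^sup>2"
    using gcos_squared[of \<delta> t] by (simp add: gcos_gvers)
  then have "\<delta> * (2 * gvers \<delta> t + \<delta> * (gvers \<delta> t)\<^sup>2) = \<delta> * (gsin \<delta> t)\<^sup>2"
    by (simp add: power2_eq_square algebra_simps)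
  with False show ?thesis by simp
qed simp

lemma gsin_double: "gsin \<delta> t = 2 * gsin \<delta> (t / 2) * gcos \<delta> (t / 2)"
proof (cases \<delta> rule: signed_square_cases)
  case (pos r)
  then show ?thesis using sinh_double[of "r * (t / 2)"] by simp
next
  case (neg r)
  then show ?thesis using sin_double[of "r * (t / 2)"] by simp
qed simp

lemma gvers_half: "gvers \<delta> t = 2 * (gsin \<delta> (t / 2))\<^sup>2"
proof (cases \<delta> rule: signed_square_cases)
  case (pos r)
  then show ?thesis using cosh_double[of "r * (t / 2)"] by (simp add: power_divide cosh_square_eq)
next
  case (neg r)
  then show ?thesis using cos_double[of "r * (t / 2)"] by (simp add: power_divide cos_squared_eq)
qed (simp add: power_divide)

lemma gsin_deriv: "(gsin \<delta> has_real_derivative gcos \<delta> t) (at t)"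
proof (cases \<delta> rule: signed_square_cases)
  case zero
  then have "gsin \<delta> = (\<lambda>t. t)" by (simp add: fun_eq_iff)
  with zero show ?thesis by simp
next
  case (pos r)
  then have "gsin \<delta> = (\<lambda>t. sinh (r * t) / r)" by (simp add: fun_eq_iff)
  with pos show ?thesis by (auto intro!: derivative_eq_intros)
next
  case (neg r)
  then have "gsin \<delta> = (\<lambda>t. sin (r * t) / r)" by (simp add: fun_eq_iff)
  with neg show ?thesis by (auto intro!: derivative_eq_intros)
qed

lemma gvers_deriv: "(gvers \<delta> has_real_derivative gsin \<delta> t) (at t)"
proof (cases \<delta> rule: signed_square_cases)
  case zero
  then have "gvers \<delta> = (\<lambda>t. t\<^sup>2 / 2)" by (simp add: fun_eq_iff)
  with zero show ?thesis by (auto intro!: derivative_eq_intros)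
next
  case (pos r)
  then have "gvers \<delta> = (\<lambda>t. (cosh (r * t) - 1) / r\<^sup>2)" by (simp add: fun_eq_iff)
  moreover have "gsin \<delta> t = sinh (r * t) / r" using pos by simp
  ultimately show ?thesis
    using pos(1) by (auto intro!: derivative_eq_intros simp: power2_eq_square)
next
  case (neg r)
  then have "gvers \<delta> = (\<lambda>t. (1 - cos (r * t)) / r\<^sup>2)" by (simp add: fun_eq_iff)
  moreover have "gsin \<delta> t = sin (r * t) / r" using neg by simp
  ultimately show ?thesis
    using neg(1) by (auto intro!: derivative_eq_intros simp: power2_eq_square)
qed

lemma even_odd_cases:
  obtains (zero) "(n :: nat) = 0" | (odd) k where "n = Suc (2 * k)" | (even) k where "n = Suc (Suc (2 * k))"
  by (metis even_Suc evenE oddE Suc_eq_plus1 mult_Suc_right not0_implies_Suc add_2_eq_Suc even_zero mult_0_right old.nat.exhaust)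

lemma gsin_sums: "(\<lambda>n. if even n then 0 else \<delta> ^ ((n - 1) div 2) * t ^ n / fact n) sums gsin \<delta> t"
proof (cases \<delta> "0 :: real" rule: linorder_cases)
  case equal
  have "(\<lambda>n. if n = 1 then t else 0) sums t"
    using sums_single[of 1 "\<lambda>_. t"] by simp
  moreover have "(if even n then 0 else \<delta> ^ ((n - 1) div 2) * t ^ n / fact n) = (if n = 1 then t else 0)" for n
    using equal by (cases n rule: even_odd_cases) (auto simp: zero_power)
  ultimately show ?thesis
    using equal by (simp add: gsin_def)
next
  case greater
  have "(\<lambda>n. (if even n then 0 else (sqrt \<delta> * t) ^ n /\<^sub>R fact n) / sqrt \<delta>) sums (sinh (sqrt \<delta> * t) / sqrt \<delta>)"
    by (intro sums_divide sinh_converges)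
  moreover have "(if even n then 0 else (sqrt \<delta> * t) ^ n /\<^sub>R fact n) / sqrt \<delta>
      = (if even n then 0 else \<delta> ^ ((n - 1) div 2) * t ^ n / fact n)" for n
    using greater by (cases n rule: even_odd_cases) (auto simp: power_mult_distrib power_mult divide_inverse)
  ultimately show ?thesis
    using greater by (simp add: gsin_def)
next
  case less
  have "(\<lambda>n. (sin_coeff n *\<^sub>R (sqrt (- \<delta>) * t) ^ n) / sqrt (- \<delta>)) sums (sin (sqrt (- \<delta>) * t) / sqrt (- \<delta>))"
    by (intro sums_divide sin_converges)
  moreover have "(sin_coeff n *\<^sub>R (sqrt (- \<delta>) * t) ^ n) / sqrt (- \<delta>)
      = (if even n then 0 else \<delta> ^ ((n - 1) div 2) * t ^ n / fact n)" for n
  proof (cases n rule: even_odd_cases)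
    case (odd k)
    have "sqrt (- \<delta>) ^ (2 * k) = (- \<delta>) ^ k"
      using less by (simp add: power_mult)
    moreover have "(-1) ^ k * (- \<delta>) ^ k = \<delta> ^ k"
      by (simp flip: power_mult_distrib)
    ultimately show ?thesis
      using less odd by (simp add: sin_coeff_def power_mult_distrib)
  qed (auto simp: sin_coeff_def)
  ultimately show ?thesis
    using less by (simp add: gsin_def)
qed

lemma gcos_sums: "(\<lambda>n. if even n then \<delta> ^ (n div 2) * t ^ n / fact n else 0) sums gcos \<delta> t"
proof (cases \<delta> "0 :: real" rule: linorder_cases)
  case equal
  have "(\<lambda>n. if n = 0 then 1 else 0) sums (1 :: real)"
    using sums_single[of 0 "\<lambda>_. 1 :: real"] by simp
  moreover have "(if even n then \<delta> ^ (n div 2) * t ^ n / fact n else 0) = (if n = 0 then 1 else 0)" for n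
    using equal by (cases n rule: even_odd_cases) (auto simp: zero_power)
  ultimately show ?thesis
    using equal by (simp add: gcos_def)
next
  case greater
  have "(if even n then (sqrt \<delta> * t) ^ n /\<^sub>R fact n else 0)
      = (if even n then \<delta> ^ (n div 2) * t ^ n / fact n else 0)" for n
    using greater by (cases n rule: even_odd_cases) (auto simp: power_mult_distrib power_mult divide_inverse)
  then show ?thesis
    using greater cosh_converges[of "sqrt \<delta> * t"] by (simp add: gcos_def)
next
  case less
  have "(cos_coeff n *\<^sub>R (sqrt (- \<delta>) * t) ^ n)
      = (if even n then \<delta> ^ (n div 2) * t ^ n / fact n else 0)" for n
  proof (cases "even n")
    case True
    then obtain k where k: "n = 2 * k" by (rule evenE)
    have "sqrt (- \<delta>) ^ (2 * k) = (- \<delta>) ^ k"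
      using less by (simp add: power_mult)
    moreover have "(-1) ^ k * (- \<delta>) ^ k = \<delta> ^ k"
      by (simp flip: power_mult_distrib)
    ultimately show ?thesis
      using k by (simp add: cos_coeff_def power_mult_distrib)
  qed (auto simp: cos_coeff_def)
  then show ?thesis
    using less cos_converges[of "sqrt (- \<delta>) * t"] by (simp add: gcos_def)
qed

lemma gvers_sums:
  "(\<lambda>n. if n = 0 \<or> odd n then 0 else \<delta> ^ (n div 2 - 1) * t ^ n / fact n) sums gvers \<delta> t"
proof (cases "\<delta> = 0")
  case True
  have "(\<lambda>n. if n = 2 then t\<^sup>2 / 2 else 0) sums (t\<^sup>2 / 2)"
    using sums_single[of 2 "\<lambda>_. t\<^sup>2 / 2"] by simp
  moreover have "(if n = 0 \<or> odd n then 0 else \<delta> ^ (n div 2 - 1) * t ^ n / fact n)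
      = (if n = 2 then t\<^sup>2 / 2 else 0)" for n
  proof (cases n rule: even_odd_cases)
    case (odd k)
    then have "n \<noteq> 2" by presburger
    with odd show ?thesis by simp
  next
    case (even k)
    with True show ?thesis by (cases k) (auto simp: power2_eq_square)
  qed simp
  ultimately show ?thesis
    using True by (simp add: gvers_def)
next
  case False
  have "(\<lambda>n. if n = 0 then 1 else 0) sums (1 :: real)"
    using sums_single[of 0 "\<lambda>_. 1 :: real"] by simp
  from sums_divide[OF sums_diff[OF gcos_sums[of \<delta> t] this], of \<delta>]
  have "(\<lambda>n. ((if even n then \<delta> ^ (n div 2) * t ^ n / fact n else 0) - (if n = 0 then 1 else 0)) / \<delta>)
      sums gvers \<delta> t"
    using False by (simp add: gvers_def)
  moreover have "((if even n then \<delta> ^ (n div 2) * t ^ n / fact n else 0) - (if n = 0 then 1 else 0)) / \<delta>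
      = (if n = 0 \<or> odd n then 0 else \<delta> ^ (n div 2 - 1) * t ^ n / fact n)" for n
    using False by (cases n rule: even_odd_cases) auto
  ultimately show ?thesis by simp
qed

section \<open>Exponentials of matrices whose cube is a multiple of themselves\<close>

lemma bounded_bilinear_mat3: "bounded_bilinear ((**) :: mat3 \<Rightarrow> mat3 \<Rightarrow> mat3)"
  unfolding bilinear_conv_bounded_bilinear[symmetric] bilinear_def
  by (auto intro!: linearI simp: matrix_matrix_mult_def vec_eq_iff sum_3 algebra_simps)

lemmas mat3_add_left = bounded_bilinear.add_left[OF bounded_bilinear_mat3]
  and mat3_add_right = bounded_bilinear.add_right[OF bounded_bilinear_mat3]
  and mat3_scaleR_left = bounded_bilinear.scaleR_left[OF bounded_bilinear_mat3]
  and mat3_scaleR_right = bounded_bilinear.scaleR_right[OF bounded_bilinear_mat3]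
  and mat3_diff_left = bounded_bilinear.diff_left[OF bounded_bilinear_mat3]
  and mat3_minus_left = bounded_bilinear.minus_left[OF bounded_bilinear_mat3]
  and mat3_diff_right = bounded_bilinear.diff_right[OF bounded_bilinear_mat3]
  and mat3_minus_right = bounded_bilinear.minus_right[OF bounded_bilinear_mat3]

definition cubic_exp :: "real \<Rightarrow> mat3 \<Rightarrow> real \<Rightarrow> mat3" where
  "cubic_exp \<delta> X t = mat 1 + gsin \<delta> t *\<^sub>R X + gvers \<delta> t *\<^sub>R (X ** X)"

text \<open>Odd powers of \<open>X\<close> are multiples of \<open>X\<close> and positive even
  powers are multiples of \<open>X ** X\<close>, so the exponential series splits into those of
  \<open>gsin\<close> and \<open>gvers\<close>.\<close>

lemma mat_exp_cubic:
  assumes "X ** (X ** X) = \<delta> *\<^sub>R X"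
  shows "mat_exp (t *\<^sub>R X) = cubic_exp \<delta> X t"
proof -
  define F :: "mat3 \<Rightarrow> mat3" where "F = (**) (t *\<^sub>R X)"
  have odd: "(F ^^ Suc (2 * k)) (mat 1) = (\<delta> ^ k * t ^ Suc (2 * k)) *\<^sub>R X" for k
  proof (induction k)
    case (Suc k)
    have "(F ^^ Suc (2 * Suc k)) (mat 1) = F (F ((F ^^ Suc (2 * k)) (mat 1)))"
      by simp
    also have "\<dots> = F (F ((\<delta> ^ k * t ^ Suc (2 * k)) *\<^sub>R X))"
      by (simp only: Suc.IH)
    also have "\<dots> = (\<delta> ^ Suc k * t ^ Suc (2 * Suc k)) *\<^sub>R X"
      by (simp add: F_def mat3_scaleR_left mat3_scaleR_right assms mult_ac)
    finally show ?case .
  qed (simp add: F_def)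
  have even: "(F ^^ Suc (Suc (2 * k))) (mat 1) = (\<delta> ^ k * t ^ Suc (Suc (2 * k))) *\<^sub>R (X ** X)" for k
  proof -
    have "(F ^^ Suc (Suc (2 * k))) (mat 1) = F ((F ^^ Suc (2 * k)) (mat 1))"
      by simp
    also have "\<dots> = F ((\<delta> ^ k * t ^ Suc (2 * k)) *\<^sub>R X)"
      by (simp only: odd)
    also have "\<dots> = (\<delta> ^ k * t ^ Suc (Suc (2 * k))) *\<^sub>R (X ** X)"
      by (simp add: F_def mat3_scaleR_left mat3_scaleR_right mult_ac)
    finally show ?thesis .
  qed
  have "(\<lambda>n. (if n = 0 then mat 1 else 0)
      + (if even n then 0 else \<delta> ^ ((n - 1) div 2) * t ^ n / fact n) *\<^sub>R X
      + (if n = 0 \<or> odd n then 0 else \<delta> ^ (n div 2 - 1) * t ^ n / fact n) *\<^sub>R (X ** X))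
    sums cubic_exp \<delta> X t"
    unfolding cubic_exp_def
    using sums_single[of 0 "\<lambda>_. mat 1 :: mat3"]
    by (intro sums_add bounded_linear.sums[OF bounded_linear_scaleR_left] gsin_sums gvers_sums) simp
  moreover have "(if n = 0 then mat 1 else 0)
      + (if even n then 0 else \<delta> ^ ((n - 1) div 2) * t ^ n / fact n) *\<^sub>R X
      + (if n = 0 \<or> odd n then 0 else \<delta> ^ (n div 2 - 1) * t ^ n / fact n) *\<^sub>R (X ** X)
    = (1 / fact n) *\<^sub>R (F ^^ n) (mat 1)" for n
    by (cases n rule: even_odd_cases) (simp_all only: odd even, simp_all)
  ultimately show ?thesis
    unfolding mat_exp_def F_def[symmetric] by (simp add: sums_iff)
qed

lemma cubic_exp_deriv:
  assumes "X ** (X ** X) = \<delta> *\<^sub>R X"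
  shows "(cubic_exp \<delta> X has_vector_derivative cubic_exp \<delta> X t ** X) (at t)"
proof -
  have "(cubic_exp \<delta> X has_vector_derivative 0 + gcos \<delta> t *\<^sub>R X + gsin \<delta> t *\<^sub>R (X ** X)) (at t)"
    unfolding cubic_exp_def[abs_def]
    by (intro has_vector_derivative_add has_vector_derivative_const)
      (auto intro!: derivative_eq_intros gsin_deriv gvers_deriv)
  moreover have "0 + gcos \<delta> t *\<^sub>R X + gsin \<delta> t *\<^sub>R (X ** X) = cubic_exp \<delta> X t ** X"
    by (simp add: cubic_exp_def mat3_add_left mat3_scaleR_left assms gcos_gvers scaleR_add_left mult.commute
        flip: matrix_mul_assoc)
  ultimately show ?thesis by simp
qed

text \<open>\<open>E\<close> is the exponential at \<open>- t\<close>, as \<open>gsin\<close> is odd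
  and \<open>gvers\<close> even in \<open>t\<close>. Skewness moves the transposed exponential
  across the form as \<open>E\<close>, and \<open>E\<close> times the exponential is the identity by
  \<open>gsin_squared\<close>.\<close>

lemma cubic_exp_O21:
  assumes "X ** (X ** X) = \<delta> *\<^sub>R X" and skew: "transpose X ** lorentz_matrix = - (lorentz_matrix ** X)"
  shows "cubic_exp \<delta> X t \<in> O21"
proof -
  define S T J where "S = gsin \<delta> t" and "T = gvers \<delta> t" and "J = lorentz_matrix"
  define E where "E = mat 1 - S *\<^sub>R X + T *\<^sub>R (X ** X)"
  have skew2: "transpose (X ** X) ** J = J ** (X ** X)"
  proof -
    have "transpose (X ** X) ** J = transpose X ** (transpose X ** J)"
      by (simp add: matrix_transpose_mul matrix_mul_assoc)
    also have "\<dots> = - ((transpose X ** J) ** X)"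
      using skew by (simp add: J_def mat3_minus_right matrix_mul_assoc)
    also have "\<dots> = J ** (X ** X)"
      using skew by (simp add: J_def mat3_minus_left matrix_mul_assoc)
    finally show ?thesis .
  qed
  have "transpose (cubic_exp \<delta> X t) = mat 1 + S *\<^sub>R transpose X + T *\<^sub>R transpose (X ** X)"
    by (simp add: cubic_exp_def S_def T_def transpose_def vec_eq_iff mat_def)
  then have E: "transpose (cubic_exp \<delta> X t) ** J = J ** E"
    using skew skew2 unfolding E_def J_def
    by (simp add: mat3_add_left mat3_add_right mat3_diff_right mat3_scaleR_left mat3_scaleR_right)
  have "(X ** X) ** X = \<delta> *\<^sub>R X" "(X ** X) ** (X ** X) = \<delta> *\<^sub>R (X ** X)"
    using assms(1) by (simp_all add: mat3_scaleR_right flip: matrix_mul_assoc)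
  then have "E ** cubic_exp \<delta> X t = mat 1 + (2 * T + \<delta> * T\<^sup>2 - S\<^sup>2) *\<^sub>R (X ** X)"
    unfolding E_def cubic_exp_def S_def[symmetric] T_def[symmetric]
    by (simp add: mat3_add_left mat3_add_right mat3_diff_left mat3_scaleR_left mat3_scaleR_right assms(1))
      (simp add: vec_eq_iff algebra_simps power2_eq_square)
  also have "2 * T + \<delta> * T\<^sup>2 - S\<^sup>2 = 0"
    by (simp add: gsin_squared S_def T_def)
  finally have "E ** cubic_exp \<delta> X t = mat 1" by simp
  then show ?thesis
    unfolding O21_iff using E by (simp add: J_def flip: matrix_mul_assoc)
qed

section \<open>Geodesics as explicit matrices\<close>

definition geodesic_generator :: "real \<Rightarrow> real \<Rightarrow> mat3" where
  "geodesic_generator \<beta> \<phi> = cos \<phi> *\<^sub>R gen_a + sin \<phi> *\<^sub>R gen_b - \<beta> *\<^sub>R gen_c"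

lemma geodesic_generator_eq:
  "geodesic_generator \<beta> \<phi> = vector [vector [0, cos \<phi>, sin \<phi>], vector [cos \<phi>, 0, \<beta>], vector [sin \<phi>, - \<beta>, 0]]"
  by (simp add: geodesic_generator_def gen_a_def gen_b_def gen_c_def vec_eq_iff forall_3)

lemma geodesic_generator_sq:
  "geodesic_generator \<beta> \<phi> ** geodesic_generator \<beta> \<phi> = vector [
     vector [1, - \<beta> * sin \<phi>, \<beta> * cos \<phi>],
     vector [\<beta> * sin \<phi>, (cos \<phi>)\<^sup>2 - \<beta>\<^sup>2, cos \<phi> * sin \<phi>],
     vector [- \<beta> * cos \<phi>, cos \<phi> * sin \<phi>, (sin \<phi>)\<^sup>2 - \<beta>\<^sup>2]]"
  by (simp add: geodesic_generator_eq vec_eq_iff forall_3 matrix_matrix_mult_def sum_3 power2_eq_square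
      sin_cos_squared_add3)

lemma geodesic_generator_cube:
  "geodesic_generator \<beta> \<phi> ** (geodesic_generator \<beta> \<phi> ** geodesic_generator \<beta> \<phi>)
     = (1 - \<beta>\<^sup>2) *\<^sub>R geodesic_generator \<beta> \<phi>"
proof -
  have p: "cos \<phi> * cos \<phi> + sin \<phi> * sin \<phi> = 1"
    by simp
  then have "cos \<phi> * (cos \<phi> * cos \<phi>) + cos \<phi> * (sin \<phi> * sin \<phi>) = cos \<phi>"
     "cos \<phi> * (cos \<phi> * sin \<phi>) + sin \<phi> * (sin \<phi> * sin \<phi>) = sin \<phi>"
     "\<beta> * (cos \<phi> * cos \<phi>) + \<beta> * (sin \<phi> * sin \<phi>) = \<beta>"
    by algebra+
  then show ?thesis
    unfolding geodesic_generator_sq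
    by (simp add: geodesic_generator_eq vec_eq_iff forall_3 matrix_matrix_mult_def sum_3 power2_eq_square
      algebra_simps)
qed

lemma gen_c_cube: "gen_c ** (gen_c ** gen_c) = (-1) *\<^sub>R gen_c"
  by (simp add: gen_c_def vec_eq_iff forall_3 matrix_matrix_mult_def sum_3)

lemma geodesic_eq:
  "geodesic \<beta> \<phi> t = cubic_exp (1 - \<beta>\<^sup>2) (geodesic_generator \<beta> \<phi>) t ** cubic_exp (-1) gen_c (t * \<beta>)"
  unfolding geodesic_def geodesic_generator_def[symmetric]
  by (simp only: mat_exp_cubic[OF geodesic_generator_cube] mat_exp_cubic[OF gen_c_cube])

lemma rotation_eq:
  "cubic_exp (-1) gen_c x = vector [vector [1, 0, 0], vector [0, cos x, - sin x], vector [0, sin x, cos x]]"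
  by (simp add: cubic_exp_def gsin_def gvers_def gcos_def gen_c_def vec_eq_iff forall_3 mat_def
      matrix_matrix_mult_def sum_3)

text \<open>Conjugation by the rotation fixes \<open>gen_c\<close> and shifts \<open>\<phi>\<close>
  to \<open>\<phi> - x\<close>. For \<open>x = t * \<beta>\<close> the component
  \<open>- \<beta> gen_c\<close> then cancels the velocity of the second factor of the geodesic,
  which is why geodesics are horizontal.\<close>

lemma generator_rotation:
  "geodesic_generator \<beta> \<phi> ** cubic_exp (-1) gen_c x
    = cubic_exp (-1) gen_c x ** (cos (\<phi> - x) *\<^sub>R gen_a + sin (\<phi> - x) *\<^sub>R gen_b - \<beta> *\<^sub>R gen_c)"
proof -
  have "cos x * cos x + sin x * sin x = 1"
    by simp
  then have *: "cos \<phi> * (cos x * cos x) + cos \<phi> * (sin x * sin x) = cos \<phi>"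
     "sin \<phi> * (cos x * cos x) + sin \<phi> * (sin x * sin x) = sin \<phi>"
     "cos x * (cos x * sin \<phi>) + sin \<phi> * (sin x * sin x) = sin \<phi>"
     "cos x * (cos x * sin \<phi>) + sin x * (sin x * sin \<phi>) = sin \<phi>"
    by algebra+
  show ?thesis
    unfolding geodesic_generator_def[symmetric] geodesic_generator_eq rotation_eq
    by (simp add: vec_eq_iff forall_3 matrix_matrix_mult_def sum_3 cos_diff sin_diff algebra_simps *)
qed

lemma cubic_exp_generator:
  "cubic_exp \<delta> (geodesic_generator \<beta> \<phi>) t = vector [
     vector [1 + gvers \<delta> t, gsin \<delta> t * cos \<phi> - gvers \<delta> t * \<beta> * sin \<phi>,
       gsin \<delta> t * sin \<phi> + gvers \<delta> t * \<beta> * cos \<phi>],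
     vector [gsin \<delta> t * cos \<phi> + gvers \<delta> t * \<beta> * sin \<phi>, 1 + gvers \<delta> t * ((cos \<phi>)\<^sup>2 - \<beta>\<^sup>2),
       gsin \<delta> t * \<beta> + gvers \<delta> t * cos \<phi> * sin \<phi>],
     vector [gsin \<delta> t * sin \<phi> - gvers \<delta> t * \<beta> * cos \<phi>,
       gvers \<delta> t * cos \<phi> * sin \<phi> - gsin \<delta> t * \<beta>, 1 + gvers \<delta> t * ((sin \<phi>)\<^sup>2 - \<beta>\<^sup>2)]]"
  unfolding cubic_exp_def geodesic_generator_sq
  by (simp add: geodesic_generator_eq vec_eq_iff forall_3 mat_def)

lemma geodesic_deriv:
  "(geodesic \<beta> \<phi> has_vector_derivative
     geodesic \<beta> \<phi> t ** (cos (\<phi> - t * \<beta>) *\<^sub>R gen_a + sin (\<phi> - t * \<beta>) *\<^sub>R gen_b)) (at t)"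
proof -
  define M where "M = cubic_exp (1 - \<beta>\<^sup>2) (geodesic_generator \<beta> \<phi>)"
  define R where "R t = cubic_exp (-1) gen_c (t * \<beta>)" for t
  define U where "U = cos (\<phi> - t * \<beta>) *\<^sub>R gen_a + sin (\<phi> - t * \<beta>) *\<^sub>R gen_b"
  have "(M has_vector_derivative M t ** geodesic_generator \<beta> \<phi>) (at t)"
    unfolding M_def by (rule cubic_exp_deriv[OF geodesic_generator_cube])
  moreover have "(R has_vector_derivative \<beta> *\<^sub>R (R t ** gen_c)) (at t)"
  proof -
    have "((\<lambda>t. t * \<beta>) has_vector_derivative \<beta>) (at t)"
      by (auto intro!: derivative_eq_intros)
    from vector_diff_chain_at[OF this cubic_exp_deriv[OF gen_c_cube]]
    show ?thesis
      by (simp add: R_def[abs_def] o_def)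
  qed
  ultimately have "((\<lambda>t. M t ** R t) has_vector_derivative
      M t ** (\<beta> *\<^sub>R (R t ** gen_c)) + (M t ** geodesic_generator \<beta> \<phi>) ** R t) (at t)"
    by (rule bounded_bilinear.has_vector_derivative[OF bounded_bilinear_mat3])
  moreover have "M t ** (\<beta> *\<^sub>R (R t ** gen_c)) + (M t ** geodesic_generator \<beta> \<phi>) ** R t = (M t ** R t) ** U"
  proof -
    have "(M t ** geodesic_generator \<beta> \<phi>) ** R t = M t ** (geodesic_generator \<beta> \<phi> ** R t)"
      by (rule matrix_mul_assoc[symmetric])
    also have "\<dots> = M t ** (R t ** (U + (- \<beta>) *\<^sub>R gen_c))"
      unfolding R_def generator_rotation U_def by simp
    also have "\<dots> = (M t ** R t) ** U - M t ** (\<beta> *\<^sub>R (R t ** gen_c))"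
      by (simp add: mat3_diff_right mat3_scaleR_right matrix_mul_assoc)
    finally show ?thesis by simp
  qed
  moreover have "geodesic \<beta> \<phi> = (\<lambda>t. M t ** R t)"
    by (simp add: fun_eq_iff geodesic_eq M_def R_def)
  ultimately show ?thesis
    by (simp add: U_def)
qed

lemma gen_skew:
  "transpose gen_c ** lorentz_matrix = - (lorentz_matrix ** gen_c)"
  "transpose (geodesic_generator \<beta> \<phi>) ** lorentz_matrix = - (lorentz_matrix ** geodesic_generator \<beta> \<phi>)"
  by (simp_all add: geodesic_generator_eq gen_c_def lorentz_matrix_def vec_eq_iff forall_3 transpose_def
      matrix_matrix_mult_def sum_3)

lemma geodesic_O21: "geodesic \<beta> \<phi> t \<in> O21"
  unfolding geodesic_eq
  by (intro O21_mult cubic_exp_O21 geodesic_generator_cube gen_c_cube gen_skew)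

lemma geodesic_0: "geodesic \<beta> \<phi> 0 = mat 1"
proof -
  have "gsin \<delta> 0 = 0" "gvers \<delta> 0 = 0" for \<delta>
    by (simp_all add: gsin_def gvers_def gcos_def)
  then show ?thesis
    by (simp add: geodesic_eq cubic_exp_def)
qed

lemma continuous_on_geodesic [continuous_intros]:
  "continuous_on S f \<Longrightarrow> continuous_on S (\<lambda>t. geodesic \<beta> \<phi> (f t))"
proof -
  assume "continuous_on S f"
  moreover have "continuous_on UNIV (geodesic \<beta> \<phi>)"
    using geodesic_deriv
    by (meson continuous_at_imp_continuous_on has_vector_derivative_continuous)
  ultimately show ?thesis
    using continuous_on_compose2[of UNIV "geodesic \<beta> \<phi>" S f] by simp
qed

lemma geodesic_SO21: "geodesic \<beta> \<phi> t \<in> SO21"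
proof -
  have "connected (range (geodesic \<beta> \<phi>))"
    by (intro connected_continuous_image continuous_on_geodesic continuous_intros) simp
  moreover have "mat 1 \<in> range (geodesic \<beta> \<phi>)"
    using geodesic_0[of \<beta> \<phi>] by (metis rangeI)
  ultimately have "range (geodesic \<beta> \<phi>) \<subseteq> SO21"
    unfolding SO21_def using geodesic_O21 by (intro connected_component_maximal) auto
  then show ?thesis by blast
qed

lemma geodesic_segment_deriv:
  "((\<lambda>s. geodesic \<beta> \<phi> (s * d)) has_vector_derivative geodesic \<beta> \<phi> (s * d) **
      ((d * cos (\<phi> - s * d * \<beta>)) *\<^sub>R gen_a + (d * sin (\<phi> - s * d * \<beta>)) *\<^sub>R gen_b)) (at s)"
proof -
  have "((\<lambda>s. s * d) has_vector_derivative d) (at s)"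
    by (auto intro!: derivative_eq_intros)
  from vector_diff_chain_at[OF this geodesic_deriv]
  show ?thesis
    by (simp add: o_def mat3_add_right mat3_scaleR_right scaleR_add_right)
qed

lemma valid_path_geodesic: "valid_path (\<lambda>s. geodesic \<beta> \<phi> (s * d))"
proof -
  have "(\<lambda>s. geodesic \<beta> \<phi> (s * d)) C1_differentiable_on {0..1}"
    unfolding C1_differentiable_on_def
  proof (intro exI conjI ballI)
    show "continuous_on {0..1} (\<lambda>s. geodesic \<beta> \<phi> (s * d) **
      ((d * cos (\<phi> - s * d * \<beta>)) *\<^sub>R gen_a + (d * sin (\<phi> - s * d * \<beta>)) *\<^sub>R gen_b))"
      by (intro bounded_bilinear.continuous_on[OF bounded_bilinear_mat3] continuous_intros)
  qed (rule geodesic_segment_deriv)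
  then show ?thesis
    unfolding valid_path_def by (rule C1_differentiable_imp_piecewise)
qed

lemma geodesic_segment_speed:
  assumes "0 \<le> d"
  shows "sqrt ((d * cos (\<phi> - s * d * \<beta>))\<^sup>2 + (d * sin (\<phi> - s * d * \<beta>))\<^sup>2) = d"
  using assms by (simp add: power_mult_distrib flip: distrib_left)

lemma geodesic_horizontal:
  assumes "0 \<le> d"
  shows "horizontal_path_of_length (\<lambda>s. geodesic \<beta> \<phi> (s * d)) d"
  unfolding horizontal_path_of_length_def
proof (intro conjI exI ballI)
  show "path_image (\<lambda>s. geodesic \<beta> \<phi> (s * d)) \<subseteq> SO21"
    using geodesic_SO21 by (auto simp: path_image_def)
  show "finite {}" by simp
  show "((\<lambda>s. sqrt ((d * cos (\<phi> - s * d * \<beta>))\<^sup>2 + (d * sin (\<phi> - s * d * \<beta>))\<^sup>2)) has_integral d) {0..1}"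
    unfolding geodesic_segment_speed[OF assms] using has_integral_const_real[of d 0 1] by simp
qed (rule valid_path_geodesic geodesic_segment_deriv)+

lemma geodesic_z: "geodesic \<beta> \<phi> t $ 1 $ 1 = 1 + gvers (1 - \<beta>\<^sup>2) t"
  by (simp add: geodesic_eq rotation_eq cubic_exp_generator matrix_matrix_mult_def sum_3)

lemma geodesic_boost:
  "boost (geodesic \<beta> \<phi> t)
    = Complex (gsin (1 - \<beta>\<^sup>2) t) (\<beta> * gvers (1 - \<beta>\<^sup>2) t) * cis (\<phi> - t * \<beta>)"
  by (simp add: boost_def geodesic_eq rotation_eq cubic_exp_generator matrix_matrix_mult_def sum_3
      complex_eq_iff cos_diff sin_diff algebra_simps)

lemma geodesic_twist:
  "twist (geodesic \<beta> \<phi> t)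
    = Complex (2 + gvers (1 - \<beta>\<^sup>2) t * (1 - 2 * \<beta>\<^sup>2)) (- 2 * \<beta> * gsin (1 - \<beta>\<^sup>2) t) * cis (t * \<beta>)"
proof -
  define S T C D where "S = gsin (1 - \<beta>\<^sup>2) t" and "T = gvers (1 - \<beta>\<^sup>2) t"
    and "C = (cos \<phi>)\<^sup>2" and "D = (sin \<phi>)\<^sup>2"
  have e: "D = 1 - C"
    by (simp add: C_def D_def sin_squared_eq)
  have "twist (geodesic \<beta> \<phi> t) = Complex
      ((1 + T * (C - \<beta>\<^sup>2)) * cos (t * \<beta>) + (S * \<beta> + T * cos \<phi> * sin \<phi>) * sin (t * \<beta>)
       + (1 + T * (D - \<beta>\<^sup>2)) * cos (t * \<beta>) - (T * cos \<phi> * sin \<phi> - S * \<beta>) * sin (t * \<beta>))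
      ((T * cos \<phi> * sin \<phi> - S * \<beta>) * cos (t * \<beta>) + (1 + T * (D - \<beta>\<^sup>2)) * sin (t * \<beta>)
       - (S * \<beta> + T * cos \<phi> * sin \<phi>) * cos (t * \<beta>) + (1 + T * (C - \<beta>\<^sup>2)) * sin (t * \<beta>))"
    by (simp add: twist_def geodesic_eq rotation_eq cubic_exp_generator matrix_matrix_mult_def sum_3
      S_def T_def C_def D_def)
  then show ?thesis
    unfolding e S_def[symmetric] T_def[symmetric] by (simp add: complex_eq_iff algebra_simps)
qed

subsection \<open>Extremal parameters determine the distance\<close>

lemma sin_div_strict_antimono:
  fixes y1 y2 :: real
  assumes "0 < y1" "y1 < y2" "y2 \<le> pi"
  shows "sin y2 / y2 < sin y1 / y1"
proof (rule DERIV_neg_imp_decreasing[OF assms(2)])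
  fix y assume "y1 \<le> y" "y \<le> y2"
  then have y: "0 < y" "y \<le> pi" using assms by auto
  have "y * cos y - sin y < 0 * cos 0 - sin 0"
  proof (rule DERIV_neg_imp_decreasing_open[OF y(1)])
    fix x assume "0 < x" "x < y"
    moreover have "((\<lambda>y. y * cos y - sin y) has_real_derivative - (x * sin x)) (at x)"
      by (auto intro!: derivative_eq_intros)
    ultimately show "\<exists>z. ((\<lambda>y. y * cos y - sin y) has_real_derivative z) (at x) \<and> z < 0"
      using y sin_gt_zero[of x] by (intro exI[of _ "- (x * sin x)"]) auto
  qed (intro continuous_intros)
  then have "(y * cos y - sin y) / y\<^sup>2 < 0"
    using y by (simp add: divide_neg_pos)
  moreover have "((\<lambda>y. sin y / y) has_real_derivative (y * cos y - sin y) / y\<^sup>2) (at y)"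
    using y by (auto intro!: derivative_eq_intros simp: power2_eq_square field_simps)
  ultimately show "\<exists>z. ((\<lambda>y. sin y / y) has_real_derivative z) (at y) \<and> z < 0"
    by blast
qed

lemma sinh_div_strict_mono:
  fixes y1 y2 :: real
  assumes "0 < y1" "y1 < y2"
  shows "sinh y1 / y1 < sinh y2 / y2"
proof (rule DERIV_pos_imp_increasing[OF assms(2)])
  fix y assume "y1 \<le> y" "y \<le> y2"
  then have y: "0 < y" using assms by auto
  have "0 * cosh 0 - sinh 0 < y * cosh y - sinh y"
  proof (rule DERIV_pos_imp_increasing_open[OF y])
    fix x assume "0 < x" "x < y"
    moreover have "((\<lambda>y. y * cosh y - sinh y) has_real_derivative x * sinh x) (at x)"
      by (auto intro!: derivative_eq_intros)
    ultimately show "\<exists>z. ((\<lambda>y. y * cosh y - sinh y) has_real_derivative z) (at x) \<and> 0 < z"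
      by (intro exI[of _ "x * sinh x"]) auto
  qed (intro continuous_intros)
  then have "0 < (y * cosh y - sinh y) / y\<^sup>2"
    using y by simp
  moreover have "((\<lambda>y. sinh y / y) has_real_derivative (y * cosh y - sinh y) / y\<^sup>2) (at y)"
    using y by (auto intro!: derivative_eq_intros simp: power2_eq_square field_simps)
  ultimately show "\<exists>z. ((\<lambda>y. sinh y / y) has_real_derivative z) (at y) \<and> 0 < z"
    by blast
qed

lemma sin_less_arg:
  fixes y :: real
  assumes "0 < y" "y \<le> pi"
  shows "sin y < y"
proof -
  have "0 - sin 0 < y - sin y"
  proof (rule DERIV_pos_imp_increasing_open[OF assms(1)])
    fix x assume "0 < x" "x < y"
    then have "cos x < cos 0"
      using assms by (intro cos_monotone_0_pi) auto
    moreover have "((\<lambda>y. y - sin y) has_real_derivative 1 - cos x) (at x)"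
      by (auto intro!: derivative_eq_intros)
    ultimately show "\<exists>z. ((\<lambda>y. y - sin y) has_real_derivative z) (at x) \<and> 0 < z"
      by (intro exI[of _ "1 - cos x"]) auto
  qed (intro continuous_intros)
  then show ?thesis by simp
qed

lemma sinh_greater_arg:
  fixes y :: real
  assumes "0 < y"
  shows "y < sinh y"
proof -
  have "sinh 0 - 0 < sinh y - y"
  proof (rule DERIV_pos_imp_increasing_open[OF assms(1)])
    fix x assume "0 < x" "x < y"
    then have "1 < cosh x"
      using cosh_real_strict_mono[of 0 x] by simp
    moreover have "((\<lambda>y. sinh y - y) has_real_derivative cosh x - 1) (at x)"
      by (auto intro!: derivative_eq_intros)
    ultimately show "\<exists>z. ((\<lambda>y. sinh y - y) has_real_derivative z) (at x) \<and> 0 < z"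
      by (intro exI[of _ "cosh x - 1"]) auto
  qed (intro continuous_intros)
  then show ?thesis by simp
qed

text \<open>With \<open>y = sqrt \<bar>\<delta>\<bar> * x\<close>, the quotient
  \<open>gsin \<delta> x / x\<close> is \<open>sin y / y\<close>, 1 or \<open>sinh y / y\<close>
  according to the sign of \<delta>. At \<open>x = d / 2\<close> the bound by \<pi> says that the
  arc ends no later than its first return to SO(2); up to there \<open>z\<close> and the length
  determine \<open>\<beta>\<^sup>2\<close>.\<close>

lemma gsin_strict_mono:
  assumes "0 < x" "\<delta>1 < \<delta>2" and pi: "\<delta>1 < 0 \<Longrightarrow> sqrt (- \<delta>1) * x \<le> pi"
  shows "gsin \<delta>1 x < gsin \<delta>2 x"
proof -
  have neg_less: "sin (r * x) / r < x" if "0 < r" "r * x \<le> pi" for r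
    using sin_less_arg[of "r * x"] that \<open>0 < x\<close> by (simp add: field_simps)
  have pos_greater: "x < sinh (r * x) / r" if "0 < r" for r
    using sinh_greater_arg[of "r * x"] that \<open>0 < x\<close> by (simp add: field_simps)
  consider (nn) "\<delta>2 < 0" | (n) "\<delta>1 < 0" "0 \<le> \<delta>2" | (p) "0 \<le> \<delta>1" by linarith
  then show ?thesis
  proof cases
    case nn
    define r1 r2 where "r1 = sqrt (- \<delta>1)" and "r2 = sqrt (- \<delta>2)"
    have r: "0 < r2" "r2 < r1" "r1 * x \<le> pi"
      using nn assms by (auto simp: r1_def r2_def)
    have "sin (r1 * x) / (r1 * x) < sin (r2 * x) / (r2 * x)"
      using r \<open>0 < x\<close> by (intro sin_div_strict_antimono) auto
    then have "sin (r1 * x) / r1 < sin (r2 * x) / r2"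
      using r \<open>0 < x\<close> by (simp add: divide_less_cancel flip: divide_divide_eq_left)
    then show ?thesis
      using nn assms by (simp add: gsin_def r1_def r2_def)
  next
    case n
    have "gsin \<delta>1 x < x"
      using neg_less[of "sqrt (- \<delta>1)"] n pi by (simp add: gsin_def)
    moreover have "x \<le> gsin \<delta>2 x"
      using pos_greater[of "sqrt \<delta>2"] n by (auto simp: gsin_def intro: less_imp_le)
    ultimately show ?thesis by simp
  next
    case p
    define r1 r2 where "r1 = sqrt \<delta>1" and "r2 = sqrt \<delta>2"
    have r: "0 \<le> r1" "r1 < r2"
      using p assms by (auto simp: r1_def r2_def)
    show ?thesis
    proof (cases "r1 = 0")
      case True
      then show ?thesis
        using pos_greater[of r2] r p assms by (simp add: gsin_def r1_def r2_def)
    next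
      case False
      have "sinh (r1 * x) / (r1 * x) < sinh (r2 * x) / (r2 * x)"
        using False r \<open>0 < x\<close> by (intro sinh_div_strict_mono) auto
      then have "sinh (r1 * x) / r1 < sinh (r2 * x) / r2"
        using r \<open>0 < x\<close> by (simp add: divide_less_cancel flip: divide_divide_eq_left)
      then show ?thesis
        using False p assms by (simp add: gsin_def r1_def r2_def)
    qed
  qed
qed

text \<open>The derivative of \<open>arccos (cos y / c)\<close> is
  \<open>sin y / sqrt (c\<^sup>2 - cos\<^sup>2 y)\<close>, hence at most 1. So at fixed
  \<open>c\<close> and up to \<open>\<kappa> l = 2 \<pi>\<close>,
  \<open>b l - 2 arccos (cos (\<kappa> l / 2) / c)\<close> grows in \<open>l\<close> at rate at
  least \<open>b - \<kappa> > 0\<close>, which turns monotonicity of the phase into a bound on the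
  length.\<close>

lemma arccos_cos_div_diff:
  fixes c y1 y2 :: real
  assumes "1 \<le> c" "0 \<le> y1" "y1 \<le> y2" "y2 \<le> pi"
  shows "arccos (cos y2 / c) - arccos (cos y1 / c) \<le> y2 - y1"
proof (cases "c = 1")
  case True
  then show ?thesis
    using assms by (simp add: arccos_cos)
next
  case False
  then have c: "1 < c" using assms by simp
  have "y1 - arccos (cos y1 / c) \<le> y2 - arccos (cos y2 / c)"
  proof (rule DERIV_nonneg_imp_nondecreasing[OF assms(3)])
    fix y assume "y1 \<le> y" "y \<le> y2"
    then have s: "0 \<le> sin y"
      using assms by (intro sin_ge_zero) auto
    have b: "- 1 < cos y / c" "cos y / c < 1"
    proof -
      have "- c < cos y" "cos y < c"
        using c cos_ge_minus_one[of y] cos_le_one[of y] by linarith+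
      then show "- 1 < cos y / c" "cos y / c < 1"
        using c by (simp_all add: field_simps)
    qed
    have "((\<lambda>y. arccos (cos y / c)) has_real_derivative inverse (- sqrt (1 - (cos y / c)\<^sup>2)) * (- sin y / c)) (at y)"
      by (rule DERIV_chain2[where f = arccos and g = "\<lambda>y. cos y / c", OF DERIV_arccos[OF b]]) (use c in \<open>auto intro!: derivative_eq_intros\<close>)
    note d = DERIV_diff[OF DERIV_ident this]
    have "(cos y / c)\<^sup>2 + (sin y / c)\<^sup>2 = (1 / c)\<^sup>2"
      by (simp add: power_divide flip: add_divide_distrib)
    moreover have "(1 / c)\<^sup>2 \<le> 1"
      using c by (simp add: power_le_one)
    ultimately have "(sin y / c)\<^sup>2 \<le> 1 - (cos y / c)\<^sup>2" by linarith
    then have "sin y / c \<le> sqrt (1 - (cos y / c)\<^sup>2)"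
      by (rule real_le_rsqrt)
    moreover have "0 < sqrt (1 - (cos y / c)\<^sup>2)"
      using b by (simp add: abs_square_less_1)
    ultimately have "sin y / c / sqrt (1 - (cos y / c)\<^sup>2) \<le> 1"
      by (simp only: divide_le_eq_1_pos)
    then have "0 \<le> 1 - inverse (- sqrt (1 - (cos y / c)\<^sup>2)) * (- sin y / c)"
      by (simp add: divide_inverse mult_ac)
    with d show "\<exists>z. ((\<lambda>y. y - arccos (cos y / c)) has_real_derivative z) (at y) \<and> 0 \<le> z"
      by blast
  qed
  then show ?thesis by simp
qed

text \<open>The end point conditions for a geodesic with \<open>\<bar>\<beta>\<bar> = b\<close> and length \<open>d\<close> from \<open>e\<close> to \<open>C\<close>, stopped not later than
  its first return to \<open>SO(2)\<close>. The last equation fixes the lift of the angle, not only its value modulo \<open>2\<pi>\<close>.\<close>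

definition extremal :: "mat3 \<Rightarrow> real \<Rightarrow> real \<Rightarrow> bool" where
  "extremal C b d \<longleftrightarrow> 0 \<le> b \<and> 0 \<le> d \<and> (1 < b \<longrightarrow> sqrt (b\<^sup>2 - 1) * d \<le> 2 * pi) \<and>
     gsin (1 - b\<^sup>2) (d / 2) = sqrt ((C$1$1 - 1) / 2) \<and>
     b * d = abs_eta C + 2 * arccos (gcos (1 - b\<^sup>2) (d / 2) / sqrt ((1 + C$1$1) / 2))"

lemma cis_rotate_ex:
  assumes "cmod a = cmod b"
  obtains \<alpha> where "b = a * cis \<alpha>"
proof (cases "a = 0")
  case True
  then show ?thesis using assms that by auto
next
  case False
  then have "cmod (b / a) = 1"
    using assms by (metis divide_self_if norm_divide norm_eq_zero)
  then have "b / a = cis (Arg (b / a))"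
    using rcis_cmod_Arg[of "b / a"] by (simp add: rcis_def)
  then show ?thesis
    using False that[of "Arg (b / a)"] by (metis nonzero_mult_div_cancel_left times_divide_eq_right)
qed

text \<open>\<open>arccos (k / c)\<close> is half the angle by which the exponential of the
  generator turns backwards. Its sine \<open>b * s / c\<close> is nonnegative up to the first return
  to SO(2), so the principal value is the correct lift there.\<close>

lemma extremal_half_angle:
  assumes "C \<in> SO21" "extremal C b d"
  defines "s \<equiv> sqrt ((C$1$1 - 1) / 2)" and "c \<equiv> sqrt ((1 + C$1$1) / 2)" and "k \<equiv> gcos (1 - b\<^sup>2) (d / 2)"
  shows "k\<^sup>2 = c\<^sup>2 - (b * s)\<^sup>2" "c\<^sup>2 = 1 + s\<^sup>2" "C$1$1 = 1 + 2 * s\<^sup>2" "0 \<le> s" "1 \<le> c" "\<bar>k / c\<bar> \<le> 1"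
    "sin (arccos (k / c)) = b * s / c"
proof -
  have z: "1 \<le> C$1$1" by (rule SO21_z_ge1[OF assms(1)])
  have s2: "s\<^sup>2 = (C$1$1 - 1) / 2" and c2: "c\<^sup>2 = (1 + C$1$1) / 2"
    using z by (simp_all add: s_def c_def)
  show cs: "c\<^sup>2 = 1 + s\<^sup>2" and "C$1$1 = 1 + 2 * s\<^sup>2"
    unfolding s2 c2 by (simp_all add: field_simps)
  show s: "0 \<le> s" and c: "1 \<le> c"
    using z by (simp_all add: s_def c_def)
  have "b \<ge> 0" and g: "gsin (1 - b\<^sup>2) (d / 2) = s"
    using assms(2) by (simp_all add: extremal_def s_def)
  have "k\<^sup>2 = 1 + (1 - b\<^sup>2) * s\<^sup>2"
    unfolding k_def gcos_squared g ..
  then show k: "k\<^sup>2 = c\<^sup>2 - (b * s)\<^sup>2"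
    unfolding cs by (simp add: power_mult_distrib algebra_simps)
  then have "k\<^sup>2 \<le> c\<^sup>2" by simp
  then have "\<bar>k\<bar> \<le> c"
    using c by (metis abs_le_square_iff abs_of_nonneg order_trans zero_le_one)
  then show kc: "\<bar>k / c\<bar> \<le> 1"
    using c by (simp add: abs_divide divide_le_eq_1)
  have "1 - (k / c)\<^sup>2 = (b * s / c)\<^sup>2"
    using c by (simp add: power_divide k field_simps)
  then have "sqrt (1 - (k / c)\<^sup>2) = b * s / c"
    using s c \<open>b \<ge> 0\<close> by simp
  then show "sin (arccos (k / c)) = b * s / c"
    using kc by (simp add: sin_arccos_abs)
qed

lemma extremal_reached:
  assumes C: "C \<in> SO21" and e: "extremal C b d"
  obtains \<beta> \<phi> where "C = geodesic \<beta> \<phi> d"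
proof -
  define s c k \<delta> h where "s = sqrt ((C$1$1 - 1) / 2)" and "c = sqrt ((1 + C$1$1) / 2)"
    and "k = gcos (1 - b\<^sup>2) (d / 2)" and "\<delta> = 1 - b\<^sup>2" and "h = 2 * arccos (k / c)"
  note H = extremal_half_angle[OF C e, folded s_def c_def k_def]
  have g: "gsin \<delta> (d / 2) = s" and bd: "b * d = abs_eta C + h"
    using e by (simp_all add: extremal_def s_def c_def \<delta>_def k_def h_def)
  have k\<delta>: "gcos \<delta> (d / 2) = k"
    by (simp add: k_def \<delta>_def)
  define S T where "S = gsin \<delta> d" and "T = gvers \<delta> d"
  have T: "T = 2 * s\<^sup>2" and S: "S = 2 * s * k"
    unfolding T_def S_def by (simp_all add: gvers_half[of _ d] gsin_double[of _ d] g k\<delta>)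
  have ck: "c * cos (arccos (k / c)) = k" "c * sin (arccos (k / c)) = b * s"
    using H by (simp_all add: cos_arccos_abs)
  have "2 * c\<^sup>2 * cos h = 2 * (c * cos (arccos (k / c)))\<^sup>2 - 2 * (c * sin (arccos (k / c)))\<^sup>2"
    unfolding h_def cos_double by (simp add: power_mult_distrib algebra_simps)
  also have "\<dots> = 2 + T * (1 - 2 * b\<^sup>2)"
    unfolding ck T H(1,2) by (simp add: power_mult_distrib algebra_simps)
  finally have ch: "2 * c\<^sup>2 * cos h = 2 + T * (1 - 2 * b\<^sup>2)" .
  have "2 * c\<^sup>2 * sin h = 4 * (c * sin (arccos (k / c))) * (c * cos (arccos (k / c)))"
    unfolding h_def sin_double by (simp add: power2_eq_square)
  also have "\<dots> = 2 * b * S"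
    unfolding ck S by simp
  finally have sh: "2 * c\<^sup>2 * sin h = 2 * b * S" .
  have c2: "1 + C$1$1 = 2 * c\<^sup>2"
    using H(2,3) by simp
  \<comment> \<open>The sign for \<beta>: \<open>\<sigma> * abs_eta C\<close> is an argument of
    \<open>twist C\<close>.\<close>
  define \<sigma> :: real where "\<sigma> = (if Im (twist C) \<ge> 0 then 1 else - 1)"
  have \<sigma>: "\<sigma> = 1 \<or> \<sigma> = - 1" by (simp add: \<sigma>_def)
  have "Im (twist C) = \<sigma> * \<bar>Im (twist C)\<bar>"
    by (simp add: \<sigma>_def)
  then have "twist C = of_real (2 * c\<^sup>2) * cis (\<sigma> * abs_eta C)"
    using SO21_abs_eta(3,4)[OF C] \<sigma> c2 by (auto simp: complex_eq_iff)
  also have "\<dots> = of_real (2 * c\<^sup>2) * (cis (- (\<sigma> * h)) * cis (d * (\<sigma> * b)))"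
    unfolding cis_mult using bd by (simp add: algebra_simps)
  also have "\<dots> = Complex (2 + T * (1 - 2 * (\<sigma> * b)\<^sup>2)) (- 2 * (\<sigma> * b) * S) * cis (d * (\<sigma> * b))"
    using \<sigma> ch sh by (auto simp: complex_eq_iff simp flip: mult.assoc)
  finally have tw: "twist C = twist (geodesic (\<sigma> * b) \<phi> d)" for \<phi>
    using \<sigma> unfolding geodesic_twist by (auto simp: power_mult_distrib S_def T_def \<delta>_def)
  \<comment> \<open>\<phi> enters the end point only through a rotation of \<open>boost\<close>, so
    equal moduli suffice to find it.\<close>
  have "(cmod (Complex S ((\<sigma> * b) * T)))\<^sup>2 = S\<^sup>2 + b\<^sup>2 * T\<^sup>2"
    using \<sigma> by (auto simp: cmod_power2 power_mult_distrib)
  also have "\<dots> = (C$1$1)\<^sup>2 - 1"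
    unfolding S_def gsin_squared T_def[symmetric] H(3) using T by (simp add: \<delta>_def power2_eq_square algebra_simps)
  also have "\<dots> = (cmod (boost C))\<^sup>2"
    using SO21_norm_boost[OF C] by simp
  finally have "cmod (Complex S ((\<sigma> * b) * T)) = cmod (boost C)"
    by (simp add: power2_eq_iff_nonneg)
  then obtain \<alpha> where "boost C = Complex S ((\<sigma> * b) * T) * cis \<alpha>"
    by (rule cis_rotate_ex)
  then have "boost C = boost (geodesic (\<sigma> * b) (\<alpha> + d * (\<sigma> * b)) d)"
    using \<sigma> unfolding geodesic_boost by (auto simp: power_mult_distrib S_def T_def \<delta>_def)
  then have "C = geodesic (\<sigma> * b) (\<alpha> + d * (\<sigma> * b)) d"
    by (intro SO21_eqI C geodesic_SO21 tw)
  then show ?thesis by (rule that)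
qed

text \<open>The angle is bounded from below only, since a path may reach any lift of the angle of
  \<open>C\<close>, and the phase decreases in \<psi>. If the length is \<open>d\<close>, the phase
  starts at 0 and ends at most at 0; being monotone, it vanishes all along the curve.\<close>

lemma extremal_fast_bound:
  assumes C: "C \<in> SO21" and e: "extremal C b d" and "1 < b"
    and curve: "reduced_curve z \<psi> l" and start: "z 0 = 1" "\<psi> 0 = 0" "l 0 = 0"
    and "z 1 = C$1$1" "abs_eta C \<le> \<psi> 1" "0 \<le> l 1"
  shows "d \<le> l 1"
    and "l 1 = d \<Longrightarrow> t \<in> {0..1} \<Longrightarrow>
      b * l t - \<psi> t = 2 * arccos (cos (sqrt (b\<^sup>2 - 1) * l t / 2) / sqrt ((1 + z t) / 2))"
proof -
  define \<kappa> where "\<kappa> = sqrt (b\<^sup>2 - 1)"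
  define c where "c = sqrt ((1 + C$1$1) / 2)"
  define D where "D t = b * l t - \<psi> t - 2 * arccos (cos (\<kappa> * l t / 2) / sqrt ((1 + z t) / 2))" for t
  have "1 < b\<^sup>2"
    using \<open>1 < b\<close> by (simp add: power2_eq_square less_1_mult)
  then have \<kappa>: "b\<^sup>2 = \<kappa>\<^sup>2 + 1" "0 < \<kappa>"
    by (simp_all add: \<kappa>_def)
  then have \<delta>: "1 - b\<^sup>2 = - (\<kappa>\<^sup>2)" by simp
  have "\<kappa>\<^sup>2 < b\<^sup>2" using \<kappa> by simp
  then have "\<kappa> < b"
    using \<open>1 < b\<close> by (intro power_less_imp_less_base[of \<kappa> 2 b]) auto
  have d: "0 \<le> d" "\<kappa> * d \<le> 2 * pi" "b * d = abs_eta C + 2 * arccos (cos (\<kappa> * d / 2) / c)"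
    using e \<kappa>(2) \<open>1 < b\<close> unfolding extremal_def \<delta> by (simp_all add: \<kappa>_def[symmetric] c_def)
  have mono: "D t1 \<le> D t2" if "0 \<le> t1" "t1 \<le> t2" "t2 \<le> 1" for t1 t2
    unfolding D_def using fast_phase_nondecreasing[OF curve that \<kappa>(1)] \<open>1 < b\<close> by simp
  have D0: "D 0 = 0" by (simp add: D_def start)
  have D1: "D 1 = b * l 1 - \<psi> 1 - 2 * arccos (cos (\<kappa> * l 1 / 2) / c)"
    by (simp add: D_def c_def assms(8))
  have "c \<ge> 1"
    using SO21_z_ge1[OF C] by (simp add: c_def)
  show "d \<le> l 1"
  proof (rule ccontr)
    assume "\<not> d \<le> l 1"
    then have less: "l 1 < d" by simp
    have "arccos (cos (\<kappa> * d / 2) / c) - arccos (cos (\<kappa> * l 1 / 2) / c) \<le> \<kappa> * d / 2 - \<kappa> * l 1 / 2"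
      using \<open>c \<ge> 1\<close> d less \<kappa>(2) \<open>0 \<le> l 1\<close> by (intro arccos_cos_div_diff) auto
    moreover have "0 \<le> D 1"
      using mono[of 0 1] D0 by simp
    ultimately have "b * d - b * l 1 \<le> \<kappa> * d - \<kappa> * l 1"
      using d(3) assms(9) D1 by linarith
    then have "b * (d - l 1) \<le> \<kappa> * (d - l 1)"
      by (simp add: algebra_simps)
    with less \<open>\<kappa> < b\<close> show False
      by (simp add: mult_le_cancel_right)
  qed
  show "b * l t - \<psi> t = 2 * arccos (cos (sqrt (b\<^sup>2 - 1) * l t / 2) / sqrt ((1 + z t) / 2))"
    if "l 1 = d" "t \<in> {0..1}"
  proof -
    have "D 1 \<le> 0"
      using D1 d(3) assms(9) unfolding that(1) by linarith
    then have "D t = 0"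
      using mono[of 0 t] mono[of t 1] that(2) D0 by simp
    then show ?thesis
      by (simp add: D_def \<kappa>_def)
  qed
qed

lemma slow_potential_1: "slow_potential b 1 = 0"
  by (simp add: slow_potential_def)

text \<open>On the extremal the calibration is exact: the arsinh term is
  \<open>(1 - b\<^sup>2) d\<close>, the arcsin term is \<open>b (b d - abs_eta C)\<close>, and their
  sum is \<open>d - b abs_eta C\<close>.\<close>

lemma extremal_slow_length:
  assumes C: "C \<in> SO21" and e: "extremal C b d" and "b \<le> 1"
  shows "d = b * abs_eta C + slow_potential b (C$1$1)"
proof -
  define \<kappa> where "\<kappa> = sqrt (1 - b\<^sup>2)"
  define s c k where "s = sqrt ((C$1$1 - 1) / 2)" and "c = sqrt ((1 + C$1$1) / 2)"
    and "k = gcos (1 - b\<^sup>2) (d / 2)"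
  note H = extremal_half_angle[OF C e, folded s_def c_def k_def]
  have b: "0 \<le> b" and g: "gsin (1 - b\<^sup>2) (d / 2) = s" and bd: "b * d = abs_eta C + 2 * arccos (k / c)"
    using e by (simp_all add: extremal_def s_def c_def k_def)
  have "b\<^sup>2 \<le> 1"
    using b \<open>b \<le> 1\<close> by (simp add: power_le_one)
  then have \<kappa>: "1 - b\<^sup>2 = \<kappa>\<^sup>2" "0 \<le> \<kappa>"
    by (simp_all add: \<kappa>_def)
  have 1: "\<kappa> * arsinh (\<kappa> * s) = \<kappa>\<^sup>2 * d / 2"
  proof (cases "\<kappa> = 0")
    case False
    then have "sinh (\<kappa> * (d / 2)) = \<kappa> * s"
      using g \<kappa> by (simp add: field_simps)
    then have "arsinh (\<kappa> * s) = \<kappa> * (d / 2)"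
      by (metis arsinh_sinh_real)
    then show ?thesis by (simp add: power2_eq_square)
  qed simp
  \<comment> \<open>For \<open>b \<le> 1\<close> the function \<open>gcos\<close> never changes
    sign, so \<open>arccos (k / c)\<close> stays in the range of arcsin.\<close>
  have "k \<ge> 0"
  proof (cases "\<kappa> = 0")
    case False
    then show ?thesis using \<kappa> by (simp add: k_def)
  next
    case True
    then show ?thesis using \<kappa> by (simp add: k_def)
  qed
  have "sqrt ((C$1$1 - 1) / (C$1$1 + 1)) = s / c"
  proof -
    have "(C$1$1 - 1) / (C$1$1 + 1) = s\<^sup>2 / c\<^sup>2"
      unfolding H(2,3) by (simp add: divide_simps)
    also have "\<dots> = (s / c)\<^sup>2" by (simp add: power_divide)
    finally show ?thesis using H(4,5) by simp
  qed
  moreover have "arcsin (b * s / c) = arccos (k / c)"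
  proof -
    have kc: "0 \<le> k / c" "k / c \<le> 1"
      using H(5,6) \<open>k \<ge> 0\<close> by auto
    then have "0 \<le> arccos (k / c)" "arccos (k / c) \<le> pi / 2"
      using arccos_le_pi2[of "k / c"] arccos_lbound[of "k / c"] by auto
    then show ?thesis
      using H(7) arcsin_sin[of "arccos (k / c)"] pi_ge_zero by simp
  qed
  ultimately have "slow_potential b (C$1$1) = \<kappa>\<^sup>2 * d + b * (2 * arccos (k / c))"
    using 1 unfolding slow_potential_def \<kappa>_def[symmetric] s_def[symmetric] by simp
  also have "2 * arccos (k / c) = b * d - abs_eta C"
    using bd by simp
  finally show ?thesis
    unfolding \<kappa>(1)[symmetric] by (simp add: power2_eq_square algebra_simps)
qed

lemma extremal_slow_bound:
  assumes C: "C \<in> SO21" and e: "extremal C b d" and "b \<le> 1"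
    and curve: "reduced_curve z \<psi> l" and start: "z 0 = 1" "\<psi> 0 = 0" "l 0 = 0"
    and "z 1 = C$1$1" "abs_eta C \<le> \<psi> 1"
  shows "d \<le> l 1"
    and "l 1 = d \<Longrightarrow> t \<in> {0..1} \<Longrightarrow> l t = b * \<psi> t + slow_potential b (z t)"
proof -
  define D where "D t = l t - b * \<psi> t - slow_potential b (z t)" for t
  have b: "0 \<le> b" using e by (simp add: extremal_def)
  have mono: "D t1 \<le> D t2" if "0 \<le> t1" "t1 \<le> t2" "t2 \<le> 1" for t1 t2
    unfolding D_def using slow_potential_nondecreasing[OF curve that b \<open>b \<le> 1\<close>] .
  have D0: "D 0 = 0" by (simp add: D_def start slow_potential_1)
  have "b * abs_eta C \<le> b * \<psi> 1"
    using b assms(9) by (rule mult_left_mono[rotated])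
  then have D1: "D 1 \<le> l 1 - d"
    using extremal_slow_length[OF C e \<open>b \<le> 1\<close>] assms(8) by (simp add: D_def)
  show "d \<le> l 1"
    using mono[of 0 1] D0 D1 by simp
  show "l t = b * \<psi> t + slow_potential b (z t)" if "l 1 = d" "t \<in> {0..1}"
  proof -
    have "D t = 0"
      using mono[of 0 t] mono[of t 1] that D0 D1 by simp
    then show ?thesis by (simp add: D_def)
  qed
qed

lemma abs_eta_le_twist_angle:
  assumes C: "C \<in> SO21" and "twist C = of_real (1 + C$1$1) * cis x"
  shows "abs_eta C \<le> \<bar>x\<bar>"
proof (rule ccontr)
  assume "\<not> abs_eta C \<le> \<bar>x\<bar>"
  then have "cos (abs_eta C) < cos \<bar>x\<bar>"
    using SO21_abs_eta(2)[OF C] by (intro cos_monotone_0_pi) auto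
  moreover have "Re (twist C) = (1 + C$1$1) * cos x"
    unfolding assms(2) by simp
  then have "(1 + C$1$1) * cos (abs_eta C) = (1 + C$1$1) * cos \<bar>x\<bar>"
    using SO21_abs_eta(3)[OF C] by simp
  then have "cos (abs_eta C) = cos \<bar>x\<bar>"
    using SO21_z_ge1[OF C] by (subst (asm) mult_cancel_left) linarith
  ultimately show False by linarith
qed

lemma signed_reduced_curve:
  assumes "reduced_curve z \<psi> l"
  obtains \<sigma> :: real where "\<bar>\<sigma>\<bar> = 1" "\<sigma> * \<psi> 1 = \<bar>\<psi> 1\<bar>" "reduced_curve z (\<lambda>t. \<sigma> * \<psi> t) l"
proof (cases "\<psi> 1 \<ge> 0")
  case True
  then show ?thesis using that[of 1] assms by simp
next
  case False
  then show ?thesis using that[of "- 1"] reduced_curve_uminus[OF assms] by simp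
qed

lemma extremal_lower_bound:
  assumes C: "C \<in> SO21" and e: "extremal C b d"
    and p: "horizontal_path_of_length p L" "pathstart p = mat 1" "pathfinish p = C"
  shows "d \<le> L"
proof -
  obtain u v S where vp: "valid_path p" "path_image p \<subseteq> SO21" "finite S"
    and dp: "\<And>t. t \<in> {0..1} - S \<Longrightarrow> (p has_vector_derivative p t ** (u t *\<^sub>R gen_a + v t *\<^sub>R gen_b)) (at t)"
    and L: "((\<lambda>t. sqrt ((u t)\<^sup>2 + (v t)\<^sup>2)) has_integral L) {0..1}"
    using p(1) unfolding horizontal_path_of_length_def by blast
  have int: "(\<lambda>t. sqrt ((u t)\<^sup>2 + (v t)\<^sup>2)) integrable_on {0..1}"
    using L by blast
  obtain \<psi> where
    curve: "reduced_curve (\<lambda>t. p t $ 1 $ 1) \<psi> (\<lambda>t. integral {0..t} (\<lambda>t. sqrt ((u t)\<^sup>2 + (v t)\<^sup>2)))"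
    and "\<psi> 0 = 0" and tw: "\<forall>t\<in>{0..1}. twist (p t) = of_real (1 + p t $ 1 $ 1) * cis (\<psi> t)"
    using horizontal_reduced_curve[OF vp dp int p(2)] .
  define l where "l t = integral {0..t} (\<lambda>t. sqrt ((u t)\<^sup>2 + (v t)\<^sup>2))" for t
  obtain \<sigma> :: real where \<sigma>: "\<bar>\<sigma>\<bar> = 1" "\<sigma> * \<psi> 1 = \<bar>\<psi> 1\<bar>"
    and curve': "reduced_curve (\<lambda>t. p t $ 1 $ 1) (\<lambda>t. \<sigma> * \<psi> t) l"
    using signed_reduced_curve[OF curve] unfolding l_def by blast
  have p01: "p 0 $ 1 $ 1 = 1" "p 1 = C"
    using p(2,3) by (simp_all add: pathstart_def pathfinish_def mat_def)
  have l: "l 0 = 0" "l 1 = L" "0 \<le> L"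
    using L by (simp_all add: l_def integral_unique has_integral_nonneg[OF L])
  have eta: "abs_eta C \<le> \<sigma> * \<psi> 1"
    using abs_eta_le_twist_angle[OF C] bspec[OF tw, of 1] p01 \<sigma>(2) by simp
  show ?thesis
  proof (cases "b \<le> 1")
    case True
    from extremal_slow_bound(1)[OF C e True curve'] show ?thesis
      using p01 l eta \<open>\<psi> 0 = 0\<close> by simp
  next
    case False
    then have "1 < b" by simp
    from extremal_fast_bound(1)[OF C e this curve'] show ?thesis
      using p01 l eta \<open>\<psi> 0 = 0\<close> by simp
  qed
qed

lemma extremal_dist:
  assumes C: "C \<in> SO21" and e: "extremal C b d"
  shows "sr_dist (mat 1) C = d"
proof -
  obtain \<beta> \<phi> where g: "C = geodesic \<beta> \<phi> d"
    using extremal_reached[OF C e] .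
  have "horizontal_path_of_length (\<lambda>s. geodesic \<beta> \<phi> (s * d)) d"
    using e by (intro geodesic_horizontal) (simp add: extremal_def)
  then show ?thesis
    unfolding sr_dist_def
    by (intro cInf_eq_minimum)
      (auto simp: pathstart_def pathfinish_def geodesic_0 g intro!: exI extremal_lower_bound[OF C e])
qed

text \<open>\<open>x - sqrt (x\<^sup>2 - 1)\<close> is the angle per unit length that a geodesic
  with parameter \<open>x\<close> has gained at its first return to SO(2).\<close>

lemma speed_gap_antimono:
  fixes x y :: real
  assumes "1 < x" "x < y"
  shows "y - sqrt (y\<^sup>2 - 1) < x - sqrt (x\<^sup>2 - 1)"
proof -
  have gap: "x - sqrt (x\<^sup>2 - 1) = 1 / (x + sqrt (x\<^sup>2 - 1))" if "1 < x" for x :: real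
  proof -
    have "1 \<le> x\<^sup>2" using that by (simp add: power2_eq_square less_1_mult less_imp_le)
    then have "(x - sqrt (x\<^sup>2 - 1)) * (x + sqrt (x\<^sup>2 - 1)) = 1"
      by (simp add: algebra_simps flip: power2_eq_square)
    moreover have "x + sqrt (x\<^sup>2 - 1) > 0"
      using that \<open>1 \<le> x\<^sup>2\<close> by (intro add_pos_nonneg) auto
    ultimately show ?thesis by (simp add: field_simps)
  qed
  have "x\<^sup>2 < y\<^sup>2" using assms by (intro power_strict_mono) auto
  then have "sqrt (x\<^sup>2 - 1) < sqrt (y\<^sup>2 - 1)" by simp
  moreover have "0 \<le> sqrt (x\<^sup>2 - 1)"
    using assms by (simp add: power2_eq_square less_1_mult less_imp_le)
  ultimately show ?thesis
    using assms unfolding gap[OF \<open>1 < x\<close>] gap[OF less_trans[OF assms]]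
    by (intro divide_strict_left_mono mult_pos_pos) linarith+
qed

text \<open>Positive \<open>abs_eta C\<close> excludes \<open>d = 0\<close>, where every \<beta>
  would do. The main point is \<open>small\<close>: the arc ends no later than its first return to
  SO(2), after which \<open>gsin_strict_mono\<close> compares the parameters.\<close>

lemma extremal_unique:
  assumes C: "C \<in> SO21" and e: "extremal C b d" and "abs_eta C > 0" and \<beta>: "C = geodesic \<beta> \<phi> d"
  shows "\<bar>\<beta>\<bar> = b"
proof -
  define B where "B = \<bar>\<beta>\<bar>"
  have B: "0 \<le> B" "B\<^sup>2 = \<beta>\<^sup>2" by (simp_all add: B_def)
  have b: "0 \<le> b" and "0 \<le> d" using e by (simp_all add: extremal_def)
  have "d \<noteq> 0"
  proof
    assume "d = 0"
    then have "C = mat 1" using \<beta> by (simp add: geodesic_0)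
    then show False using \<open>abs_eta C > 0\<close> by (simp add: abs_eta_def mat_def)
  qed
  then have "0 < d" using \<open>0 \<le> d\<close> by simp
  have small: "sqrt (B\<^sup>2 - 1) * d \<le> 2 * pi" if "1 < B"
  proof (rule ccontr)
    define \<kappa> where "\<kappa> = sqrt (B\<^sup>2 - 1)"
    assume "\<not> sqrt (B\<^sup>2 - 1) * d \<le> 2 * pi"
    then have big: "2 * pi < \<kappa> * d" by (simp add: \<kappa>_def)
    have "1 < B\<^sup>2" using that by (simp add: power2_eq_square less_1_mult)
    then have \<kappa>: "B\<^sup>2 = \<kappa>\<^sup>2 + 1" "0 < \<kappa>" by (simp_all add: \<kappa>_def)
    \<comment> \<open>The length at the first return to SO(2), which under the assumption to be
      refuted lies strictly inside the arc.\<close>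
    define \<tau> where "\<tau> = 2 * pi / \<kappa>"
    have \<tau>: "0 < \<tau>" "\<tau> < d" "\<kappa> * \<tau> = 2 * pi"
      using \<kappa> big by (simp_all add: \<tau>_def field_simps)
    define t where "t = \<tau> / d"
    have t: "t \<in> {0..1}" "t * d = \<tau>"
      using \<tau> \<open>0 < d\<close> by (simp_all add: t_def)
    define p where "p s = geodesic \<beta> \<phi> (s * d)" for s
    define l where "l s = integral {0..s} (\<lambda>s. sqrt ((d * cos (\<phi> - s * d * \<beta>))\<^sup>2 + (d * sin (\<phi> - s * d * \<beta>))\<^sup>2))" for s
    have l: "l s = s * d" if "0 \<le> s" for s
      unfolding l_def geodesic_segment_speed[OF \<open>0 \<le> d\<close>] using that by simp
    obtain \<psi> where curve: "reduced_curve (\<lambda>s. p s $ 1 $ 1) \<psi> l" and "\<psi> 0 = 0"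
      and tw: "\<forall>s\<in>{0..1}. twist (p s) = of_real (1 + p s $ 1 $ 1) * cis (\<psi> s)"
    proof (rule horizontal_reduced_curve)
      show "valid_path p" unfolding p_def by (rule valid_path_geodesic)
      show "path_image p \<subseteq> SO21" using geodesic_SO21 by (auto simp: path_image_def p_def)
      show "pathstart p = mat 1" by (simp add: pathstart_def p_def geodesic_0)
      show "finite {}" by simp
      show "(p has_vector_derivative p s ** ((d * cos (\<phi> - s * d * \<beta>)) *\<^sub>R gen_a
          + (d * sin (\<phi> - s * d * \<beta>)) *\<^sub>R gen_b)) (at s)" for s
        unfolding p_def by (rule geodesic_segment_deriv)
      show "(\<lambda>s. sqrt ((d * cos (\<phi> - s * d * \<beta>))\<^sup>2 + (d * sin (\<phi> - s * d * \<beta>))\<^sup>2)) integrable_on {0..1}"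
        unfolding geodesic_segment_speed[OF \<open>0 \<le> d\<close>] by (rule integrable_const_ivl)
    qed (use that in \<open>simp add: l_def[abs_def]\<close>)
    obtain \<sigma> :: real where \<sigma>: "\<bar>\<sigma>\<bar> = 1" "\<sigma> * \<psi> 1 = \<bar>\<psi> 1\<bar>"
      and curve': "reduced_curve (\<lambda>s. p s $ 1 $ 1) (\<lambda>s. \<sigma> * \<psi> s) l"
      using signed_reduced_curve[OF curve] .
    have p: "p 0 $ 1 $ 1 = 1" "p 1 = C"
      using \<beta> by (simp_all add: p_def geodesic_0 mat_def)
    have "gsin (1 - \<beta>\<^sup>2) (\<tau> / 2) = 0"
    proof -
      have "1 - \<beta>\<^sup>2 = - (\<kappa>\<^sup>2)" using \<kappa>(1) B(2) by simp
      then show ?thesis using \<kappa>(2) \<tau>(3) by simp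
    qed
    then have pt: "p t $ 1 $ 1 = 1"
      by (simp add: p_def t geodesic_z gvers_half)
    have eta: "abs_eta C \<le> \<sigma> * \<psi> 1"
      using abs_eta_le_twist_angle[OF C] bspec[OF tw, of 1] p \<sigma>(2) by simp
    have "arccos (cos (\<kappa> * \<tau> / 2)) = pi"
      by (simp add: \<tau>(3))
    \<comment> \<open>The phase for the arc's own parameter \<open>B\<close> bounds from above the
      angle gained at the return.\<close>
    moreover have "B * l 0 - \<sigma> * \<psi> 0 - 2 * arccos (cos (\<kappa> * l 0 / 2) / sqrt ((1 + p 0 $ 1 $ 1) / 2))
        \<le> B * l t - \<sigma> * \<psi> t - 2 * arccos (cos (\<kappa> * l t / 2) / sqrt ((1 + p t $ 1 $ 1) / 2))"
      using t by (intro fast_phase_nondecreasing[OF curve' _ _ _ \<kappa>(1) B(1)]) auto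
    ultimately have "\<sigma> * \<psi> t \<le> B * \<tau> - 2 * pi"
      using l[of 0] l[of t] t p(1) pt \<open>\<psi> 0 = 0\<close> by simp
    then have le: "\<sigma> * \<psi> t \<le> (B - \<kappa>) * \<tau>"
      using \<tau>(3) by (simp add: algebra_simps)
    show False
    proof (cases "b \<le> 1")
      case True
      \<comment> \<open>Minimality makes the slow calibration exact at the return, where
        \<open>slow_potential\<close> vanishes. But \<open>b \<le> 1\<close>, and the angle gained
        there is less than \<tau> because \<open>B - \<kappa> < 1\<close>.\<close>
      have "\<tau> = b * (\<sigma> * \<psi> t)"
        using extremal_slow_bound(2)[OF C e True curve' _ _ _ _ eta _ t(1)] l[of 0] l[of 1] l[of t] t p pt
          \<open>\<psi> 0 = 0\<close> by (simp add: slow_potential_1)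
      also have "\<dots> \<le> b * ((B - \<kappa>) * \<tau>)"
        using le b by (rule mult_left_mono)
      also have "\<dots> \<le> 1 * ((B - \<kappa>) * \<tau>)"
      proof (rule mult_right_mono[OF True])
        have "\<kappa> \<le> B" using \<kappa> B(1) by (auto intro: power2_le_imp_le)
        then show "0 \<le> (B - \<kappa>) * \<tau>" using \<tau>(1) by simp
      qed
      also have "\<dots> < 1 * \<tau>"
      proof -
        have "(B - 1)\<^sup>2 < \<kappa>\<^sup>2"
          using \<open>1 < B\<close> \<kappa>(1) by (simp add: power2_eq_square algebra_simps)
        then have "B - 1 < \<kappa>"
          using \<kappa>(2) by (auto intro: power_less_imp_less_base)
        then show ?thesis
          unfolding mult_1 using mult_strict_right_mono[of "B - \<kappa>" 1 \<tau>] \<tau>(1) by simp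
      qed
      finally show False by simp
    next
      case False
      then have "1 < b" by simp
      define k where "k = sqrt (b\<^sup>2 - 1)"
      have kd: "k * d \<le> 2 * pi"
        using e \<open>1 < b\<close> by (simp add: extremal_def k_def)
      have "1 < b\<^sup>2" using \<open>1 < b\<close> by (simp add: power2_eq_square less_1_mult)
      then have k: "0 < k" "b\<^sup>2 = k\<^sup>2 + 1" by (simp_all add: k_def)
      have "k * d < \<kappa> * d" using kd big by linarith
      then have "k < \<kappa>" using \<open>0 < d\<close> by simp
      then have "k\<^sup>2 < \<kappa>\<^sup>2" using k(1) by (intro power_strict_mono) auto
      then have "b\<^sup>2 < B\<^sup>2" using k(2) \<kappa>(1) by simp
      then have "b < B" using B(1) by (rule power_less_imp_less_base)
      have "k * \<tau> \<le> k * d" using k(1) \<tau>(2) by simp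
      then have "k * \<tau> / 2 \<le> pi" using kd by linarith
      then have "arccos (cos (k * \<tau> / 2)) = k * \<tau> / 2"
        using k(1) \<tau>(1) by (intro arccos_cos) auto
      \<comment> \<open>Minimality makes the phase for \<open>b\<close> vanish at the return, so the
        angle gained is \<open>(b - k) * \<tau>\<close>; as \<open>b < B\<close>, this exceeds the
        bound \<open>(B - \<kappa>) * \<tau>\<close>.\<close>
      then have "b * \<tau> - \<sigma> * \<psi> t = k * \<tau>"
        using extremal_fast_bound(2)[OF C e \<open>1 < b\<close> curve' _ _ _ _ eta _ _ t(1)] l[of 0] l[of 1] l[of t] t p pt
          \<open>\<psi> 0 = 0\<close> \<open>0 \<le> d\<close> by (simp add: k_def[symmetric])
      then have "(b - k) * \<tau> \<le> (B - \<kappa>) * \<tau>"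
        using le by (simp add: algebra_simps)
      then have "b - k \<le> B - \<kappa>"
        using \<tau>(1) by (rule mult_right_le_imp_le)
      then show False
        using speed_gap_antimono[OF \<open>1 < b\<close> \<open>b < B\<close>] by (simp add: k_def \<kappa>_def)
    qed
  qed
  have pi': "sqrt (- (1 - x\<^sup>2)) * (d / 2) \<le> pi" if "1 < x \<Longrightarrow> sqrt (x\<^sup>2 - 1) * d \<le> 2 * pi" "0 \<le> x" "1 - x\<^sup>2 < 0" for x
  proof -
    have "1 < x" using that(2,3) by (smt (verit) power_le_one)
    with that(1) show ?thesis by simp
  qed
  \<comment> \<open>\<open>C$1$1\<close> determines only the square of \<open>gsin\<close>; up to
    the first return its sign is known as well.\<close>
  have "gsin (1 - B\<^sup>2) (d / 2) \<ge> 0"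
  proof (cases "1 - B\<^sup>2 < 0")
    case True
    then show ?thesis
      using pi'[OF small B(1)] \<open>0 \<le> d\<close> by (auto simp: gsin_def intro!: divide_nonneg_nonneg sin_ge_zero)
  next
    case False
    then show ?thesis
      using \<open>0 \<le> d\<close> by (simp add: gsin_def)
  qed
  moreover have "C$1$1 = 1 + 2 * (gsin (1 - B\<^sup>2) (d / 2))\<^sup>2"
    using \<beta> by (simp add: geodesic_z gvers_half B(2))
  ultimately have "gsin (1 - B\<^sup>2) (d / 2) = sqrt ((C$1$1 - 1) / 2)"
    by simp
  also have "\<dots> = gsin (1 - b\<^sup>2) (d / 2)"
    using e by (simp add: extremal_def)
  finally have eq: "gsin (1 - B\<^sup>2) (d / 2) = gsin (1 - b\<^sup>2) (d / 2)" .
  have "sqrt (b\<^sup>2 - 1) * d \<le> 2 * pi" if "1 < b"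
    using e that by (simp add: extremal_def)
  then have "1 - B\<^sup>2 = 1 - b\<^sup>2"
    using gsin_strict_mono[of "d / 2" "1 - B\<^sup>2" "1 - b\<^sup>2", OF _ _ pi'[OF small B(1)]]
      gsin_strict_mono[of "d / 2" "1 - b\<^sup>2" "1 - B\<^sup>2", OF _ _ pi'[OF _ b]] eq \<open>0 < d\<close>
    by (cases "1 - B\<^sup>2" "1 - b\<^sup>2" rule: linorder_cases) auto
  then have "B = b"
    using B(1) b by (simp add: power2_eq_iff_nonneg)
  then show ?thesis by (simp add: B_def)
qed

subsection \<open>The cases of the theorem\<close>

text \<open>\<open>s\<close> and \<open>c\<close> are sinh and cosh of \<open>\<rho>/2\<close>, and
  the upper bound for \<open>b\<close> is their coth. The formula for it includes
  \<open>s = 0\<close>, where both sides are 0 through division by zero.\<close>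

lemma half_angle:
  assumes "C \<in> SO21"
  defines "s \<equiv> sqrt ((C$1$1 - 1) / 2)" and "c \<equiv> sqrt ((1 + C$1$1) / 2)"
  shows "0 \<le> s" "1 \<le> c" "c\<^sup>2 = 1 + s\<^sup>2" "C$1$1 = 1 + 2 * s\<^sup>2" "c = sqrt (1 + s\<^sup>2)"
    "abs_mu C b = sqrt (c\<^sup>2 - b\<^sup>2 * s\<^sup>2) / c" "sqrt ((1 + C$1$1) / (C$1$1 - 1)) = c / s"
    "theta C = pi * (c - 1)" "alpha C = 2 * s - 2 * arccos (1 / c)"
proof -
  have z: "1 \<le> C$1$1" by (rule SO21_z_ge1[OF assms(1)])
  then show s: "0 \<le> s" and c: "1 \<le> c"
    by (simp_all add: s_def c_def)
  have s2: "2 * s\<^sup>2 = C$1$1 - 1" and c2: "2 * c\<^sup>2 = 1 + C$1$1"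
    using z by (simp_all add: s_def c_def)
  show cs: "c\<^sup>2 = 1 + s\<^sup>2" using s2 c2 by simp
  show "C$1$1 = 1 + 2 * s\<^sup>2" using s2 by simp
  show "c = sqrt (1 + s\<^sup>2)" using cs c by (simp add: real_sqrt_unique)
  have "1 - b\<^sup>2 * ((C$1$1 - 1) / (1 + C$1$1)) = (c\<^sup>2 - b\<^sup>2 * s\<^sup>2) / c\<^sup>2"
    unfolding s2[symmetric] c2[symmetric] using c by (simp add: field_simps)
  then show "abs_mu C b = sqrt (c\<^sup>2 - b\<^sup>2 * s\<^sup>2) / c"
    using c by (simp add: abs_mu_def real_sqrt_divide)
  have "(1 + C$1$1) / (C$1$1 - 1) = c\<^sup>2 / s\<^sup>2"
    unfolding s2[symmetric] c2[symmetric] by simp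
  then show "sqrt ((1 + C$1$1) / (C$1$1 - 1)) = c / s"
    using c s by (simp add: real_sqrt_divide)
  show "theta C = pi * (c - 1)"
    by (simp add: theta_def c_def)
  have "sqrt (2 * (C$1$1 - 1)) = 2 * s"
    unfolding s2[symmetric] using s by (simp add: real_sqrt_mult)
  moreover have "sqrt (2 / (1 + C$1$1)) = 1 / c"
    unfolding c2[symmetric] using c by (simp add: real_sqrt_divide)
  ultimately show "alpha C = 2 * s - 2 * arccos (1 / c)"
    by (simp add: alpha_def)
qed

lemma half_angle_pos:
  assumes "C \<in> SO21" "C$1$1 \<noteq> 1"
  shows "0 < sqrt ((C$1$1 - 1) / 2)"
  using SO21_z_ge1[OF assms(1)] assms(2) by simp

lemma extremal_fastI:
  assumes "0 < \<kappa>" "b\<^sup>2 = \<kappa>\<^sup>2 + 1" "0 \<le> b" "0 \<le> d" "\<kappa> * d \<le> 2 * pi"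
    and "sin (\<kappa> * d / 2) = \<kappa> * sqrt ((C$1$1 - 1) / 2)"
    and "b * d = abs_eta C + 2 * arccos (cos (\<kappa> * d / 2) / sqrt ((1 + C$1$1) / 2))"
  shows "extremal C b d"
proof -
  have "1 - b\<^sup>2 = - (\<kappa>\<^sup>2)" "sqrt (b\<^sup>2 - 1) = \<kappa>"
    using assms(1,2) by simp_all
  then show ?thesis
    using assms by (simp add: extremal_def)
qed

lemma sqrt_fast:
  assumes "1 < (b :: real)"
  obtains \<kappa> where "\<kappa> = sqrt (b\<^sup>2 - 1)" "0 < \<kappa>" "b\<^sup>2 = \<kappa>\<^sup>2 + 1"
proof -
  have "1 < b\<^sup>2" using assms by (simp add: power2_eq_square less_1_mult)
  then show ?thesis using that[OF refl] by simp
qed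

text \<open>\<gamma> stands for \<open>\<kappa> d\<close> or for
  \<open>2 \<pi> - \<kappa> d\<close>. As \<open>\<gamma> / 2\<close> lies between 0 and
  \<open>\<pi> / 2\<close>, the half angle formulas fix sine and cosine without ambiguity of sign;
  which half of the period the arc ends in shows in the sign before \<open>abs_mu\<close>.\<close>

lemma gamma_half:
  assumes C: "C \<in> SO21" and "b\<^sup>2 = \<kappa>\<^sup>2 + 1" "0 < \<kappa>" "0 \<le> \<gamma>" "\<gamma> \<le> pi" and cos: "cos \<gamma> = b\<^sup>2 - C$1$1 * (b\<^sup>2 - 1)"
  shows "sin (\<gamma> / 2) = \<kappa> * sqrt ((C$1$1 - 1) / 2)"
    and "cos (\<gamma> / 2) / sqrt ((1 + C$1$1) / 2) = abs_mu C b"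
proof -
  define s c where "s = sqrt ((C$1$1 - 1) / 2)" and "c = sqrt ((1 + C$1$1) / 2)"
  note H = half_angle[OF C, folded s_def c_def]
  have cg: "cos \<gamma> = 1 - 2 * (\<kappa> * s)\<^sup>2"
    unfolding cos assms(2) H(4) by (simp add: power_mult_distrib algebra_simps)
  have "cos \<gamma> = 1 - 2 * (sin (\<gamma> / 2))\<^sup>2"
    using cos_double_sin[of "\<gamma> / 2"] by simp
  with cg have "(sin (\<gamma> / 2))\<^sup>2 = (\<kappa> * s)\<^sup>2" by simp
  moreover have "0 \<le> sin (\<gamma> / 2)"
    using assms(4,5) by (intro sin_ge_zero) auto
  ultimately show "sin (\<gamma> / 2) = \<kappa> * sqrt ((C$1$1 - 1) / 2)"
    unfolding s_def[symmetric] by (rule power2_eq_imp_eq) (use H(1) \<open>0 < \<kappa>\<close> in simp)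
  then have "(cos (\<gamma> / 2))\<^sup>2 = c\<^sup>2 - b\<^sup>2 * s\<^sup>2"
    unfolding s_def[symmetric] cos_squared_eq H(3) assms(2) by (simp add: power_mult_distrib algebra_simps)
  moreover have "0 \<le> cos (\<gamma> / 2)"
    using assms(4,5) by (intro cos_ge_zero) auto
  ultimately have "cos (\<gamma> / 2) = sqrt (c\<^sup>2 - b\<^sup>2 * s\<^sup>2)"
    by (metis real_sqrt_abs abs_of_nonneg)
  then show "cos (\<gamma> / 2) / sqrt ((1 + C$1$1) / 2) = abs_mu C b"
    unfolding H(6) c_def[symmetric] by simp
qed

section \<open>Every solution of the relations is extremal\<close>

lemma rel_III_extremal:
  assumes C: "C \<in> SO21" and r: "rel_III C b \<gamma> d"
  shows "extremal C b d"
proof -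
  have "1 < 2 / sqrt 3"
    using real_sqrt_less_mono[of 3 4] by simp
  also have "\<dots> < b" using r by (simp add: rel_III_def)
  finally have "1 < b" .
  then obtain \<kappa> where \<kappa>: "\<kappa> = sqrt (b\<^sup>2 - 1)" "0 < \<kappa>" "b\<^sup>2 = \<kappa>\<^sup>2 + 1"
    by (rule sqrt_fast)
  have R: "d = (2 * pi - \<gamma>) / \<kappa>" "abs_eta C = (2 * pi - \<gamma>) * (b / \<kappa>) - 2 * arccos (- abs_mu C b)"
    "0 \<le> \<gamma>" "\<gamma> < pi" "cos \<gamma> = b\<^sup>2 - C$1$1 * (b\<^sup>2 - 1)"
    using r unfolding rel_III_def \<kappa>(1)[symmetric] by blast+
  note g = gamma_half[OF C \<kappa>(3,2) R(3) less_imp_le[OF R(4)] R(5)]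
  \<comment> \<open>The arc covers more than half of the period, hence the cosine
    \<open>- cos (\<gamma> / 2)\<close> and the argument \<open>- abs_mu\<close>.\<close>
  have kd: "\<kappa> * d = 2 * pi - \<gamma>" "\<kappa> * d / 2 = pi - \<gamma> / 2" using \<kappa>(2) R(1) by simp_all
  show ?thesis
  proof (rule extremal_fastI[OF \<kappa>(2,3)])
    show "0 \<le> d" using R \<kappa>(2) pi_gt_zero by simp
    show "sin (\<kappa> * d / 2) = \<kappa> * sqrt ((C$1$1 - 1) / 2)"
      unfolding kd(2) using g(1) by simp
    have "cos (\<kappa> * d / 2) / sqrt ((1 + C$1$1) / 2) = - abs_mu C b"
      unfolding kd(2) g(2)[symmetric] by simp
    moreover have "b * d = (2 * pi - \<gamma>) * (b / \<kappa>)"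
      by (simp add: R(1))
    ultimately show "b * d = abs_eta C + 2 * arccos (cos (\<kappa> * d / 2) / sqrt ((1 + C$1$1) / 2))"
      using R(2) by simp
  qed (use \<open>1 < b\<close> R kd in auto)
qed

lemma rel_IVc_extremal:
  assumes C: "C \<in> SO21" and r: "rel_IVc C b \<gamma> d"
  shows "extremal C b d"
proof -
  have "1 < b" using r by (simp add: rel_IVc_def)
  then obtain \<kappa> where \<kappa>: "\<kappa> = sqrt (b\<^sup>2 - 1)" "0 < \<kappa>" "b\<^sup>2 = \<kappa>\<^sup>2 + 1"
    by (rule sqrt_fast)
  have R: "d = \<gamma> / \<kappa>" "abs_eta C = \<gamma> * (b / \<kappa>) - 2 * arccos (abs_mu C b)"
    "0 < \<gamma>" "\<gamma> < pi" "cos \<gamma> = b\<^sup>2 - C$1$1 * (b\<^sup>2 - 1)"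
    using r unfolding rel_IVc_def \<kappa>(1)[symmetric] by blast+
  note g = gamma_half[OF C \<kappa>(3,2) less_imp_le[OF R(3)] less_imp_le[OF R(4)] R(5)]
  have kd: "\<kappa> * d = \<gamma>" using \<kappa>(2) R(1) by simp
  show ?thesis
  proof (rule extremal_fastI[OF \<kappa>(2,3)])
    show "0 \<le> d" using R \<kappa>(2) by simp
    show "sin (\<kappa> * d / 2) = \<kappa> * sqrt ((C$1$1 - 1) / 2)"
      unfolding kd by (rule g(1))
    have "b * d = \<gamma> * (b / \<kappa>)"
      by (simp add: R(1))
    then show "b * d = abs_eta C + 2 * arccos (cos (\<kappa> * d / 2) / sqrt ((1 + C$1$1) / 2))"
      unfolding kd g(2) using R(2) by simp
  qed (use \<open>1 < b\<close> R kd in auto)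
qed

text \<open>The arc stops exactly at its first return, \<open>\<kappa> * d = 2 * pi\<close>; the
  arccos in \<open>extremal\<close> is then \<pi>, which accounts for the term \<open>2 * pi\<close>
  in \<open>eq_I\<close>.\<close>

lemma rel_I_extremal:
  assumes "C$1$1 = 1" and r: "rel_I C b d"
  shows "extremal C b d"
proof -
  have "1 < 3 / sqrt 5"
    using real_sqrt_less_mono[of 5 9] by simp
  also have "\<dots> \<le> b" using r by (simp add: rel_I_def)
  finally have "1 < b" .
  then obtain \<kappa> where \<kappa>: "\<kappa> = sqrt (b\<^sup>2 - 1)" "0 < \<kappa>" "b\<^sup>2 = \<kappa>\<^sup>2 + 1"
    by (rule sqrt_fast)
  have R: "d = 2 * pi / \<kappa>" "2 * b * pi / \<kappa> = abs_eta C + 2 * pi"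
    using r unfolding rel_I_def eq_I_def abs_eta_def \<kappa>(1)[symmetric] by blast+
  have kd: "\<kappa> * d = 2 * pi" using \<kappa>(2) R(1) by simp
  show ?thesis
    using \<open>1 < b\<close> \<kappa>(2) R assms(1) kd by (intro extremal_fastI[OF \<kappa>(2,3)]) (auto simp: mult_ac)
qed

lemma rel_II_extremal:
  assumes C: "C \<in> SO21" and "C$1$1 \<noteq> 1" "abs_eta C = theta C" and r: "rel_II C b d"
  shows "extremal C b d"
proof -
  define s c where "s = sqrt ((C$1$1 - 1) / 2)" and "c = sqrt ((1 + C$1$1) / 2)"
  note H = half_angle[OF C, folded s_def c_def]
  have s: "0 < s" unfolding s_def by (rule half_angle_pos[OF C assms(2)])
  have R: "b = c / s" "d = pi * s"
    using r unfolding rel_II_def H(7) s_def[symmetric] by blast+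
  show ?thesis
  \<comment> \<open>\<open>1 / s\<close> is \<open>sqrt (b\<^sup>2 - 1)\<close>, so
    \<open>\<kappa> d = \<pi>\<close>: the arc covers half of the period and the cosine
    vanishes.\<close>
  proof (rule extremal_fastI[of "1 / s"])
    show "b\<^sup>2 = (1 / s)\<^sup>2 + 1"
      using s by (simp add: R power_divide H(3) field_simps)
    show "b * d = abs_eta C + 2 * arccos (cos (1 / s * d / 2) / sqrt ((1 + C$1$1) / 2))"
      using s by (simp add: R assms(3) H(8) algebra_simps)
  qed (use s H(2) in \<open>simp_all add: R s_def[symmetric]\<close>)
qed

lemma rel_IVa_extremal:
  assumes C: "C \<in> SO21" and "abs_eta C = alpha C" and r: "rel_IVa C b d"
  shows "extremal C b d"
proof -
  define s c where "s = sqrt ((C$1$1 - 1) / 2)" and "c = sqrt ((1 + C$1$1) / 2)"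
  note H = half_angle[OF C, folded s_def c_def]
  have "sqrt (2 * (C$1$1 - 1)) = 2 * s"
    unfolding H(4) using H(1) by (simp add: real_sqrt_mult)
  then have R: "b = 1" "d = 2 * s"
    using r by (simp_all add: rel_IVa_def)
  show ?thesis
    unfolding extremal_def s_def[symmetric] c_def[symmetric]
    using H(1) by (simp add: R assms(2) H(9))
qed

lemma arsinh_nonneg: "0 \<le> (x :: real) \<Longrightarrow> 0 \<le> arsinh x"
  by (metis sinh_arsinh_real sinh_real_nonneg_iff)

lemma arcosh_sqrt:
  assumes "0 \<le> (x :: real)"
  shows "arcosh (sqrt (1 + x\<^sup>2)) = arsinh x"
proof -
  have "cosh (arsinh x) = sqrt (1 + x\<^sup>2)"
    by (simp add: cosh_arsinh_real add.commute)
  moreover have "0 \<le> arsinh x" using assms by (rule arsinh_nonneg)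
  ultimately show ?thesis by (metis arcosh_cosh_real)
qed

lemma abs_mu_slow:
  assumes C: "C \<in> SO21" and "b\<^sup>2 = 1 - \<kappa>\<^sup>2" "0 \<le> \<kappa>"
  defines "s \<equiv> sqrt ((C$1$1 - 1) / 2)" and "c \<equiv> sqrt ((1 + C$1$1) / 2)"
  shows "abs_mu C b = sqrt (1 + (\<kappa> * s)\<^sup>2) / c" "arcosh (c * abs_mu C b) = arsinh (\<kappa> * s)"
proof -
  note H = half_angle[OF C, folded s_def c_def]
  show "abs_mu C b = sqrt (1 + (\<kappa> * s)\<^sup>2) / c"
    unfolding H(6) H(3) assms(2) by (simp add: power_mult_distrib algebra_simps)
  then have "c * abs_mu C b = sqrt (1 + (\<kappa> * s)\<^sup>2)"
    using H(2) by simp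
  then show "arcosh (c * abs_mu C b) = arsinh (\<kappa> * s)"
    using H(1) assms(3) by (simp add: arcosh_sqrt)
qed

lemma rel_IVb_extremal:
  assumes C: "C \<in> SO21" and r: "rel_IVb C b d"
  shows "extremal C b d"
proof -
  define s c where "s = sqrt ((C$1$1 - 1) / 2)" and "c = sqrt ((1 + C$1$1) / 2)"
  note H = half_angle[OF C, folded s_def c_def]
  have b: "0 < b" "b < 1" using r by (simp_all add: rel_IVb_def)
  define \<kappa> where "\<kappa> = sqrt (1 - b\<^sup>2)"
  have "b\<^sup>2 < 1" using b by (simp add: power_less_one_iff)
  then have \<kappa>: "0 < \<kappa>" "b\<^sup>2 = 1 - \<kappa>\<^sup>2" "1 - b\<^sup>2 = \<kappa>\<^sup>2" by (simp_all add: \<kappa>_def)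
  note mu = abs_mu_slow[OF C \<kappa>(2) less_imp_le[OF \<kappa>(1)], folded s_def c_def]
  have R: "d = 2 / \<kappa> * arsinh (\<kappa> * s)"
      "abs_eta C = 2 * (b / \<kappa> * arsinh (\<kappa> * s) - arccos (abs_mu C b))"
    using r unfolding rel_IVb_def \<kappa>_def[symmetric] c_def[symmetric] mu(2) by blast+
  have kd: "\<kappa> * d / 2 = arsinh (\<kappa> * s)" using R(1) \<kappa>(1) by simp
  have "gcos (1 - b\<^sup>2) (d / 2) = sqrt (1 + (\<kappa> * s)\<^sup>2)"
    unfolding \<kappa>(3) using \<kappa>(1) kd by (simp add: cosh_arsinh_real add.commute)
  moreover have "gsin (1 - b\<^sup>2) (d / 2) = s"
    unfolding \<kappa>(3) using \<kappa>(1) kd by simp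
  moreover have "0 \<le> d" using R(1) \<kappa>(1) H(1) by (simp add: arsinh_nonneg)
  ultimately show ?thesis
    unfolding extremal_def s_def[symmetric] c_def[symmetric]
    using b R mu(1) by (simp add: algebra_simps)
qed

text \<open>With \<open>b = 0\<close> the functions \<open>gsin\<close> and \<open>gcos\<close> are
  sinh and cosh, and the angle term is \<open>2 arccos 1 = 0\<close>.\<close>

lemma Sim_extremal:
  assumes C: "C \<in> SO21" and "abs_eta C = 0"
  shows "extremal C 0 (arcosh (C$1$1))"
proof -
  define s c where "s = sqrt ((C$1$1 - 1) / 2)" and "c = sqrt ((1 + C$1$1) / 2)"
  note H = half_angle[OF C, folded s_def c_def]
  have z: "1 \<le> C$1$1" by (rule SO21_z_ge1[OF C])
  define d where "d = arcosh (C$1$1)"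
  have d: "0 \<le> d" "cosh d = C$1$1"
    using z by (simp_all add: d_def)
  have "cosh d = 2 * (sinh (d / 2))\<^sup>2 + 1" "cosh d = 2 * (cosh (d / 2))\<^sup>2 - 1"
    using cosh_double[of "d / 2"] cosh_square_eq[of "d / 2"] by simp_all
  then have sq: "(sinh (d / 2))\<^sup>2 = (C$1$1 - 1) / 2" "(cosh (d / 2))\<^sup>2 = (1 + C$1$1) / 2"
    unfolding d(2) by simp_all
  have "sinh (d / 2) = s" "cosh (d / 2) = c"
    unfolding s_def c_def sq[symmetric] using d(1) by simp_all
  moreover have "gsin 1 x = sinh x" "gcos 1 x = cosh x" for x
    using gsin_simps(2)[of 1 x] gcos_simps(2)[of 1 x] by simp_all
  ultimately show ?thesis
    unfolding extremal_def s_def[symmetric] c_def[symmetric] d_def[symmetric]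
    using d(1) assms(2) H(2) by simp
qed

text \<open>\<open>R\<close> stands for the relation of one case, with \<gamma> quantified away.
  Extremality makes the second entry of every solution the distance, and uniqueness of the extremal
  parameter transfers the solution that exists to every \<beta> of a shortest arc.\<close>

lemma case_conclusion:
  assumes C: "C \<in> SO21" and "abs_eta C > 0"
    and unique: "\<And>b d \<beta> \<phi>. extremal C b d \<Longrightarrow> C = geodesic \<beta> \<phi> d \<Longrightarrow> \<bar>\<beta>\<bar> = b"
    and R: "\<And>b x. R b x \<Longrightarrow> extremal C b x" and ex: "\<exists>b x. R b x"
  shows "(\<forall>x. (\<exists>b. R b x) \<longleftrightarrow> x = sr_dist (mat 1) C)
    \<and> (\<forall>\<beta>. shortest_arc_param C \<beta> \<longrightarrow> R \<bar>\<beta>\<bar> (sr_dist (mat 1) C))"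
proof -
  have d: "x = sr_dist (mat 1) C" if "R b x" for b x
    using extremal_dist[OF C R[OF that]] by simp
  obtain b where b: "R b (sr_dist (mat 1) C)"
    using ex d by metis
  have "\<bar>\<beta>\<bar> = b" if "shortest_arc_param C \<beta>" for \<beta>
    using that unique[OF R[OF b]] unfolding shortest_arc_param_def by blast
  with b d show ?thesis by blast
qed

text \<open>For \<open>b = cosh y\<close>, \<open>y > 0\<close>, this is \<open>coth y\<close>: an
  order-reversing involution of the numbers above 1. The angle equations bound
  \<open>ratio b\<close>, and the values 2 and 3/2 become the thresholds \<open>2 / sqrt 3\<close>
  and \<open>3 / sqrt 5\<close> for \<open>b\<close>.\<close>

definition ratio :: "real \<Rightarrow> real" where
  "ratio b = b / sqrt (b\<^sup>2 - 1)"

lemma ratio_less_iff: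
  assumes "1 < b" "1 < q"
  shows "ratio b < q \<longleftrightarrow> ratio q < b" "q < ratio b \<longleftrightarrow> b < ratio q"
proof -
  obtain \<kappa> where \<kappa>: "\<kappa> = sqrt (b\<^sup>2 - 1)" "0 < \<kappa>" "b\<^sup>2 = \<kappa>\<^sup>2 + 1"
    using sqrt_fast[OF assms(1)] .
  obtain k where k: "k = sqrt (q\<^sup>2 - 1)" "0 < k" "q\<^sup>2 = k\<^sup>2 + 1"
    using sqrt_fast[OF assms(2)] .
  have sq: "x < y \<longleftrightarrow> x\<^sup>2 < y\<^sup>2" if "0 \<le> x" "0 \<le> y" for x y :: real
    using that by (meson pos2 power_less_imp_less_base power_strict_mono)
  have "ratio b < q \<longleftrightarrow> b < q * \<kappa>" "ratio q < b \<longleftrightarrow> q < b * k"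
    "q < ratio b \<longleftrightarrow> q * \<kappa> < b" "b < ratio q \<longleftrightarrow> b * k < q"
    unfolding ratio_def \<kappa>(1)[symmetric] k(1)[symmetric] using \<kappa>(2) k(2) by (simp_all add: field_simps)
  moreover have "b < q * \<kappa> \<longleftrightarrow> q < b * k" "q * \<kappa> < b \<longleftrightarrow> b * k < q"
    using sq[of b "q * \<kappa>"] sq[of q "b * k"] sq[of "q * \<kappa>" b] sq[of "b * k" q] assms \<kappa>(2) k(2)
    by (simp_all add: power_mult_distrib \<kappa>(3) k(3) algebra_simps)
  ultimately show "ratio b < q \<longleftrightarrow> ratio q < b" "q < ratio b \<longleftrightarrow> b < ratio q"
    by simp_all
qed

lemma ratio_gt_1:
  assumes "1 < b"
  shows "1 < ratio b"
proof -
  obtain \<kappa> where \<kappa>: "\<kappa> = sqrt (b\<^sup>2 - 1)" "0 < \<kappa>" "b\<^sup>2 = \<kappa>\<^sup>2 + 1"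
    using sqrt_fast[OF assms] .
  then have "\<kappa> < b"
    using assms by (auto intro: power_less_imp_less_base[of _ 2])
  then show ?thesis
    using \<kappa>(2) by (simp add: ratio_def \<kappa>(1)[symmetric])
qed

lemma ratio_ratio:
  assumes "1 < b"
  shows "ratio (ratio b) = b"
  using ratio_less_iff[OF assms, of "ratio (ratio b)"] ratio_less_iff[OF ratio_gt_1[OF assms], of b]
    ratio_less_iff[OF ratio_gt_1[OF assms], of "ratio (ratio b)"] ratio_gt_1 assms
  by (metis less_irrefl linorder_neqE_linordered_idom)

lemma ratio_values: "ratio 2 = 2 / sqrt 3" "ratio (3 / 2) = 3 / sqrt 5"
  by (simp_all add: ratio_def real_sqrt_divide power_divide)

section \<open>Estimates for the angle equations\<close>

lemma tan_mult_ge: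
  fixes m g :: real
  assumes "1 \<le> m" "0 \<le> g" "m * g < pi / 2"
  shows "m * tan g \<le> tan (m * g)"
proof -
  have "tan (m * 0) - m * tan 0 \<le> tan (m * g) - m * tan g"
  proof (rule DERIV_nonneg_imp_nondecreasing[OF assms(2)])
    fix x assume "0 \<le> x" "x \<le> g"
    then have x: "0 \<le> x" "x \<le> m * x" "m * x \<le> m * g"
      using assms(1) mult_right_mono[of 1 m x] by (auto intro: mult_left_mono)
    then have c: "0 < cos (m * x)" "cos (m * x) \<le> cos x"
      using assms(3) by (auto intro!: cos_gt_zero_pi cos_monotone_0_pi_le)
    have "((\<lambda>x. tan (m * x) - m * tan x) has_real_derivative
        inverse ((cos (m * x))\<^sup>2) * m - m * inverse ((cos x)\<^sup>2)) (at x)"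
      using c by (intro DERIV_diff DERIV_cmult DERIV_tan DERIV_chain2[OF DERIV_tan])
        (auto intro!: derivative_eq_intros)
    moreover have "inverse ((cos x)\<^sup>2) \<le> inverse ((cos (m * x))\<^sup>2)"
      using c by (intro le_imp_inverse_le power_mono) auto
    then have "m * inverse ((cos x)\<^sup>2) \<le> m * inverse ((cos (m * x))\<^sup>2)"
      using assms(1) by (intro mult_left_mono) auto
    ultimately show "\<exists>y. ((\<lambda>x. tan (m * x) - m * tan x) has_real_derivative y) (at x) \<and> 0 \<le> y"
      by (intro exI[of _ "inverse ((cos (m * x))\<^sup>2) * m - m * inverse ((cos x)\<^sup>2)"]) (auto simp: mult.commute)
  qed
  then show ?thesis by simp
qed

text \<open>The angle \<open>arccos (cos g / c)\<close> has sine \<open>m sin g / c\<close>, hence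
  tangent \<open>m tan g\<close>, which \<open>tan_mult_ge\<close> bounds by
  \<open>tan (m g)\<close>. Once \<open>m g \<ge> \<pi> / 2\<close> the bound is immediate.\<close>

lemma arccos_le_mult:
  fixes m g c :: real
  assumes "1 \<le> m" "0 \<le> g" "g \<le> pi / 2" "1 \<le> c" "c\<^sup>2 = (cos g)\<^sup>2 + (m * sin g)\<^sup>2"
  shows "arccos (cos g / c) \<le> m * g"
proof -
  have cg: "0 \<le> cos g" using assms by (intro cos_ge_zero) auto
  have r: "0 \<le> cos g / c" "cos g / c \<le> 1"
  proof -
    have "cos g \<le> c" using cos_le_one[of g] assms(4) by linarith
    then show "0 \<le> cos g / c" "cos g / c \<le> 1" using cg assms(4) by simp_all
  qed
  show ?thesis
  proof (cases "m * g < pi / 2")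
    case False
    then show ?thesis
      using arccos_le_pi2[OF r] by linarith
  next
    case True
    have "g \<le> m * g" using assms(1,2) mult_right_mono[of 1 m g] by simp
    then have cos_pos: "0 < cos g" "0 < cos (m * g)"
      using True assms(2) by (auto intro!: cos_gt_zero_pi)
    then have "m * sin g * cos (m * g) \<le> sin (m * g) * cos g"
      using tan_mult_ge[OF assms(1,2) True] by (simp add: tan_def field_simps)
    moreover have "0 \<le> m * sin g * cos (m * g)"
      using assms cos_pos by (auto intro!: mult_nonneg_nonneg sin_ge_zero)
    ultimately have "(m * sin g * cos (m * g))\<^sup>2 \<le> (sin (m * g) * cos g)\<^sup>2"
      by (rule power_mono)
    also have "\<dots> = (cos g)\<^sup>2 - (cos g * cos (m * g))\<^sup>2"
      by (simp add: power_mult_distrib sin_squared_eq algebra_simps)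
    finally have "(c * cos (m * g))\<^sup>2 \<le> (cos g)\<^sup>2"
      unfolding power_mult_distrib assms(5) by (simp add: algebra_simps)
    then have "c * cos (m * g) \<le> cos g"
      using cg by (rule power2_le_imp_le)
    then have "cos (m * g) \<le> cos g / c"
      using assms(4) by (simp add: field_simps)
    then have "arccos (cos g / c) \<le> arccos (cos (m * g))"
      using r by (intro arccos_le_arccos) auto
    also have "\<dots> = m * g"
    proof (rule arccos_cos)
      show "0 \<le> m * g" using assms(1,2) by simp
      show "m * g \<le> pi" using True pi_gt_zero by linarith
    qed
    finally show ?thesis .
  qed
qed

lemma arccos_cos_div_ge:
  fixes g c :: real
  assumes "0 \<le> g" "g \<le> pi / 2" "1 \<le> c"
  shows "g \<le> arccos (cos g / c)"
proof -
  have cg: "0 \<le> cos g" using assms by (intro cos_ge_zero) auto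
  then have "cos g / c \<le> cos g" "0 \<le> cos g / c"
    using assms(3) by (simp_all add: divide_le_eq mult_le_cancel_left1)
  then have "arccos (cos g) \<le> arccos (cos g / c)"
    by (intro arccos_le_arccos) auto
  moreover have "arccos (cos g) = g"
    using assms by (intro arccos_cos) auto
  ultimately show ?thesis by simp
qed

text \<open>In use \<open>p\<close> is \<pi>, \<open>q\<close> is \<open>ratio b\<close>,
  \<open>g\<close> is \<open>\<gamma> / 2\<close> and \<open>A\<close> is
  \<open>arccos (abs_mu C b)\<close>. Treating the products \<open>p * q\<close> and
  \<open>q * g\<close> as variables leaves linear statements.\<close>

lemma angle_inequalities:
  fixes p g q A :: real
  shows "p / 2 - A < q * (p / 2 - g) \<Longrightarrow> p * q - p < (2 * p - 2 * g) * q - 2 * (p - A)"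
    and "A \<le> q * g \<Longrightarrow> p = (2 * p - 2 * g) * q - 2 * (p - A) \<Longrightarrow> p * 3 \<le> p * (2 * q)"
    and "p / 2 - A < q * (p / 2 - g) \<Longrightarrow> p = 2 * g * q - 2 * A \<Longrightarrow> p * 2 < p * q"
proof -
  have e: "q * (p / 2 - g) = p * q / 2 - q * g" "(2 * p - 2 * g) * q = 2 * (p * q) - 2 * (q * g)"
    "p * (2 * q) = 2 * (p * q)" "2 * g * q = 2 * (q * g)"
    by (simp_all add: algebra_simps)
  have lin: "P - p < (2 * P - 2 * G) - 2 * (p - A)" if "p / 2 - A < P / 2 - G" for P G
    using that by (simp add: field_simps)
  have lin': "p * 3 \<le> 2 * P" if "A \<le> G" "p = (2 * P - 2 * G) - 2 * (p - A)" for P G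
    using that by argo
  have lin'': "p * 2 < P" if "p / 2 - A < P / 2 - G" "p = 2 * G - 2 * A" for P G
    using that by argo
  show "p * q - p < (2 * p - 2 * g) * q - 2 * (p - A)" if "p / 2 - A < q * (p / 2 - g)"
    using lin that unfolding e by blast
  show "p * 3 \<le> p * (2 * q)" if "A \<le> q * g" "p = (2 * p - 2 * g) * q - 2 * (p - A)"
    using lin' that unfolding e by blast
  show "p * 2 < p * q" if "p / 2 - A < q * (p / 2 - g)" "p = 2 * g * q - 2 * A"
    using lin'' that unfolding e by blast
qed

lemma arcsin_div_tendsto: "((\<lambda>x. arcsin (x * s) / x) \<longlongrightarrow> s) (at_right 0)"
proof -
  have "((\<lambda>x. arcsin (x * s)) has_real_derivative s) (at 0)"
    by (auto intro!: derivative_eq_intros)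
  from DERIV_D[OF this] show ?thesis
    by (auto intro: tendsto_within_subset)
qed

lemma arsinh_div_tendsto: "((\<lambda>x. arsinh (x * s) / x) \<longlongrightarrow> (s :: real)) (at_right 0)"
proof -
  have "((\<lambda>x. arsinh (x * s)) has_real_derivative 1 / sqrt ((0 * s)\<^sup>2 + 1) * s) (at 0)"
    by (rule DERIV_chain2[where f = arsinh and g = "\<lambda>x. x * s", OF arsinh_real_has_field_derivative])
      (auto intro!: derivative_eq_intros)
  from DERIV_D[OF this] show ?thesis
    by (auto intro: tendsto_within_subset)
qed

text \<open>The equations are solved for \<open>\<kappa> = sqrt (b\<^sup>2 - 1)\<close>:
  \<open>\<gamma> / 2\<close> is then the explicit function \<open>arcsin (\<kappa> * s)\<close>,
  and \<open>0 < \<kappa> < 1 / s\<close> corresponds to \<open>1 < b < c / s\<close>.\<close>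

lemma fast_param:
  assumes C: "C \<in> SO21" and "C$1$1 \<noteq> 1" and \<kappa>: "0 < \<kappa>"
  defines "s \<equiv> sqrt ((C$1$1 - 1) / 2)" and "c \<equiv> sqrt ((1 + C$1$1) / 2)" and "b \<equiv> sqrt (1 + \<kappa>\<^sup>2)"
  assumes "\<kappa> * s < 1"
  defines "g \<equiv> arcsin (\<kappa> * s)"
  shows "1 < b" "sqrt (b\<^sup>2 - 1) = \<kappa>" "b / \<kappa> = ratio b" "b < c / s" "0 < g" "g < pi / 2"
    "cos (2 * g) = b\<^sup>2 - C$1$1 * (b\<^sup>2 - 1)" "abs_mu C b = cos g / c" "sqrt (1 - (\<kappa> * s)\<^sup>2) = cos g"
    "c\<^sup>2 = (cos g)\<^sup>2 + (b / \<kappa> * sin g)\<^sup>2"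
proof -
  note H = half_angle[OF C, folded s_def c_def]
  have s: "0 < s" unfolding s_def by (rule half_angle_pos[OF C assms(2)])
  have b2: "b\<^sup>2 = 1 + \<kappa>\<^sup>2" by (simp add: b_def)
  show "1 < b" using \<kappa> by (simp add: b_def)
  show "sqrt (b\<^sup>2 - 1) = \<kappa>" using \<kappa> by (simp add: b2)
  then show "b / \<kappa> = ratio b" by (simp add: ratio_def)
  have ks: "0 < \<kappa> * s" using \<kappa> s by simp
  show "b < c / s"
  proof -
    have "(\<kappa> * s)\<^sup>2 < 1\<^sup>2" using ks \<open>\<kappa> * s < 1\<close> by (intro power_strict_mono) auto
    then have "(b * s)\<^sup>2 < c\<^sup>2"
      unfolding power_mult_distrib b2 H(3) by (simp add: algebra_simps)
    then have "b * s < c" using H(2) by (auto intro: power_less_imp_less_base)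
    then show ?thesis using s by (simp add: field_simps)
  qed
  have sg: "sin g = \<kappa> * s" using ks \<open>\<kappa> * s < 1\<close> by (simp add: g_def)
  show "0 < g" using arcsin_less_arcsin[of 0 "\<kappa> * s"] ks \<open>\<kappa> * s < 1\<close> by (simp add: g_def)
  show "g < pi / 2" using arcsin_lt_bounded[of "\<kappa> * s"] ks \<open>\<kappa> * s < 1\<close> by (simp add: g_def)
  show "cos (2 * g) = b\<^sup>2 - C$1$1 * (b\<^sup>2 - 1)"
    unfolding cos_double_sin sg b2 H(4) by (simp add: power_mult_distrib algebra_simps)
  show cg: "sqrt (1 - (\<kappa> * s)\<^sup>2) = cos g"
    using ks \<open>\<kappa> * s < 1\<close> by (simp add: g_def cos_arcsin)
  have "c\<^sup>2 - b\<^sup>2 * s\<^sup>2 = 1 - (\<kappa> * s)\<^sup>2"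
    unfolding H(3) b2 by (simp add: power_mult_distrib algebra_simps)
  then show "abs_mu C b = cos g / c"
    unfolding H(6) by (simp add: cg)
  have "(b / \<kappa> * sin g)\<^sup>2 = (1 + \<kappa>\<^sup>2) * s\<^sup>2"
    unfolding sg power_mult_distrib power_divide b2 using \<kappa> by simp
  then show "c\<^sup>2 = (cos g)\<^sup>2 + (b / \<kappa> * sin g)\<^sup>2"
    unfolding cos_squared_eq sg H(3) by (simp add: power_mult_distrib algebra_simps)
qed

section \<open>Solvability of the relations\<close>

lemma rel_I_ex:
  assumes "0 < abs_eta C" "abs_eta C \<le> pi"
  obtains b where "1 < b" "ratio b = (abs_eta C + 2 * pi) / (2 * pi)" "rel_I C b (2 * pi / sqrt (b\<^sup>2 - 1))"
proof -
  \<comment> \<open>\<open>eq_I\<close> amounts to \<open>ratio b = k\<close>, which the involution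
    solves; \<open>abs_eta C \<le> pi\<close> gives \<open>k \<le> 3 / 2\<close>.\<close>
  define k where "k = (abs_eta C + 2 * pi) / (2 * pi)"
  have k: "1 < k" "k \<le> 3 / 2" using assms by (simp_all add: k_def field_simps)
  define b where "b = ratio k"
  have b: "1 < b" "ratio b = k"
    using k(1) by (simp_all add: b_def ratio_gt_1 ratio_ratio)
  have "3 / sqrt 5 \<le> b"
    using ratio_less_iff(2)[OF b(1), of "3 / 2"] b(2) k(2) by (simp add: ratio_values not_less[symmetric])
  moreover have "2 * b * pi / sqrt (b\<^sup>2 - 1) = abs_eta C + 2 * pi"
    using b(2) by (simp add: ratio_def k_def field_simps)
  ultimately have "rel_I C b (2 * pi / sqrt (b\<^sup>2 - 1))"
    by (simp add: rel_I_def eq_I_def abs_eta_def)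
  with b show ?thesis by (intro that) (simp_all add: k_def)
qed

text \<open>Here \<open>ratio b = c\<close>, so the lower bound on \<open>b\<close> amounts to
  \<open>c \<le> 2\<close>. This is \<open>\<pi> (c - 1) = abs_eta C \<le> \<pi>\<close>, with
  equality exactly for the angle \<pi>.\<close>

lemma rel_II_ex:
  assumes C: "C \<in> SO21" and "C$1$1 \<noteq> 1" "abs_eta C = theta C"
  shows "\<exists>b d. rel_II C b d"
proof -
  define s c where "s = sqrt ((C$1$1 - 1) / 2)" and "c = sqrt ((1 + C$1$1) / 2)"
  note H = half_angle[OF C, folded s_def c_def]
  have s: "0 < s" unfolding s_def by (rule half_angle_pos[OF C assms(2)])
  define b where "b = c / s"
  have b2: "b\<^sup>2 - 1 = (1 / s)\<^sup>2"
    using s by (simp add: b_def power_divide H(3) field_simps)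
  have "sqrt (b\<^sup>2 - 1) = 1 / s" unfolding b2 using s by simp
  then have rb: "ratio b = c" using s by (simp add: ratio_def b_def)
  have "s < c" using H(2,3) by (auto intro: power_less_imp_less_base[of _ 2])
  then have b1: "1 < b" using s by (simp add: b_def)
  have "c - 1 \<le> 1"
    using SO21_abs_eta(2)[OF C] assms(3) unfolding H(8) by simp
  then have "2 / sqrt 3 \<le> b"
    using ratio_less_iff(2)[OF b1, of 2] rb by (simp add: ratio_values not_less[symmetric])
  moreover have "abs_eta C = pi" if "b = 2 / sqrt 3"
  proof -
    have "c = 2" using that rb ratio_ratio[of 2] by (simp add: ratio_values)
    then show ?thesis using assms(3) H(8) by simp
  qed
  ultimately have "rel_II C b (pi * s)"
    unfolding rel_II_def H(7) by (auto simp: b_def s_def)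
  then show ?thesis by blast
qed

lemma rel_III_ex:
  assumes C: "C \<in> SO21" and "0 < abs_eta C" "theta C < abs_eta C"
  shows "\<exists>b d \<gamma>. rel_III C b \<gamma> d"
proof (cases "C$1$1 = 1")
  case True
  have eta: "abs_eta C \<le> pi" by (rule SO21_abs_eta(2)[OF C])
  obtain b where b: "1 < b" "ratio b = (abs_eta C + 2 * pi) / (2 * pi)" "rel_I C b (2 * pi / sqrt (b\<^sup>2 - 1))"
    using rel_I_ex[OF assms(2) eta] .
  have rb: "2 * pi * ratio b = abs_eta C + 2 * pi" using b(2) by simp
  have "abs_eta C + 2 * pi < 2 * (2 * pi)" using eta pi_gt_zero by linarith
  then have "ratio b < 2" unfolding b(2) by (simp add: divide_less_eq)
  then have "2 / sqrt 3 < b"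
    using ratio_less_iff(1)[OF b(1), of 2] by (simp add: ratio_values)
  moreover have "b \<le> 3 / sqrt 5" if "abs_eta C = pi"
    using ratio_less_iff(1)[OF b(1), of "3 / 2"] b(2) that by (simp add: ratio_values not_less[symmetric])
  moreover have "abs_mu C b = 1" using True by (simp add: abs_mu_def)
  \<comment> \<open>For \<open>C$1$1 = 1\<close> the last condition becomes
    \<open>cos \<gamma> = 1\<close>, so \<open>\<gamma> = 0\<close> and the arc covers the whole
    period.\<close>
  ultimately have "rel_III C b 0 (2 * pi / sqrt (b\<^sup>2 - 1))"
    using rb True unfolding rel_III_def by (simp add: ratio_def)
  then show ?thesis by blast
next
  case False
  define s c where "s = sqrt ((C$1$1 - 1) / 2)" and "c = sqrt ((1 + C$1$1) / 2)"
  note H = half_angle[OF C, folded s_def c_def]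
  have s: "0 < s" unfolding s_def by (rule half_angle_pos[OF C False])
  have eta: "abs_eta C \<le> pi" by (rule SO21_abs_eta(2)[OF C])
  define E where "E \<kappa> = (2 * pi - 2 * arcsin (\<kappa> * s)) * (sqrt (1 + \<kappa>\<^sup>2) / \<kappa>)
      - 2 * arccos (- (sqrt (1 - (\<kappa> * s)\<^sup>2) / c))" for \<kappa>
  have root: "0 \<le> sqrt (1 - (\<kappa> * s)\<^sup>2) / c" "sqrt (1 - (\<kappa> * s)\<^sup>2) / c \<le> 1" if "\<kappa> * s \<le> 1" "0 < \<kappa>" for \<kappa>
  proof -
    have "0 \<le> 1 - (\<kappa> * s)\<^sup>2" using that s by (simp add: power_le_one)
    moreover have "sqrt (1 - (\<kappa> * s)\<^sup>2) \<le> 1" by simp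
    then have "sqrt (1 - (\<kappa> * s)\<^sup>2) \<le> c" using H(2) by linarith
    ultimately show "0 \<le> sqrt (1 - (\<kappa> * s)\<^sup>2) / c" "sqrt (1 - (\<kappa> * s)\<^sup>2) / c \<le> 1"
      using H(2) by (simp_all add: divide_le_eq_1)
  qed
  \<comment> \<open>For \<open>\<kappa> \<le> 1 / 3\<close> the factor \<open>b / \<kappa>\<close>
    is at least 3, so the first term of \<open>E\<close> is at least \<open>3 \<pi>\<close>. The
    second takes away at most \<open>2 \<pi>\<close>, which leaves at least
    \<open>\<pi> \<ge> abs_eta C\<close>.\<close>
  define \<kappa>0 where "\<kappa>0 = min (1 / 3) (1 / s)"
  have \<kappa>0: "0 < \<kappa>0" "\<kappa>0 \<le> 1 / s" "\<kappa>0 \<le> 1 / 3" using s by (simp_all add: \<kappa>0_def)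
  have ks: "\<kappa> * s \<le> 1" "0 < \<kappa>" "- 1 \<le> \<kappa> * s" if "\<kappa> \<in> {\<kappa>0..1 / s}" for \<kappa>
  proof -
    show "0 < \<kappa>" using that \<kappa>0 by simp
    then have "0 \<le> \<kappa> * s" using s by simp
    then show "- 1 \<le> \<kappa> * s" by linarith
    show "\<kappa> * s \<le> 1" using that s by (simp add: field_simps)
  qed
  have "continuous_on {\<kappa>0..1 / s} E"
    unfolding E_def
  proof (intro continuous_intros ballI conjI)
    fix \<kappa> assume "\<kappa> \<in> {\<kappa>0..1 / s}"
    note k = ks[OF this]
    show "\<kappa> * s \<le> 1" "- 1 \<le> \<kappa> * s" "\<kappa> \<noteq> 0" using k by auto
    show "- 1 \<le> - (sqrt (1 - (\<kappa> * s)\<^sup>2) / c)" "- (sqrt (1 - (\<kappa> * s)\<^sup>2) / c) \<le> 1"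
      using root[OF k(1,2)] by linarith+
    show "c \<noteq> 0" using H(2) by simp
  qed
  \<comment> \<open>At \<open>\<kappa> = 1 / s\<close> one has \<open>\<gamma> = \<pi>\<close>. The
    family of \<open>rel_IVc\<close> ends with the same value: the two halves of the period meet at
    \<open>theta C\<close>.\<close>
  moreover have E_end: "E (1 / s) = theta C"
  proof -
    have "1 + (1 / s)\<^sup>2 = (c / s)\<^sup>2" using s by (simp add: power_divide H(3) field_simps)
    then have "sqrt (1 + (1 / s)\<^sup>2) = c / s" using s H(2) by simp
    then show ?thesis using s by (simp add: E_def H(8) algebra_simps)
  qed
  moreover have "abs_eta C \<le> E \<kappa>0"
  proof -
    define g where "g = arcsin (\<kappa>0 * s)"
    have k: "\<kappa>0 * s \<le> 1" "0 \<le> \<kappa>0 * s" "- 1 \<le> \<kappa>0 * s"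
      using ks[of \<kappa>0] \<kappa>0 s by auto
    have g: "0 \<le> g" "g \<le> pi / 2"
      using arcsin_le_arcsin[of 0 "\<kappa>0 * s"] arcsin_bounded[of "\<kappa>0 * s"] k by (simp_all add: g_def)
    have cg: "sqrt (1 - (\<kappa>0 * s)\<^sup>2) / c = cos g / c"
      using k by (simp add: g_def cos_arcsin)
    have "arccos (- (sqrt (1 - (\<kappa>0 * s)\<^sup>2) / c)) = pi - arccos (cos g / c)"
      using root[OF k(1) \<kappa>0(1)] unfolding cg by (simp add: arccos_minus)
    moreover have "0 \<le> arccos (cos g / c)"
      using arccos_cos_div_ge[OF g H(2)] g by simp
    moreover have "3 \<le> sqrt (1 + \<kappa>0\<^sup>2) / \<kappa>0"
    proof -
      have "3 * \<kappa>0 \<le> 1" using \<kappa>0(3) by simp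
      also have "1 \<le> sqrt (1 + \<kappa>0\<^sup>2)" by simp
      finally show ?thesis using \<kappa>0(1) by (simp add: field_simps)
    qed
    then have "pi * 3 \<le> (2 * pi - 2 * g) * (sqrt (1 + \<kappa>0\<^sup>2) / \<kappa>0)"
      using g by (intro mult_mono) auto
    ultimately show ?thesis
      using eta unfolding E_def g_def[symmetric] by linarith
  qed
  ultimately obtain \<kappa> where \<kappa>: "\<kappa>0 \<le> \<kappa>" "\<kappa> \<le> 1 / s" "E \<kappa> = abs_eta C"
    using IVT2'[of E "1 / s" "abs_eta C" \<kappa>0] \<kappa>0(2) assms(3) by auto
  have "\<kappa> \<noteq> 1 / s" using \<kappa>(3) E_end assms(3) by auto
  then have \<kappa>': "0 < \<kappa>" "\<kappa> * s < 1" using \<kappa> \<kappa>0(1) s by (auto simp: field_simps)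
  define b g where "b = sqrt (1 + \<kappa>\<^sup>2)" and "g = arcsin (\<kappa> * s)"
  note F = fast_param[OF C False \<kappa>'(1), folded s_def c_def b_def, OF \<kappa>'(2), folded g_def]
  have am: "arccos (- abs_mu C b) = pi - arccos (cos g / c)"
    using root[OF less_imp_le[OF \<kappa>'(2)] \<kappa>'(1)] unfolding F(8,9) by (simp add: arccos_minus)
  have eq: "abs_eta C = (2 * pi - 2 * g) * (b / \<kappa>) - 2 * arccos (- abs_mu C b)"
    using \<kappa>(3) unfolding E_def F(8) F(9) b_def[symmetric] g_def[symmetric] by simp
  define q where "q = b / \<kappa>"
  note q = F(3)[folded q_def] and eq = eq[folded q_def]
  have m: "1 < q" unfolding q by (rule ratio_gt_1[OF F(1)])
  \<comment> \<open>Dividing the cosine by \<open>c \<ge> 1\<close> cannot decrease the angle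
    \<open>g\<close>. With \<open>q > 1\<close> this gives
    \<open>\<pi> q - \<pi> < abs_eta C \<le> \<pi>\<close>, hence \<open>q < 2\<close>, which is the
    lower bound on \<open>b\<close>.\<close>
  have "pi / 2 - arccos (cos g / c) < q * (pi / 2 - g)"
  proof -
    have "pi / 2 - arccos (cos g / c) \<le> 1 * (pi / 2 - g)"
      using arccos_cos_div_ge[of g c] F(5,6) H(2) by simp
    also have "\<dots> < q * (pi / 2 - g)"
      using m F(6) by (intro mult_strict_right_mono) auto
    finally show ?thesis .
  qed
  then have "pi * q - pi < abs_eta C"
    unfolding eq am by (rule angle_inequalities(1))
  then have "pi * q < pi * 2" using eta by linarith
  then have "q < 2" by (simp only: mult_less_cancel_left_pos[OF pi_gt_zero])
  then have "2 / sqrt 3 < b"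
    using ratio_less_iff(1)[OF F(1), of 2] q by (simp add: ratio_values)
  moreover have "b \<le> 3 / sqrt 5" if "abs_eta C = pi"
  proof -
    have "arccos (cos g / c) \<le> q * g"
      using m F(5,6) H(2) F(10)[folded q_def] by (intro arccos_le_mult) auto
    then have "pi * 3 \<le> pi * (2 * q)"
      by (rule angle_inequalities(2)) (rule eq[unfolded am that])
    then have "3 \<le> 2 * q" by (simp only: mult_le_cancel_left_pos[OF pi_gt_zero])
    then show ?thesis
      using ratio_less_iff(1)[OF F(1), of "3 / 2"] q by (simp add: ratio_values not_less[symmetric])
  qed
  ultimately have "rel_III C b (2 * g) ((2 * pi - 2 * g) / sqrt (b\<^sup>2 - 1))"
    unfolding rel_III_def F(2) H(7) using eq[unfolded q_def] F(4,5,6,7) by auto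
  then show ?thesis by blast
qed

lemma rel_IVb_ex:
  assumes C: "C \<in> SO21" and "C$1$1 \<noteq> 1" "0 < abs_eta C" "abs_eta C < alpha C"
  shows "\<exists>b d. rel_IVb C b d"
proof -
  define s c where "s = sqrt ((C$1$1 - 1) / 2)" and "c = sqrt ((1 + C$1$1) / 2)"
  note H = half_angle[OF C, folded s_def c_def]
  have s: "0 < s" unfolding s_def by (rule half_angle_pos[OF C assms(2)])
  have "1 < c" unfolding H(5) using s by simp
  define E where "E \<kappa> = 2 * (sqrt (1 - \<kappa>\<^sup>2) * (arsinh (\<kappa> * s) / \<kappa>) - arccos (sqrt (1 + (\<kappa> * s)\<^sup>2) / c))" for \<kappa>
  \<comment> \<open>The end \<open>b = 1\<close> is approached by a limit, as
    \<open>x / 0 = 0\<close> gives \<open>E 0\<close> another value; \<open>\<kappa>0\<close> is a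
    small number at which \<open>E\<close> still exceeds \<open>abs_eta C\<close>. At the other end,
    \<open>\<kappa> = 1\<close>, \<open>b\<close> and \<open>E\<close> vanish.\<close>
  have "(E \<longlongrightarrow> 2 * (sqrt (1 - 0\<^sup>2) * s - arccos (sqrt (1 + (0 * s)\<^sup>2) / c))) (at_right 0)"
    unfolding E_def
  proof (intro tendsto_intros arsinh_div_tendsto isCont_tendsto_compose[OF isCont_arccos])
    show "- 1 < sqrt (1 + (0 * s)\<^sup>2) / c" "sqrt (1 + (0 * s)\<^sup>2) / c < 1" "c \<noteq> 0"
      using \<open>1 < c\<close> by (auto simp: field_simps)
  qed
  then have "(E \<longlongrightarrow> alpha C) (at_right 0)"
    by (simp add: H(9))
  from order_tendstoD(1)[OF this assms(4)] eventually_at_right_real[of 0 1]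
  have "\<forall>\<^sub>F \<kappa> in at_right 0. abs_eta C < E \<kappa> \<and> \<kappa> \<in> {0<..<1}"
    by (auto intro: eventually_conj)
  then obtain \<kappa>0 where \<kappa>0: "abs_eta C < E \<kappa>0" "0 < \<kappa>0" "\<kappa>0 < 1"
    using eventually_happens'[OF trivial_limit_at_right_real] by force
  have "continuous_on {\<kappa>0..1} E"
    unfolding E_def
  proof (intro continuous_intros ballI conjI)
    fix \<kappa> assume k: "\<kappa> \<in> {\<kappa>0..1}"
    show "\<kappa> \<noteq> 0" using k \<kappa>0 by simp
    show "c \<noteq> 0" using \<open>1 < c\<close> by simp
    have "\<kappa> * s \<le> 1 * s" "0 \<le> \<kappa> * s" using k \<kappa>0 s by (auto intro: mult_right_mono)
    then have "(\<kappa> * s)\<^sup>2 \<le> s\<^sup>2" by (intro power_mono) auto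
    then have "sqrt (1 + (\<kappa> * s)\<^sup>2) \<le> c" unfolding H(5) by simp
    then show "sqrt (1 + (\<kappa> * s)\<^sup>2) / c \<le> 1" using \<open>1 < c\<close> by simp
    have "0 \<le> sqrt (1 + (\<kappa> * s)\<^sup>2) / c" using \<open>1 < c\<close> by simp
    then show "- 1 \<le> sqrt (1 + (\<kappa> * s)\<^sup>2) / c" by linarith
  qed
  moreover have E1: "E 1 = 0"
    using \<open>1 < c\<close> by (simp add: E_def H(5)[symmetric])
  ultimately obtain \<kappa> where \<kappa>: "\<kappa>0 \<le> \<kappa>" "\<kappa> \<le> 1" "E \<kappa> = abs_eta C"
    using IVT2'[of E 1 "abs_eta C" \<kappa>0] \<kappa>0 assms(3) by auto
  have "\<kappa> \<noteq> 1" using \<kappa>(3) E1 assms(3) by auto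
  then have \<kappa>': "0 < \<kappa>" "\<kappa> < 1" using \<kappa> \<kappa>0 by auto
  define b where "b = sqrt (1 - \<kappa>\<^sup>2)"
  have k2: "0 < \<kappa>\<^sup>2" "\<kappa>\<^sup>2 < 1" using \<kappa>' by (simp_all add: power_less_one_iff)
  then have b: "0 < b" "b < 1" "b\<^sup>2 = 1 - \<kappa>\<^sup>2" by (simp_all add: b_def)
  have bk: "sqrt (1 - b\<^sup>2) = \<kappa>" using \<kappa>' by (simp add: b(3))
  note mu = abs_mu_slow[OF C b(3) less_imp_le[OF \<kappa>'(1)], folded s_def c_def]
  have "rel_IVb C b (2 / sqrt (1 - b\<^sup>2) * arcosh (c * abs_mu C b))"
    unfolding rel_IVb_def c_def[symmetric] bk mu(2)
    using b \<kappa>(3) by (simp add: E_def mu(1) b_def[symmetric])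
  then show ?thesis by blast
qed

text \<open>The angle as a function of \<kappa> tends to \<open>alpha C\<close> as \<kappa> tends to
  0 and equals \<open>theta C\<close> at the half period \<open>\<kappa> = 1 / s\<close>, so it
  takes every value strictly in between.\<close>

lemma rel_IVc_ex:
  assumes C: "C \<in> SO21" and "C$1$1 \<noteq> 1" "alpha C < abs_eta C" "abs_eta C < theta C"
  shows "\<exists>b d \<gamma>. rel_IVc C b \<gamma> d"
proof -
  define s c where "s = sqrt ((C$1$1 - 1) / 2)" and "c = sqrt ((1 + C$1$1) / 2)"
  note H = half_angle[OF C, folded s_def c_def]
  have s: "0 < s" unfolding s_def by (rule half_angle_pos[OF C assms(2)])
  have "1 < c" unfolding H(5) using s by simp
  define E where "E \<kappa> = 2 * (sqrt (1 + \<kappa>\<^sup>2) * (arcsin (\<kappa> * s) / \<kappa>) - arccos (sqrt (1 - (\<kappa> * s)\<^sup>2) / c))" for \<kappa>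
  have "(E \<longlongrightarrow> 2 * (sqrt (1 + 0\<^sup>2) * s - arccos (sqrt (1 - (0 * s)\<^sup>2) / c))) (at_right 0)"
    unfolding E_def
  proof (intro tendsto_intros arcsin_div_tendsto isCont_tendsto_compose[OF isCont_arccos])
    show "- 1 < sqrt (1 - (0 * s)\<^sup>2) / c" "sqrt (1 - (0 * s)\<^sup>2) / c < 1" "c \<noteq> 0"
      using \<open>1 < c\<close> by (auto simp: field_simps)
  qed
  then have "(E \<longlongrightarrow> alpha C) (at_right 0)"
    by (simp add: H(9))
  from order_tendstoD(2)[OF this assms(3)] eventually_at_right_real[of 0 "1 / s"] s
  have "\<forall>\<^sub>F \<kappa> in at_right 0. E \<kappa> < abs_eta C \<and> \<kappa> \<in> {0<..<1 / s}"
    by (auto intro: eventually_conj)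
  then obtain \<kappa>0 where \<kappa>0: "E \<kappa>0 < abs_eta C" "0 < \<kappa>0" "\<kappa>0 < 1 / s"
    using eventually_happens'[OF trivial_limit_at_right_real] by force
  have "continuous_on {\<kappa>0..1 / s} E"
    unfolding E_def
  proof (intro continuous_intros ballI conjI)
    fix \<kappa> assume k: "\<kappa> \<in> {\<kappa>0..1 / s}"
    show "\<kappa> \<noteq> 0" using k \<kappa>0 by simp
    show "c \<noteq> 0" using \<open>1 < c\<close> by simp
    have ks: "0 \<le> \<kappa> * s" "\<kappa> * s \<le> 1" using k \<kappa>0 s by (auto simp: field_simps)
    then show "\<kappa> * s \<le> 1" "- 1 \<le> \<kappa> * s" by linarith+
    have "0 \<le> 1 - (\<kappa> * s)\<^sup>2" using ks by (simp add: power_le_one)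
    moreover have "sqrt (1 - (\<kappa> * s)\<^sup>2) \<le> 1" by simp
    then have "sqrt (1 - (\<kappa> * s)\<^sup>2) \<le> c" using \<open>1 < c\<close> by linarith
    ultimately have "0 \<le> sqrt (1 - (\<kappa> * s)\<^sup>2) / c" "sqrt (1 - (\<kappa> * s)\<^sup>2) / c \<le> 1"
      using \<open>1 < c\<close> by simp_all
    then show "sqrt (1 - (\<kappa> * s)\<^sup>2) / c \<le> 1" "- 1 \<le> sqrt (1 - (\<kappa> * s)\<^sup>2) / c" by linarith+
  qed
  moreover have E_end: "E (1 / s) = theta C"
  proof -
    have "1 + (1 / s)\<^sup>2 = (c / s)\<^sup>2" using s by (simp add: power_divide H(3) field_simps)
    then have "sqrt (1 + (1 / s)\<^sup>2) = c / s" using s H(2) by simp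
    then show ?thesis using s by (simp add: E_def H(8) algebra_simps)
  qed
  ultimately obtain \<kappa> where \<kappa>: "\<kappa>0 \<le> \<kappa>" "\<kappa> \<le> 1 / s" "E \<kappa> = abs_eta C"
    using IVT'[of E \<kappa>0 "abs_eta C" "1 / s"] \<kappa>0 assms(4) by auto
  have "\<kappa> \<noteq> 1 / s" using \<kappa>(3) E_end assms(4) by auto
  then have \<kappa>': "0 < \<kappa>" "\<kappa> * s < 1" using \<kappa> \<kappa>0(2) s by (auto simp: field_simps)
  define b g where "b = sqrt (1 + \<kappa>\<^sup>2)" and "g = arcsin (\<kappa> * s)"
  note F = fast_param[OF C assms(2) \<kappa>'(1), folded s_def c_def b_def, OF \<kappa>'(2), folded g_def]
  have eq: "abs_eta C = 2 * g * (b / \<kappa>) - 2 * arccos (abs_mu C b)"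
    using \<kappa>(3) unfolding E_def F(8) F(9) b_def[symmetric] g_def[symmetric] by (simp add: algebra_simps)
  define q where "q = b / \<kappa>"
  note q = F(3)[folded q_def] and eq = eq[folded q_def]
  have m: "1 < q" unfolding q by (rule ratio_gt_1[OF F(1)])
  have "b < 2 / sqrt 3" if "abs_eta C = pi"
  proof -
    have "pi / 2 - arccos (cos g / c) \<le> 1 * (pi / 2 - g)"
      using arccos_cos_div_ge[of g c] F(5,6) H(2) by simp
    also have "\<dots> < q * (pi / 2 - g)"
      using m F(6) by (intro mult_strict_right_mono) auto
    finally have "pi * 2 < pi * q"
      by (rule angle_inequalities(3)) (rule eq[unfolded F(8) that])
    then have "2 < q" by (simp only: mult_less_cancel_left_pos[OF pi_gt_zero])
    then show ?thesis
      using ratio_less_iff(2)[OF F(1), of 2] q by (simp add: ratio_values)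
  qed
  then have "rel_IVc C b (2 * g) (2 * g / sqrt (b\<^sup>2 - 1))"
    unfolding rel_IVc_def F(2) H(7) using eq[unfolded q_def] F(1,4,5,6,7) by auto
  then show ?thesis by blast
qed

theorem theorem4:
  fixes C :: mat3
  assumes "C \<in> SO21"
  shows
    "let d = sr_dist (mat 1) C in
     \<comment> \<open>0\<close>
     (C \<in> Sim \<longrightarrow> rel_0 C d) \<and>
     \<comment> \<open>I to IV, for every parameter of a shortest arc\<close>
     (C \<notin> Sim \<longrightarrow> (\<forall>\<beta>. shortest_arc_param C \<beta> \<longrightarrow>
       (C \<in> SO2 \<longrightarrow> rel_I C \<bar>\<beta>\<bar> d \<and> (\<forall>b>1. eq_I C b \<longrightarrow> b = \<bar>\<beta>\<bar>)) \<and>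
       (abs_eta C = theta C \<longrightarrow> rel_II C \<bar>\<beta>\<bar> d) \<and>
       (abs_eta C > theta C \<longrightarrow> (\<exists>\<gamma>. rel_III C \<bar>\<beta>\<bar> \<gamma> d)) \<and>
       (abs_eta C < theta C \<longrightarrow>
          (abs_eta C = alpha C \<longrightarrow> rel_IVa C \<bar>\<beta>\<bar> d) \<and>
          (abs_eta C < alpha C \<longrightarrow> rel_IVb C \<bar>\<beta>\<bar> d) \<and>
          (abs_eta C > alpha C \<longrightarrow> (\<exists>\<gamma>. rel_IVc C \<bar>\<beta>\<bar> \<gamma> d))))) \<and>
     \<comment> \<open>V\<close>
     (C \<in> Sim \<longrightarrow> (\<forall>x. rel_0 C x \<longleftrightarrow> x = d)) \<and>
     (C \<notin> Sim \<longrightarrow>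
       (C \<in> SO2 \<longrightarrow> (\<forall>x. (\<exists>b. rel_I C b x) \<longleftrightarrow> x = d)) \<and>
       (abs_eta C = theta C \<longrightarrow> (\<forall>x. (\<exists>b. rel_II C b x) \<longleftrightarrow> x = d)) \<and>
       (abs_eta C > theta C \<longrightarrow> (\<forall>x. (\<exists>b \<gamma>. rel_III C b \<gamma> x) \<longleftrightarrow> x = d)) \<and>
       (abs_eta C < theta C \<longrightarrow>
          (abs_eta C = alpha C \<longrightarrow> (\<forall>x. (\<exists>b. rel_IVa C b x) \<longleftrightarrow> x = d)) \<and>
          (abs_eta C < alpha C \<longrightarrow> (\<forall>x. (\<exists>b. rel_IVb C b x) \<longleftrightarrow> x = d)) \<and>
          (abs_eta C > alpha C \<longrightarrow> (\<forall>x. (\<exists>b \<gamma>. rel_IVc C b \<gamma> x) \<longleftrightarrow> x = d))))"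
proof (cases "C \<in> Sim")
  case True
  then have "sr_dist (mat 1) C = arcosh (C$1$1)"
    using Sim_iff[OF assms] by (intro extremal_dist[OF assms Sim_extremal[OF assms]]) simp
  with True show ?thesis
    by (simp add: rel_0_def)
next
  case False
  then have eta: "0 < abs_eta C" "abs_eta C \<le> pi"
    using Sim_iff[OF assms] SO21_abs_eta(1,2)[OF assms] by auto
  note concl = case_conclusion[OF assms eta(1) extremal_unique[OF assms _ eta(1)]]
  \<comment> \<open>\<open>C$1$1 = 1\<close> would give
    \<open>theta C = 0 < abs_eta C\<close>.\<close>
  have z1: "C$1$1 \<noteq> 1" if "abs_eta C \<le> theta C"
    using that eta(1) by (auto simp: theta_def)
  have I: "(\<forall>x. (\<exists>b. rel_I C b x) \<longleftrightarrow> x = sr_dist (mat 1) C)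
      \<and> (\<forall>\<beta>. shortest_arc_param C \<beta> \<longrightarrow> rel_I C \<bar>\<beta>\<bar> (sr_dist (mat 1) C))" if "C \<in> SO2"
    using rel_I_extremal[OF SO2_z[OF that]] rel_I_ex[OF eta] by (intro concl) blast+
  \<comment> \<open>\<open>eq_I\<close> fixes \<open>ratio b\<close>, which is injective above 1.
    The range matters: \<open>sqrt\<close> of a negative number is negative, so some
    \<open>b\<close> between -1 and 0 satisfies \<open>eq_I\<close> as well.\<close>
  have I': "b = \<bar>\<beta>\<bar>" if "rel_I C \<bar>\<beta>\<bar> d" "1 < b" "eq_I C b" for b \<beta> d
  proof -
    have "1 < 3 / sqrt 5"
      using real_sqrt_less_mono[of 5 9] by simp
    moreover have "3 / sqrt 5 \<le> \<bar>\<beta>\<bar>" "eq_I C \<bar>\<beta>\<bar>"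
      using that(1) unfolding rel_I_def by blast+
    ultimately have "1 < \<bar>\<beta>\<bar>" "eq_I C \<bar>\<beta>\<bar>"
      by linarith+
    have eq_I_ratio: "eq_I C x \<longleftrightarrow> 2 * pi * ratio x = abs_eta C + 2 * pi" for x
      by (simp add: eq_I_def ratio_def abs_eta_def mult_ac)
    have "2 * pi * ratio b = 2 * pi * ratio \<bar>\<beta>\<bar>"
      using that(3) \<open>eq_I C \<bar>\<beta>\<bar>\<close> unfolding eq_I_ratio by simp
    then have "ratio (ratio b) = ratio (ratio \<bar>\<beta>\<bar>)" by simp
    then show ?thesis
      by (simp only: ratio_ratio[OF that(2)] ratio_ratio[OF \<open>1 < \<bar>\<beta>\<bar>\<close>])
  qed
  have II: "(\<forall>x. (\<exists>b. rel_II C b x) \<longleftrightarrow> x = sr_dist (mat 1) C)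
      \<and> (\<forall>\<beta>. shortest_arc_param C \<beta> \<longrightarrow> rel_II C \<bar>\<beta>\<bar> (sr_dist (mat 1) C))" if "abs_eta C = theta C"
    using rel_II_extremal[OF assms z1 that] rel_II_ex[OF assms z1 that] that by (intro concl) auto
  have III: "(\<forall>x. (\<exists>b \<gamma>. rel_III C b \<gamma> x) \<longleftrightarrow> x = sr_dist (mat 1) C)
      \<and> (\<forall>\<beta>. shortest_arc_param C \<beta> \<longrightarrow> (\<exists>\<gamma>. rel_III C \<bar>\<beta>\<bar> \<gamma> (sr_dist (mat 1) C)))" if "abs_eta C > theta C"
    using rel_III_extremal[OF assms] rel_III_ex[OF assms eta(1) that] by (intro concl) blast+
  have IVa: "(\<forall>x. (\<exists>b. rel_IVa C b x) \<longleftrightarrow> x = sr_dist (mat 1) C)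
      \<and> (\<forall>\<beta>. shortest_arc_param C \<beta> \<longrightarrow> rel_IVa C \<bar>\<beta>\<bar> (sr_dist (mat 1) C))" if "abs_eta C = alpha C"
    using rel_IVa_extremal[OF assms that] by (intro concl) (auto simp: rel_IVa_def)
  have IVb: "(\<forall>x. (\<exists>b. rel_IVb C b x) \<longleftrightarrow> x = sr_dist (mat 1) C)
      \<and> (\<forall>\<beta>. shortest_arc_param C \<beta> \<longrightarrow> rel_IVb C \<bar>\<beta>\<bar> (sr_dist (mat 1) C))"
    if "abs_eta C < theta C" "abs_eta C < alpha C"
    using rel_IVb_extremal[OF assms] rel_IVb_ex[OF assms z1 eta(1) that(2)] that(1) by (intro concl) auto
  have IVc: "(\<forall>x. (\<exists>b \<gamma>. rel_IVc C b \<gamma> x) \<longleftrightarrow> x = sr_dist (mat 1) C)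
      \<and> (\<forall>\<beta>. shortest_arc_param C \<beta> \<longrightarrow> (\<exists>\<gamma>. rel_IVc C \<bar>\<beta>\<bar> \<gamma> (sr_dist (mat 1) C)))"
    if "abs_eta C < theta C" "alpha C < abs_eta C"
    using rel_IVc_extremal[OF assms] rel_IVc_ex[OF assms z1 that(2,1)] that(1) by (intro concl) auto
  note dist = I[THEN conjunct1, rule_format] II[THEN conjunct1, rule_format] III[THEN conjunct1, rule_format]
    IVa[THEN conjunct1, rule_format] IVb[THEN conjunct1, rule_format] IVc[THEN conjunct1, rule_format]
  note param = I[THEN conjunct2, rule_format] II[THEN conjunct2, rule_format] III[THEN conjunct2, rule_format]
    IVa[THEN conjunct2, rule_format] IVb[THEN conjunct2, rule_format] IVc[THEN conjunct2, rule_format]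
  show ?thesis
    unfolding Let_def
    by (intro conjI impI allI;
      (erule notE[OF False] | (rule dist; assumption) | (rule param; assumption) | (rule I'[OF param(1)]; assumption)))
qed

end
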